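(* Let $\mathcal{A}_{g,n}$ and $\mathcal{V}_{g,n}$ be the polynomials in formal intersection numbers defined in the context. (1) Let $g\ge1$, $n\ge0$ with $2g+n>3$, and put $d=6g-6+2n$, $\ell=4g-4+n$, $d_i=6g_i-6+2n_i$, $\ell_i=4g_i-4+n_i$. Then, as polynomials in the intersection numbers of $\psi$-classes, $$\mathcal{A}_{g,n}=\frac18\sum_{\substack{g_1+g_2=g\\ n_1+n_2=n+2\\ g_i\ge0,\ n_i\ge1,\ d_i\ge1}}\frac{\ell!}{\ell_1!\,\ell_2!}\cdot\frac{n!}{(n_1-1)!\,(n_2-1)!}\cdot\frac{(d_1-1)!\,(d_2-1)!}{(d-1)!}\,\mathcal{V}_{g_1,n_1}\mathcal{V}_{g_2,n_2}$$ $$+\frac{1}{16}\cdot\frac{(4g-4+n)\,n(n-1)}{(6g-7+2n)(6g-8+2n)}\,\mathcal{V}_{0,3}\,\mathcal{V}_{g,n-1}+\frac{\ell!}{(\ell-2)!}\cdot\frac{(d-3)!}{(d-1)!}\,\mathcal{V}_{g-1,n+2}$$ (the middle term has coefficient $0$, and is absent, if $n\in\{0,1\}$). (2) Let $g=0$ and let $n$ be any integer with $n\ge4$. Then, as polynomials in the intersection numbers of $\psi$-classes, $$\mathcal{A}_{0,n}=\frac18\sum_{\substack{n_1+n_2=n+2\\ n_i\ge4}}\frac{(n-4)!}{(n_1-4)!\,(n_2-4)!}\cdot\frac{n!}{(n_1-1)!\,(n_2-1)!}\cdot\frac{(2n_1-7)!\,(2n_2-7)!}{(2n-7)!}\,\mathcal{V}_{0,n_1}\mathcal{V}_{0,n_2}$$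 $$+\frac{1}{16}\cdot\frac{(n-4)\,n(n-1)}{(2n-7)(2n-8)}\,\mathcal{V}_{0,3}\,\mathcal{V}_{0,n-1},$$ where the term involving $\mathcal{V}_{0,3}$ is interpreted, when needed (that is, for $n=4$), by the convention given at the end of the context.
   Context: Formal intersection numbers. Let $R$ be the polynomial ring over $\mathbb{R}$ in independent indeterminates $\langle\tau_{d_1}\cdots\tau_{d_m}\rangle$, one for each finite multiset $\{d_1,\dots,d_m\}$ of non-negative integers such that $d_1+\dots+d_m=3h-3+m$ for some integer $h\ge0$ with $2h-2+m>0$. (These stand for the intersection numbers $\int_{\overline{\mathcal{M}}_{h,m}}\psi_1^{d_1}\cdots\psi_m^{d_m}$, kept unevaluated.) For $2h-2+m>0$ set $$N_{h,m}(b_1,\dots,b_m)=\sum_{d_1+\dots+d_m=3h-3+m}\frac{1}{2^{5h-6+2m}d_1!\cdots d_m!}\langle\tau_{d_1}\cdots\tau_{d_m}\rangle\,b_1^{2d_1}\cdots b_m^{2d_m}\in R[b_1,\dots,b_m].$$ Stable graphs. $\mathcal{G}_{g,n}$ is the (finite) set of isomorphism classes of stable graphs: connected graphs $\Gamma$ (loops and multiple edges allowed) with vertex set $V(\Gamma)$, edge set $E(\Gamma)$, an integer $g_v\ge0$ at each vertex $v$, and $n$ legs labelled $1,\dots,n$, such that $g=h_1(\Gamma)+\sum_v g_v$ ($h_1$ the first Betti number) and $2g_v-2+n_v>0$ for every $v$, where $n_v$ is the valency of $v$ (legs counted, loops counted twice). Isomorphisms are pairs of bijections of vertices and of half-edges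 (legs included) respecting incidence, edges, genus decoration and leg labels; $\operatorname{Aut}(\Gamma)$ is the automorphism group. For $2g+n>3$ and $\Gamma\in\mathcal{G}_{g,n}$, assign a variable $b_e$ to each edge $e$; for a vertex $v$ let $\boldsymbol{b}_v$ be the $n_v$-tuple with entry $b_e$ for each half-edge at $v$ belonging to the edge $e$ (so twice for a loop) and $0$ for each leg. Put $$P_\Gamma=\frac{2^{6g-5+2n}(4g-4+n)!}{(6g-7+2n)!}\cdot\frac{1}{2^{|V(\Gamma)|-1}}\cdot\frac{1}{|\operatorname{Aut}(\Gamma)|}\cdot\prod_{e\in E(\Gamma)}b_e\cdot\prod_{v\in V(\Gamma)}N_{g_v,n_v}(\boldsymbol{b}_v).$$ Operators. $\mathcal{Z}$ is $R$-linear with $\mathcal{Z}(\prod_i b_i^{m_i})=\prod_i m_i!\,\zeta(m_i+1)$, where $\zeta$ is the Riemann zeta function. Let $\chi_\Gamma(e)=\frac12$ if $e$ is a bridge (removing it disconnects $\Gamma$), $\chi_\Gamma(e)=1$ otherwise, and $$\partial_\Gamma P=\sum_{e\in E(\Gamma)}\chi_\Gamma(e)\,b_e\left.\frac{\partial P}{\partial b_e}\right|_{b_e=0}.$$ For $2g+n>3$ define $\mathcal{V}_{g,n}=\sum_{\Gamma\in\mathcal{G}_{g,n}}\mathcal{Z}(P_\Gamma)\in R$ and $\mathcal{A}_{g,n}=\frac{3}{\pi^2}\sum_{\Gamma\in\mathcal{G}_{g,n}}\mathcal{Z}(\partial_\Gamma P_\Gamma)\in R$. Moreover $\mathcal{V}_{0,3}:=4\langle\tau_0^3\rangle$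 and $\mathcal{V}_{1,1}:=\frac{2\pi^2}{3}\langle\tau_0^3\rangle$, corresponding to the conventions $\operatorname{Vol}\mathcal{Q}_{0,3}:=4$ and $\operatorname{Vol}\mathcal{Q}_{1,1}:=\frac{2\pi^2}{3}$. (After evaluation of the intersection numbers, $\mathcal{V}_{g,n}$ is the Masur--Veech volume $\operatorname{Vol}\mathcal{Q}_{g,n}$ and $\mathcal{A}_{g,n}=c_{\mathit{area}}(\mathcal{Q}_{g,n})\operatorname{Vol}\mathcal{Q}_{g,n}$, with $c_{\mathit{area}}$ the area Siegel--Veech constant.) Convention for the terms involving $(0,3)$. These terms can be interpreted as the particular cases $(g_i,n_i)=(0,3)$ of the general terms of the corresponding sums, under the convention $$\left.\frac{(d_i-1)!}{\ell_i!}\right|_{g_i=0,\,n_i=3}:=\left.\frac{(2n_i-7)!}{(n_i-4)!}\right|_{n_i=3}:=\lim_{m\to3}\frac{\Gamma(2m-6)}{\Gamma(m-3)}=\frac12$$ (here $\Gamma(\cdot)$ is Euler's Gamma function). In particular, for $g=0$, $n=4$, where the sum over $n_i\ge4$ is empty and the printed coefficient of $\mathcal{V}_{0,3}\mathcal{V}_{0,3}$ reads $0/0$, that term is the general term with $n_1=n_2=3$, i.e. $\frac18\cdot\frac{4!}{2!\,2!}\cdot\frac12\cdot\frac12\,\mathcal{V}_{0,3}^2$. *)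

theory Defs
  imports Complex_Main "HOL-Library.Multiset" "HOL-Library.FuncSet" "HOL-Library.Poly_Mapping"
begin

section \<open>Formal intersection numbers\<close>

text \<open>Multivariate polynomials over a ring of coefficients \<open>'a\<close> with indeterminates indexed by \<open>'i\<close>
  are finitely supported functions \<open>('i \<Rightarrow>\<^sub>0 nat) \<Rightarrow>\<^sub>0 'a\<close> from monomials to coefficients, with the
  convolution product.\<close>

typedef tau_index =
  "{D :: nat multiset. \<exists>h. 2 * h + size D > 2 \<and> sum_mset D + 3 = 3 * h + size D}"
  by (rule exI[of _ "{#0, 0, 0#}"]) (auto intro: exI[of _ 0])

type_synonym tau_poly = "(tau_index \<Rightarrow>\<^sub>0 nat) \<Rightarrow>\<^sub>0 real"

definition rconst :: "real \<Rightarrow> tau_poly" where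
  "rconst r = Poly_Mapping.single 0 r"

definition tau :: "nat multiset \<Rightarrow> tau_poly" where
  "tau D = Poly_Mapping.single (Poly_Mapping.single (Abs_tau_index D) 1) 1"

text \<open>The edge variables are indexed by the edges themselves; an edge is the set of its two
  half-edges.\<close>

type_synonym edge_poly = "(nat set \<Rightarrow>\<^sub>0 nat) \<Rightarrow>\<^sub>0 tau_poly"

definition econst :: "tau_poly \<Rightarrow> edge_poly" where
  "econst c = Poly_Mapping.single 0 c"

definition bvar :: "nat set \<Rightarrow> edge_poly" where
  "bvar e = Poly_Mapping.single (Poly_Mapping.single e 1) 1"

text \<open>\<open>N_poly h I b\<close> is the polynomial $N_{h,m}$, $m = |I|$, evaluated at the tuple
  $(b_i)_{i \in I}$ of elements of the ring of edge polynomials. The exponent \<open>5 * h + 2 * m - 6\<close>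
  is not truncated if \<open>2 * h + m > 2\<close>.\<close>

definition N_poly :: "nat \<Rightarrow> nat set \<Rightarrow> (nat \<Rightarrow> edge_poly) \<Rightarrow> edge_poly" where
  "N_poly h I b =
     (\<Sum>d \<in> {d \<in> I \<rightarrow>\<^sub>E (UNIV :: nat set). (\<Sum>i\<in>I. d i) + 3 = 3 * h + card I}.
        econst (rconst (1 / (2 ^ (5 * h + 2 * card I - 6) * (\<Prod>i\<in>I. fact (d i))))
                * tau (image_mset d (mset_set I)))
        * (\<Prod>i\<in>I. b i ^ (2 * d i)))"

section \<open>Stable graphs\<close>

text \<open>A graph is given by vertices, half-edges (legs included), the vertex \<open>inc h\<close> carrying the
  half-edge \<open>h\<close>, and an involution \<open>opp\<close> of the half-edges: its fixed points are the legs, its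
  other orbits are the edges.\<close>

record sgraph =
  verts :: "nat set"
  halves :: "nat set"
  inc :: "nat \<Rightarrow> nat"
  opp :: "nat \<Rightarrow> nat"
  genus :: "nat \<Rightarrow> nat"
  leg_label :: "nat \<Rightarrow> nat"

definition legs :: "sgraph \<Rightarrow> nat set" where
  "legs \<Gamma> = {h \<in> halves \<Gamma>. opp \<Gamma> h = h}"

definition edges :: "sgraph \<Rightarrow> nat set set" where
  "edges \<Gamma> = {{h, opp \<Gamma> h} | h. h \<in> halves \<Gamma> \<and> opp \<Gamma> h \<noteq> h}"

definition halves_at :: "sgraph \<Rightarrow> nat \<Rightarrow> nat set" where
  "halves_at \<Gamma> v = {h \<in> halves \<Gamma>. inc \<Gamma> h = v}"

text \<open>Connected components of the spanning subgraph with edge set \<open>F\<close>.\<close>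

definition reach :: "sgraph \<Rightarrow> nat set set \<Rightarrow> (nat \<times> nat) set" where
  "reach \<Gamma> F = {(inc \<Gamma> h, inc \<Gamma> (opp \<Gamma> h)) | h. h \<in> halves \<Gamma> \<and> {h, opp \<Gamma> h} \<in> F}\<^sup>*"

definition components :: "sgraph \<Rightarrow> nat set set \<Rightarrow> nat set set" where
  "components \<Gamma> F = (\<lambda>v. reach \<Gamma> F `` {v}) ` verts \<Gamma>"

definition connected_with :: "sgraph \<Rightarrow> nat set set \<Rightarrow> bool" where
  "connected_with \<Gamma> F \<longleftrightarrow> verts \<Gamma> \<noteq> {} \<and> (\<forall>u\<in>verts \<Gamma>. \<forall>v\<in>verts \<Gamma>. (u, v) \<in> reach \<Gamma> F)"

definition betti1 :: "sgraph \<Rightarrow> int" where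
  "betti1 \<Gamma> = int (card (edges \<Gamma>)) - int (card (verts \<Gamma>)) + int (card (components \<Gamma> (edges \<Gamma>)))"

definition stable_graph :: "nat \<Rightarrow> nat \<Rightarrow> sgraph \<Rightarrow> bool" where
  "stable_graph g n \<Gamma> \<longleftrightarrow>
     finite (verts \<Gamma>) \<and> finite (halves \<Gamma>) \<and>
     (\<forall>h\<in>halves \<Gamma>. inc \<Gamma> h \<in> verts \<Gamma> \<and> opp \<Gamma> h \<in> halves \<Gamma> \<and> opp \<Gamma> (opp \<Gamma> h) = h) \<and>
     bij_betw (leg_label \<Gamma>) (legs \<Gamma>) {1..n} \<and>
     connected_with \<Gamma> (edges \<Gamma>) \<and>
     int g = betti1 \<Gamma> + int (\<Sum>v\<in>verts \<Gamma>. genus \<Gamma> v) \<and>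
     (\<forall>v\<in>verts \<Gamma>. 2 * genus \<Gamma> v + card (halves_at \<Gamma> v) > 2)"

text \<open>Isomorphisms are pairs of maps made extensional outside the carriers, so that they can be
  counted.\<close>

definition isos :: "sgraph \<Rightarrow> sgraph \<Rightarrow> ((nat \<Rightarrow> nat) \<times> (nat \<Rightarrow> nat)) set" where
  "isos \<Gamma> \<Delta> = {(\<phi>, \<psi>).
     \<phi> \<in> extensional (verts \<Gamma>) \<and> bij_betw \<phi> (verts \<Gamma>) (verts \<Delta>) \<and>
     \<psi> \<in> extensional (halves \<Gamma>) \<and> bij_betw \<psi> (halves \<Gamma>) (halves \<Delta>) \<and>
     (\<forall>h\<in>halves \<Gamma>. inc \<Delta> (\<psi> h) = \<phi> (inc \<Gamma> h) \<and> opp \<Delta> (\<psi> h) = \<psi> (opp \<Gamma> h)) \<and>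
     (\<forall>v\<in>verts \<Gamma>. genus \<Delta> (\<phi> v) = genus \<Gamma> v) \<and>
     (\<forall>h\<in>legs \<Gamma>. leg_label \<Delta> (\<psi> h) = leg_label \<Gamma> h)}"

abbreviation Aut :: "sgraph \<Rightarrow> ((nat \<Rightarrow> nat) \<times> (nat \<Rightarrow> nat)) set" where
  "Aut \<Gamma> \<equiv> isos \<Gamma> \<Gamma>"

text \<open>Every finite graph is isomorphic to one whose vertices and half-edges are natural numbers,
  so these are all isomorphism classes.\<close>

definition stable_classes :: "nat \<Rightarrow> nat \<Rightarrow> sgraph set set" where
  "stable_classes g n =
     {\<Gamma>. stable_graph g n \<Gamma>} //
     {(\<Gamma>, \<Delta>). stable_graph g n \<Gamma> \<and> stable_graph g n \<Delta> \<and> isos \<Gamma> \<Delta> \<noteq> {}}"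

text \<open>Sum of an isomorphism invariant over the isomorphism classes.\<close>

definition sum_stable :: "nat \<Rightarrow> nat \<Rightarrow> (sgraph \<Rightarrow> tau_poly) \<Rightarrow> tau_poly" where
  "sum_stable g n F = (\<Sum>C\<in>stable_classes g n. F (SOME \<Gamma>. \<Gamma> \<in> C))"

section \<open>The polynomials of a stable graph and the operators\<close>

definition half_var :: "sgraph \<Rightarrow> nat \<Rightarrow> edge_poly" where
  "half_var \<Gamma> h = (if opp \<Gamma> h = h then 0 else bvar {h, opp \<Gamma> h})"

text \<open>No natural subtraction below is truncated if \<open>2 * g + n > 3\<close>.\<close>

definition P_graph :: "nat \<Rightarrow> nat \<Rightarrow> sgraph \<Rightarrow> edge_poly" where
  "P_graph g n \<Gamma> =
     econst (rconst (2 ^ (6 * g + 2 * n - 5) * fact (4 * g + n - 4) / fact (6 * g + 2 * n - 7)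
                     * (1 / 2 ^ (card (verts \<Gamma>) - 1))
                     * (1 / real (card (Aut \<Gamma>)))))
     * (\<Prod>e\<in>edges \<Gamma>. bvar e)
     * (\<Prod>v\<in>verts \<Gamma>. N_poly (genus \<Gamma> v) (halves_at \<Gamma> v) (half_var \<Gamma>))"

text \<open>The Riemann zeta function at an integer \<open>s \<ge> 2\<close>.\<close>

definition zeta :: "nat \<Rightarrow> real" where
  "zeta s = suminf (\<lambda>k. 1 / real (k + 1) ^ s)"

text \<open>The product runs over the variables occurring in the monomial, hence over exponents
  \<open>\<ge> 1\<close>. In all polynomials to which \<open>Z_op\<close> is applied below, every edge variable occurs in every
  monomial, so the divergent value $\zeta(1)$ is never involved.\<close>

definition Z_op :: "edge_poly \<Rightarrow> tau_poly" where
  "Z_op P = (\<Sum>m\<in>Poly_Mapping.keys P.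
     rconst (\<Prod>e\<in>Poly_Mapping.keys m.
               fact (Poly_Mapping.lookup m e) * zeta (Poly_Mapping.lookup m e + 1))
     * Poly_Mapping.lookup P m)"

definition pdiff :: "nat set \<Rightarrow> edge_poly \<Rightarrow> edge_poly" where
  "pdiff e P = (\<Sum>m\<in>Poly_Mapping.keys P.
     Poly_Mapping.single (m - Poly_Mapping.single e 1)
       (of_nat (Poly_Mapping.lookup m e) * Poly_Mapping.lookup P m))"

text \<open>The substitution $b_e = 0$.\<close>

definition at_zero :: "nat set \<Rightarrow> edge_poly \<Rightarrow> edge_poly" where
  "at_zero e P = (\<Sum>m\<in>{m \<in> Poly_Mapping.keys P. Poly_Mapping.lookup m e = 0}.
     Poly_Mapping.single m (Poly_Mapping.lookup P m))"

definition bridge :: "sgraph \<Rightarrow> nat set \<Rightarrow> bool" where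
  "bridge \<Gamma> e \<longleftrightarrow> e \<in> edges \<Gamma> \<and> \<not> connected_with \<Gamma> (edges \<Gamma> - {e})"

definition chi :: "sgraph \<Rightarrow> nat set \<Rightarrow> real" where
  "chi \<Gamma> e = (if bridge \<Gamma> e then 1 / 2 else 1)"

definition del_graph :: "sgraph \<Rightarrow> edge_poly \<Rightarrow> edge_poly" where
  "del_graph \<Gamma> P =
     (\<Sum>e\<in>edges \<Gamma>. econst (rconst (chi \<Gamma> e)) * bvar e * at_zero e (pdiff e P))"

section \<open>Formal volumes and formal area Siegel--Veech constants\<close>

definition formal_V :: "nat \<Rightarrow> nat \<Rightarrow> tau_poly" where
  "formal_V g n =
     (if (g, n) = (0, 3) then rconst 4 * tau {#0, 0, 0#}
      else if (g, n) = (1, 1) then rconst (2 * pi\<^sup>2 / 3) * tau {#0, 0, 0#}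
      else sum_stable g n (\<lambda>\<Gamma>. Z_op (P_graph g n \<Gamma>)))"

definition formal_A :: "nat \<Rightarrow> nat \<Rightarrow> tau_poly" where
  "formal_A g n =
     rconst (3 / pi\<^sup>2) * sum_stable g n (\<lambda>\<Gamma>. Z_op (del_graph \<Gamma> (P_graph g n \<Gamma>)))"

text \<open>The numbers $d = 6g-6+2n$ and $\ell = 4g-4+n$. Truncation does not affect the condition
  \<open>dim_d g n \<ge> 1\<close>, and \<open>dim_d g n \<ge> 1\<close> together with \<open>n \<ge> 1\<close> excludes truncation in both.\<close>

definition dim_d :: "nat \<Rightarrow> nat \<Rightarrow> nat" where
  "dim_d g n = 6 * g + 2 * n - 6"

definition dim_l :: "nat \<Rightarrow> nat \<Rightarrow> nat" where
  "dim_l g n = 4 * g + n - 4"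

end

theory Submission
  imports "HOL-Analysis.Gamma_Function" "HOL-Combinatorics.Permutations" Defs
begin

text \<open>Every monomial of the polynomial of a stable graph contains every edge variable \<open>b\<^sub>e\<close> with exponent
  at least one. Hence the operator \<open>b\<^sub>e \<partial>/\<partial>b\<^sub>e\<close> at \<open>b\<^sub>e = 0\<close> keeps exactly the monomials that are linear
  in \<open>b\<^sub>e\<close>, and \<open>Z\<close> turns their factor \<open>b\<^sub>e\<close> into \<open>\<zeta>(2) = \<pi>\<^sup>2/6\<close>. What is left is the contribution of the
  graph in which \<open>e\<close> has been cut into two legs, because a leg is a half-edge whose variable is \<open>0\<close>.
  So the area Siegel--Veech sum is a sum over pairs of a stable graph and an edge of it, and the
  theorem follows by counting such pairs through the graphs that result from the cut
  (\<open>Z_op_del_graph\<close>).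

  If \<open>e\<close> is not a bridge, the result is a connected stable graph of genus \<open>g - 1\<close> with \<open>n + 2\<close> legs.
  If \<open>e\<close> is a bridge, the result has two components, which are stable graphs whose genera add up to \<open>g\<close>
  and which share the \<open>n\<close> old legs, with one new leg each. Both constructions can be inverted by gluing
  the two new legs.

  Automorphisms are dealt with by counting labelled graphs, that is, graphs whose vertices are
  \<open>0, \<dots>, k - 1\<close> and whose half-edges are \<open>0, \<dots>, m - 1\<close>: by the orbit-stabilizer theorem the sum
  over isomorphism classes with weights \<open>1/|Aut|\<close> is the sum over labelled graphs with weights
  \<open>1/(k! m!)\<close> (\<open>sum_stable_labelled\<close>). On labelled graphs, cutting at a half-edge is a bijection in
  the connected case (\<open>sum_cut_nonbridge\<close>) and in the disconnected case, where the labels are distributed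
  over the two components (\<open>sum_cut_bridge\<close>). The resulting binomial coefficients cancel against the
  factorials, so that the bridge terms become products of the series
  \<open>U\<^sub>g\<^sub>,\<^sub>n = graph_series g n\<close> (\<open>product_series\<close>). With \<open>c\<^sub>g\<^sub>,\<^sub>n = vol_const g n\<close>, the factor of \<open>P\<^sub>\<Gamma>\<close>
  that depends on the type only, this gives (\<open>formal_A_eq\<close>)
  \[ A_{g,n} = c_{g,n} \Bigl( \tfrac14 U_{g-1,n+2}
       + \tfrac1{16} \sum_{i \le n,\; j \le g} {n \choose i} U_{j,i+1} U_{g-j,n-i+1} \Bigr). \]

  Finally \<open>V\<^sub>g\<^sub>,\<^sub>n = c\<^sub>g\<^sub>,\<^sub>n U\<^sub>g\<^sub>,\<^sub>n\<close> for all types except \<open>(0,3)\<close>, including \<open>(1,1)\<close>, where the convention agrees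
  with the sum over graphs; and \<open>V\<^sub>0\<^sub>,\<^sub>3 = 4 U\<^sub>0\<^sub>,\<^sub>3\<close>, while \<open>U\<^sub>0\<^sub>,\<^sub>1 = U\<^sub>0\<^sub>,\<^sub>2 = 0\<close>. Separating the terms with a factor
  \<open>U\<^sub>0\<^sub>,\<^sub>3\<close> from the others and comparing constants gives both parts of the theorem.\<close>

section \<open>Constants and the operators on edge polynomials\<close>

lemma rconst_mult: "rconst (a * b) = rconst a * rconst b"
  by (simp add: rconst_def mult_single)

lemma rconst_0 [simp]: "rconst 0 = 0"
  by (simp add: rconst_def)

lemma rconst_1 [simp]: "rconst 1 = 1"
  by (simp add: rconst_def)

lemma rconst_of_nat: "rconst (of_nat n) = of_nat n"
  by (simp add: rconst_def)

lemma rconst_cancel: "a \<noteq> 0 \<Longrightarrow> rconst (1 / a) * (rconst a * x) = x"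
  by (simp add: mult.assoc[symmetric] rconst_mult[symmetric])

text \<open>The value of \<open>Z\<close> on the \<open>k\<close>-th power of an edge variable, for \<open>k \<ge> 1\<close>.\<close>

definition zeta_factor :: "nat \<Rightarrow> real" where
  "zeta_factor k = fact k * zeta (k + 1)"

lemma zeta_factor_1: "zeta_factor (Suc 0) = pi\<^sup>2 / 6"
proof -
  have "(\<lambda>k. 1 / real (k + 1) ^ 2) sums (pi\<^sup>2 / 6)"
    using inverse_squares_sums by (simp add: add.commute)
  then show ?thesis
    by (simp add: zeta_factor_def zeta_def sums_iff numeral_2_eq_2)
qed

lemma Z_op_alt:
  assumes "finite K" "Poly_Mapping.keys P \<subseteq> K"
  shows "Z_op P = (\<Sum>m\<in>K. rconst (\<Prod>e\<in>Poly_Mapping.keys m. zeta_factor (Poly_Mapping.lookup m e))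
     * Poly_Mapping.lookup P m)"
  unfolding Z_op_def zeta_factor_def using assms
  by (intro sum.mono_neutral_left) (auto simp: in_keys_iff)

lemma Z_op_0 [simp]: "Z_op 0 = 0"
  by (simp add: Z_op_def)

lemma Z_op_add: "Z_op (P + Q) = Z_op P + Z_op Q"
proof -
  let ?K = "Poly_Mapping.keys P \<union> Poly_Mapping.keys Q"
  show ?thesis
    using keys_add[of P Q]
    by (simp add: Z_op_alt[of ?K P] Z_op_alt[of ?K Q] Z_op_alt[of ?K "P + Q"]
      lookup_add distrib_left sum.distrib)
qed

lemma Z_op_sum: "Z_op (\<Sum>x\<in>A. f x) = (\<Sum>x\<in>A. Z_op (f x))"
  by (induction A rule: infinite_finite_induct) (auto simp: Z_op_add)

lemma Z_op_single:
  "Z_op (Poly_Mapping.single m c) =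
     rconst (\<Prod>e\<in>Poly_Mapping.keys m. zeta_factor (Poly_Mapping.lookup m e)) * c"
  by (subst Z_op_alt[of "{m}"]) auto

lemma pdiff_alt:
  assumes "finite K" "Poly_Mapping.keys P \<subseteq> K"
  shows "pdiff e P = (\<Sum>m\<in>K. Poly_Mapping.single (m - Poly_Mapping.single e 1)
       (of_nat (Poly_Mapping.lookup m e) * Poly_Mapping.lookup P m))"
  unfolding pdiff_def using assms
  by (intro sum.mono_neutral_left) (auto simp: in_keys_iff)

lemma pdiff_0 [simp]: "pdiff e 0 = 0"
  by (simp add: pdiff_def)

lemma pdiff_add: "pdiff e (P + Q) = pdiff e P + pdiff e Q"
proof -
  let ?K = "Poly_Mapping.keys P \<union> Poly_Mapping.keys Q"
  show ?thesis
    using keys_add[of P Q]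
    by (simp add: pdiff_alt[of ?K P] pdiff_alt[of ?K Q] pdiff_alt[of ?K "P + Q"]
      lookup_add distrib_left single_add sum.distrib)
qed

lemma pdiff_sum: "pdiff e (\<Sum>x\<in>A. f x) = (\<Sum>x\<in>A. pdiff e (f x))"
  by (induction A rule: infinite_finite_induct) (auto simp: pdiff_add)

lemma lookup_at_zero:
  "Poly_Mapping.lookup (at_zero e P) m = (if Poly_Mapping.lookup m e = 0 then Poly_Mapping.lookup P m else 0)"
  by (auto simp: at_zero_def lookup_sum lookup_single when_def in_keys_iff)

lemma at_zero_sum: "at_zero e (\<Sum>x\<in>A. f x) = (\<Sum>x\<in>A. at_zero e (f x))"
  by (rule poly_mapping_eqI) (simp add: lookup_at_zero lookup_sum)

lemma at_zero_single:
  "at_zero e (Poly_Mapping.single m c) = (if Poly_Mapping.lookup m e = 0 then Poly_Mapping.single m c else 0)"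
  by (rule poly_mapping_eqI) (auto simp: lookup_at_zero lookup_single when_def)

text \<open>The key property of the differential operator: among the monomials it selects those that are
  linear in \<open>b\<^sub>e\<close>, and it does not change them. This makes the substitution \<open>b\<^sub>e = 0\<close> in the vertex
  polynomials a condition on exponents.\<close>

lemma bvar_at_zero_pdiff_single:
  "bvar e * at_zero e (pdiff e (Poly_Mapping.single m c)) =
     (if Poly_Mapping.lookup m e = 1 then Poly_Mapping.single m c else 0)"
proof -
  let ?k = "Poly_Mapping.lookup m e"
  let ?m' = "m - Poly_Mapping.single e 1"
  have pdiff: "pdiff e (Poly_Mapping.single m c) = Poly_Mapping.single ?m' (of_nat ?k * c)"
    by (subst pdiff_alt[of "{m}"]) auto
  have lookup: "Poly_Mapping.lookup ?m' e = ?k - 1"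
    by (simp add: lookup_minus)
  consider "?k = 0" | "?k = 1" | "?k > 1"
    by linarith
  then show ?thesis
  proof cases
    case 2
    then have "Poly_Mapping.single e 1 + ?m' = m"
      by (intro poly_mapping_eqI) (auto simp: lookup_add lookup_minus lookup_single when_def)
    then show ?thesis
      unfolding pdiff at_zero_single lookup 2 bvar_def by (simp only: mult_single diff_self_eq_0 simp_thms if_True of_nat_1 mult_1_left)
  qed (unfold pdiff at_zero_single lookup, simp_all)
qed

section \<open>The weight of a graph and the expansion of its polynomial\<close>

text \<open>The coefficient of the monomial with exponents \<open>2 d i\<close> in the polynomial \<open>N\<close> of a vertex.\<close>

definition vertex_factor :: "nat \<Rightarrow> nat set \<Rightarrow> (nat \<Rightarrow> nat) \<Rightarrow> tau_poly" where
  "vertex_factor h I d = rconst (1 / (2 ^ (5 * h + 2 * card I - 6) * (\<Prod>i\<in>I. fact (d i))))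
     * tau (image_mset d (mset_set I))"

text \<open>The exponents of the \<open>\<psi>\<close>-classes at all half-edges at once. They vanish at legs because a leg
  carries the variable \<open>0\<close>, and only \<open>0 ^ 0\<close> contributes.\<close>

definition psi_exponents :: "sgraph \<Rightarrow> (nat \<Rightarrow> nat) set" where
  "psi_exponents G = {d \<in> halves G \<rightarrow>\<^sub>E (UNIV :: nat set).
     (\<forall>v\<in>verts G. (\<Sum>i\<in>halves_at G v. d i) + 3 = 3 * genus G v + card (halves_at G v)) \<and>
     (\<forall>h\<in>legs G. d h = 0)}"

definition vertex_factors :: "sgraph \<Rightarrow> (nat \<Rightarrow> nat) \<Rightarrow> tau_poly" where
  "vertex_factors G d = (\<Prod>v\<in>verts G. vertex_factor (genus G v) (halves_at G v) d)"

text \<open>The value of \<open>Z\<close> on the polynomial of a graph, without the constant, the power of two and the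
  number of automorphisms. It ignores the labels of the legs, and it makes sense for disconnected
  graphs.\<close>

definition weight :: "sgraph \<Rightarrow> tau_poly" where
  "weight G = (\<Sum>d\<in>psi_exponents G. vertex_factors G d
     * rconst (\<Prod>e\<in>edges G. zeta_factor (1 + 2 * (\<Sum>i\<in>e. d i))))"

definition wf_graph :: "sgraph \<Rightarrow> bool" where
  "wf_graph G \<longleftrightarrow> finite (verts G) \<and> finite (halves G) \<and>
     (\<forall>h\<in>halves G. inc G h \<in> verts G \<and> opp G h \<in> halves G \<and> opp G (opp G h) = h)"

lemma wf_graphD:
  assumes "wf_graph G"
  shows "finite (verts G)" "finite (halves G)"
    "\<And>h. h \<in> halves G \<Longrightarrow> inc G h \<in> verts G"
    "\<And>h. h \<in> halves G \<Longrightarrow> opp G h \<in> halves G"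
    "\<And>h. h \<in> halves G \<Longrightarrow> opp G (opp G h) = h"
  using assms by (auto simp: wf_graph_def)

definition edge_monomial :: "sgraph \<Rightarrow> (nat \<Rightarrow> nat) \<Rightarrow> (nat set \<Rightarrow>\<^sub>0 nat)" where
  "edge_monomial G d = (\<Sum>e\<in>edges G. Poly_Mapping.single e (1 + 2 * (\<Sum>i\<in>e. d i)))"

lemma finite_halves_at: "wf_graph G \<Longrightarrow> finite (halves_at G v)"
  by (simp add: wf_graph_def halves_at_def)

lemma edges_image: "edges G = (\<lambda>h. {h, opp G h}) ` (halves G - legs G)"
  by (auto simp: edges_def legs_def)

lemma finite_edges: "wf_graph G \<Longrightarrow> finite (edges G)"
  by (simp add: edges_image wf_graph_def)

lemma lookup_edge_monomial:
  assumes "wf_graph G"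
  shows "Poly_Mapping.lookup (edge_monomial G d) e = (if e \<in> edges G then 1 + 2 * (\<Sum>i\<in>e. d i) else 0)"
  using finite_edges[OF assms]
  by (simp add: edge_monomial_def lookup_sum lookup_single when_def)

lemma keys_edge_monomial:
  assumes "wf_graph G"
  shows "Poly_Mapping.keys (edge_monomial G d) = edges G"
  by (rule set_eqI) (simp add: in_keys_iff lookup_edge_monomial[OF assms])

lemma edge_of_member:
  assumes "wf_graph G" "e \<in> edges G" "i \<in> e"
  shows "i \<in> halves G - legs G" "e = {i, opp G i}"
proof -
  obtain h where h: "h \<in> halves G" "opp G h \<noteq> h" "e = {h, opp G h}"
    using assms(2) by (auto simp: edges_def)
  have *: "opp G h \<in> halves G" "opp G (opp G h) = h"
    using assms(1) h by (auto simp: wf_graph_def)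
  show "i \<in> halves G - legs G" "e = {i, opp G i}"
    using h * assms(3) by (auto simp: legs_def)
qed

lemma Union_edges: "wf_graph G \<Longrightarrow> \<Union>(edges G) = halves G - legs G"
  by (rule equalityI) (use edge_of_member(1) in blast, auto simp: edges_image)

lemma edges_disjoint:
  assumes "wf_graph G" "e \<in> edges G" "e' \<in> edges G" "e \<noteq> e'"
  shows "e \<inter> e' = {}"
proof (rule ccontr)
  assume "e \<inter> e' \<noteq> {}"
  then obtain i where "i \<in> e" "i \<in> e'" by blast
  then show False
    using edge_of_member(2)[OF assms(1,2)] edge_of_member(2)[OF assms(1,3)] assms(4) by metis
qed

lemma finite_edge: "e \<in> edges G \<Longrightarrow> finite e"
  by (auto simp: edges_def)

lemma finite_sum_bounded_PiE:
  assumes "finite I"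
  shows "finite {d \<in> I \<rightarrow>\<^sub>E (UNIV :: nat set). (\<Sum>i\<in>I. d i) + 3 = (k::nat)}"
proof (rule finite_subset)
  show "{d \<in> I \<rightarrow>\<^sub>E (UNIV :: nat set). (\<Sum>i\<in>I. d i) + 3 = k} \<subseteq> I \<rightarrow>\<^sub>E {..k}"
  proof
    fix d assume d: "d \<in> {d \<in> I \<rightarrow>\<^sub>E (UNIV :: nat set). (\<Sum>i\<in>I. d i) + 3 = k}"
    have "d i \<le> k" if "i \<in> I" for i
      using member_le_sum[of i I d] assms that d by simp
    then show "d \<in> I \<rightarrow>\<^sub>E {..k}"
      using d by (simp add: PiE_iff)
  qed
qed (simp add: assms finite_PiE)

lemma prod_halves_at:
  assumes "wf_graph G"
  shows "(\<Prod>v\<in>verts G. \<Prod>i\<in>halves_at G v. f i) = (\<Prod>i\<in>halves G. (f i :: 'a :: comm_monoid_mult))"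
proof -
  have "(\<Prod>v\<in>verts G. \<Prod>i\<in>{i \<in> halves G. inc G i = v}. f i) = (\<Prod>i\<in>halves G. f i)"
    using assms by (intro prod.group) (auto simp: wf_graph_def)
  then show ?thesis by (simp add: halves_at_def)
qed

text \<open>A leg with positive exponent kills the product; the half-edges that are not legs come in
  pairs, one pair for each edge.\<close>

lemma prod_half_var:
  assumes wf: "wf_graph G"
  shows "(\<Prod>e\<in>edges G. bvar e) * (\<Prod>i\<in>halves G. half_var G i ^ (2 * d i)) =
     (if \<forall>h\<in>legs G. d h = 0 then Poly_Mapping.single (edge_monomial G d) 1 else 0)"
proof (cases "\<forall>h\<in>legs G. d h = 0")
  case False
  then obtain h where "h \<in> legs G" "d h \<noteq> 0" by blast
  then have "h \<in> halves G" "half_var G h ^ (2 * d h) = 0"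
    by (auto simp: legs_def half_var_def power_0_left)
  then have "(\<Prod>i\<in>halves G. half_var G i ^ (2 * d i)) = 0"
    using wf by (subst prod.remove[of _ h]) (auto simp: wf_graph_def)
  with False show ?thesis by auto
next
  case True
  have pow: "bvar e ^ k = Poly_Mapping.single (Poly_Mapping.single e k) 1" for e k
    by (induction k) (auto simp: bvar_def mult_single single_add[symmetric])
  have prod_single: "(\<Prod>e\<in>E. Poly_Mapping.single (f e) 1) = (Poly_Mapping.single (\<Sum>e\<in>E. f e) 1 :: edge_poly)"
    for E and f :: "nat set \<Rightarrow> _"
    by (induction E rule: infinite_finite_induct) (auto simp: mult_single)
  have "(\<Prod>i\<in>halves G. half_var G i ^ (2 * d i)) = (\<Prod>i\<in>halves G - legs G. half_var G i ^ (2 * d i))"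
    using wf True by (intro prod.mono_neutral_right) (auto simp: wf_graph_def)
  also have "\<dots> = (\<Prod>e\<in>edges G. \<Prod>i\<in>e. half_var G i ^ (2 * d i))"
    using edges_disjoint[OF wf] finite_edge
    by (subst Union_edges[OF wf, symmetric], subst prod.Union_disjoint) auto
  also have "\<dots> = (\<Prod>e\<in>edges G. \<Prod>i\<in>e. bvar e ^ (2 * d i))"
  proof (intro prod.cong refl)
    fix e i assume "e \<in> edges G" "i \<in> e"
    from edge_of_member[OF wf this] show "half_var G i ^ (2 * d i) = bvar e ^ (2 * d i)"
      by (auto simp: half_var_def legs_def)
  qed
  also have "\<dots> = (\<Prod>e\<in>edges G. bvar e ^ (2 * (\<Sum>i\<in>e. d i)))"
    by (simp add: power_sum sum_distrib_left)
  finally have "(\<Prod>e\<in>edges G. bvar e) * (\<Prod>i\<in>halves G. half_var G i ^ (2 * d i)) =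
      (\<Prod>e\<in>edges G. bvar e ^ (1 + 2 * (\<Sum>i\<in>e. d i)))"
    by (simp add: prod.distrib)
  also have "\<dots> = Poly_Mapping.single (edge_monomial G d) 1"
    by (simp only: pow prod_single edge_monomial_def)
  finally show ?thesis
    using True by simp
qed

lemma econst_mult: "econst (a * b) = econst a * econst b"
  by (simp add: econst_def mult_single)

lemma econst_prod: "econst (\<Prod>x\<in>A. f x) = (\<Prod>x\<in>A. econst (f x))"
  by (induction A rule: infinite_finite_induct) (auto simp: econst_mult, (simp add: econst_def)+)

lemma econst_mult_single: "econst a * Poly_Mapping.single m c = Poly_Mapping.single m (a * c)"
  by (simp add: econst_def mult_single)

lemma finite_exponents:
  assumes wf: "wf_graph G"
  shows "finite {d \<in> halves G \<rightarrow>\<^sub>E (UNIV :: nat set).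
     \<forall>v\<in>verts G. (\<Sum>i\<in>halves_at G v. d i) + 3 = 3 * genus G v + card (halves_at G v)}" (is "finite ?E")
proof (rule finite_subset)
  let ?B = "\<lambda>h. 3 * genus G (inc G h) + card (halves_at G (inc G h))"
  show "?E \<subseteq> PiE (halves G) (\<lambda>h. {..?B h})"
  proof (clarsimp simp: PiE_iff)
    fix d h
    assume *: "\<forall>v\<in>verts G. (\<Sum>i\<in>halves_at G v. d i) + 3 = 3 * genus G v + card (halves_at G v)"
      and h: "h \<in> halves G"
    have "d h \<le> (\<Sum>i\<in>halves_at G (inc G h). d i)"
      using h finite_halves_at[OF wf] by (intro member_le_sum) (auto simp: halves_at_def)
    then show "d h \<le> ?B h"
      using * wf_graphD(3)[OF wf h] by fastforce
  qed
  show "finite (PiE (halves G) (\<lambda>h. {..?B h}))"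
    using wf by (intro finite_PiE) (auto simp: wf_graph_def)
qed

lemma vertex_factor_cong:
  assumes "finite I" "\<And>i. i \<in> I \<Longrightarrow> d i = d' i"
  shows "vertex_factor k I d = vertex_factor k I d'"
proof -
  have "image_mset d (mset_set I) = image_mset d' (mset_set I)"
    using assms by (intro image_mset_cong) auto
  then show ?thesis
    using assms by (simp add: vertex_factor_def)
qed

lemma prod_N_poly:
  assumes wf: "wf_graph G"
  shows "(\<Prod>e\<in>edges G. bvar e) * (\<Prod>v\<in>verts G. N_poly (genus G v) (halves_at G v) (half_var G)) =
     (\<Sum>d\<in>psi_exponents G. Poly_Mapping.single (edge_monomial G d) (vertex_factors G d))"
proof -
  define D where "D = (\<lambda>v. {d \<in> halves_at G v \<rightarrow>\<^sub>E (UNIV :: nat set).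
    (\<Sum>i\<in>halves_at G v. d i) + 3 = 3 * genus G v + card (halves_at G v)})"
  define f where "f = (\<lambda>v d. econst (vertex_factor (genus G v) (halves_at G v) d)
        * (\<Prod>i\<in>halves_at G v. half_var G i ^ (2 * d i)))"
  define E where "E = {d \<in> halves G \<rightarrow>\<^sub>E (UNIV :: nat set).
     \<forall>v\<in>verts G. (\<Sum>i\<in>halves_at G v. d i) + 3 = 3 * genus G v + card (halves_at G v)}"
  have cong: "f v d = f v d'" if "\<And>i. i \<in> halves_at G v \<Longrightarrow> d i = d' i" for v d d'
    using that vertex_factor_cong[OF finite_halves_at[OF wf] that] by (simp add: f_def)
  have finE: "finite (verts G)" "\<And>v. finite (D v)"
    using wf finite_sum_bounded_PiE finite_halves_at unfolding D_def wf_graph_def by auto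
  have "(\<Prod>v\<in>verts G. N_poly (genus G v) (halves_at G v) (half_var G)) =
      (\<Prod>v\<in>verts G. \<Sum>d\<in>D v. f v d)"
    by (simp add: N_poly_def D_def f_def vertex_factor_def)
  also have "\<dots> = (\<Sum>x\<in>PiE (verts G) D. \<Prod>v\<in>verts G. f v (x v))"
    using finE by (intro prod_sum_PiE) auto
  \<comment> \<open>Every half-edge lies at exactly one vertex, so exponents chosen at each vertex are one function on
    all half-edges.\<close>
  also have "\<dots> = (\<Sum>d\<in>E. \<Prod>v\<in>verts G. f v d)"
  proof (rule sum.reindex_bij_witness[of _ "\<lambda>d. \<lambda>v\<in>verts G. restrict d (halves_at G v)"
        "\<lambda>x. \<lambda>h\<in>halves G. x (inc G h) h"])
    fix x assume x: "x \<in> PiE (verts G) D"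
    have eq: "(\<lambda>h\<in>halves G. x (inc G h) h) i = x v i" if "i \<in> halves_at G v" for v i
      using that by (auto simp: halves_at_def)
    show "(\<lambda>v\<in>verts G. restrict (\<lambda>h\<in>halves G. x (inc G h) h) (halves_at G v)) = x"
    proof
      fix v
      show "(\<lambda>v\<in>verts G. restrict (\<lambda>h\<in>halves G. x (inc G h) h) (halves_at G v)) v = x v"
      proof (cases "v \<in> verts G")
        case True
        then have "x v \<in> extensional (halves_at G v)"
          using x by (auto simp: PiE_iff D_def)
        with True show ?thesis
          by (auto simp: fun_eq_iff restrict_def extensional_def halves_at_def)
      qed (use x in \<open>auto simp: PiE_iff extensional_def\<close>)
    qed
    have "(\<Sum>i\<in>halves_at G v. (\<lambda>h\<in>halves G. x (inc G h) h) i) = (\<Sum>i\<in>halves_at G v. x v i)" for v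
      by (intro sum.cong refl eq)
    then show "(\<lambda>h\<in>halves G. x (inc G h) h) \<in> E"
      using x by (auto simp: E_def D_def PiE_iff)
    show "(\<Prod>v\<in>verts G. f v (\<lambda>h\<in>halves G. x (inc G h) h)) = (\<Prod>v\<in>verts G. f v (x v))"
      by (intro prod.cong refl cong eq)
  next
    fix d assume d: "d \<in> E"
    show "(\<lambda>h\<in>halves G. (\<lambda>v\<in>verts G. restrict d (halves_at G v)) (inc G h) h) = d"
      using d wf by (auto simp: fun_eq_iff E_def PiE_iff extensional_def halves_at_def wf_graph_def)
    show "(\<lambda>v\<in>verts G. restrict d (halves_at G v)) \<in> PiE (verts G) D"
      using d by (auto simp: E_def D_def PiE_iff)
  qed
  also have "\<dots> = (\<Sum>d\<in>E. econst (vertex_factors G d) * (\<Prod>i\<in>halves G. half_var G i ^ (2 * d i)))"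
    by (simp add: f_def prod.distrib vertex_factors_def econst_prod prod_halves_at[OF wf])
  finally have "(\<Prod>e\<in>edges G. bvar e) * (\<Prod>v\<in>verts G. N_poly (genus G v) (halves_at G v) (half_var G))
    = (\<Sum>d\<in>E. econst (vertex_factors G d) *
        ((\<Prod>e\<in>edges G. bvar e) * (\<Prod>i\<in>halves G. half_var G i ^ (2 * d i))))"
    by (simp add: sum_distrib_left mult_ac)
  also have "\<dots> = (\<Sum>d\<in>E. if \<forall>h\<in>legs G. d h = 0
      then Poly_Mapping.single (edge_monomial G d) (vertex_factors G d) else 0)"
    by (intro sum.cong refl) (auto simp: prod_half_var[OF wf] econst_mult_single)
  also have "\<dots> = (\<Sum>d\<in>psi_exponents G. Poly_Mapping.single (edge_monomial G d) (vertex_factors G d))"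
  proof -
    have "finite E"
      using finite_exponents[OF wf] by (simp add: E_def)
    moreover have "psi_exponents G = {d \<in> E. \<forall>h\<in>legs G. d h = 0}"
      by (auto simp: psi_exponents_def E_def)
    ultimately show ?thesis
      by (simp add: sum.inter_filter)
  qed
  finally show ?thesis .
qed

text \<open>The factor of the polynomial of a graph that depends on its type only.\<close>

definition vol_const :: "nat \<Rightarrow> nat \<Rightarrow> real" where
  "vol_const g n = 2 ^ (6 * g + 2 * n - 5) * fact (4 * g + n - 4) / fact (6 * g + 2 * n - 7)"

lemma P_graph_expand:
  assumes wf: "wf_graph G"
  shows "P_graph g n G = (\<Sum>d\<in>psi_exponents G. Poly_Mapping.single (edge_monomial G d)
    (rconst (vol_const g n / 2 ^ (card (verts G) - 1) / real (card (Aut G))) * vertex_factors G d))"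
  unfolding P_graph_def mult.assoc prod_N_poly[OF wf]
  by (simp add: sum_distrib_left econst_mult_single vol_const_def mult.assoc)

lemma finite_psi_exponents: "wf_graph G \<Longrightarrow> finite (psi_exponents G)"
  by (rule finite_subset[OF _ finite_exponents]) (auto simp: psi_exponents_def)

lemma Z_op_edge_monomial:
  assumes "wf_graph G"
  shows "Z_op (Poly_Mapping.single (edge_monomial G d) c) =
    rconst (\<Prod>e\<in>edges G. zeta_factor (1 + 2 * (\<Sum>i\<in>e. d i))) * c"
  by (simp add: Z_op_single keys_edge_monomial[OF assms] lookup_edge_monomial[OF assms])

lemma Z_op_P_graph:
  assumes wf: "wf_graph G"
  shows "Z_op (P_graph g n G) =
    rconst (vol_const g n / 2 ^ (card (verts G) - 1) / real (card (Aut G))) * weight G"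
  by (simp add: P_graph_expand[OF wf] Z_op_sum Z_op_edge_monomial[OF wf] weight_def
      sum_distrib_left mult_ac)

section \<open>Cutting an edge\<close>

text \<open>Both halves of the edge of \<open>h\<close> become legs. The new legs get different labels, \<open>h\<close> itself the first
  one, so that \<open>h\<close> can be recovered from the result.\<close>

definition cut_edge :: "nat \<Rightarrow> nat \<Rightarrow> sgraph \<Rightarrow> nat \<Rightarrow> sgraph" where
  "cut_edge p q G h = G\<lparr>opp := (opp G)(h := h, opp G h := opp G h),
     leg_label := (leg_label G)(h := p, opp G h := q)\<rparr>"

lemma cut_edge_simps [simp]:
  "verts (cut_edge p q G h) = verts G" "halves (cut_edge p q G h) = halves G"
  "inc (cut_edge p q G h) = inc G" "genus (cut_edge p q G h) = genus G"
  "opp (cut_edge p q G h) = (opp G)(h := h, opp G h := opp G h)"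
  "leg_label (cut_edge p q G h) = (leg_label G)(h := p, opp G h := q)"
  "halves_at (cut_edge p q G h) = halves_at G"
  by (auto simp: cut_edge_def halves_at_def)

lemma non_legD:
  assumes "wf_graph G" "h \<in> halves G - legs G"
  shows "h \<in> halves G" "opp G h \<in> halves G" "opp G (opp G h) = h" "opp G h \<noteq> h" "h \<noteq> opp G h"
  using assms by (auto simp: wf_graph_def legs_def)

lemma legs_cut_edge:
  assumes "wf_graph G" "h \<in> halves G - legs G"
  shows "legs (cut_edge p q G h) = legs G \<union> {h, opp G h}"
  using non_legD[OF assms] by (auto simp: legs_def)

lemma wf_cut_edge:
  assumes "wf_graph G" "h \<in> halves G - legs G"
  shows "wf_graph (cut_edge p q G h)"
proof -
  have "\<And>x. x \<in> halves G \<Longrightarrow> opp G x = h \<longleftrightarrow> x = opp G h"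
    using non_legD[OF assms] wf_graphD[OF assms(1)] by metis
  moreover have "\<And>x. x \<in> halves G \<Longrightarrow> opp G x = opp G h \<longleftrightarrow> x = h"
    using non_legD[OF assms] wf_graphD[OF assms(1)] by metis
  ultimately show ?thesis
    using non_legD[OF assms] wf_graphD[OF assms(1)] by (simp add: wf_graph_def)
qed

lemma edge_eq_iff:
  assumes "wf_graph G" "h \<in> halves G - legs G" "x \<in> halves G"
  shows "{x, opp G x} = {h, opp G h} \<longleftrightarrow> x \<in> {h, opp G h}"
  using non_legD[OF assms(1,2)] by (auto simp: doubleton_eq_iff)

lemma edges_cut_edge:
  assumes "wf_graph G" "h \<in> halves G - legs G"
  shows "edges (cut_edge p q G h) = edges G - {{h, opp G h}}"
proof -
  have "halves G - legs (cut_edge p q G h) = (halves G - legs G) - {h, opp G h}"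
    using legs_cut_edge[OF assms] by auto
  then have "edges (cut_edge p q G h) = (\<lambda>x. {x, opp G x}) ` ((halves G - legs G) - {h, opp G h})"
    by (simp add: edges_image cong: image_cong_simp)
  also have "\<dots> = edges G - {{h, opp G h}}"
  proof -
    have image_minus: "f ` (S - T) = f ` S - {c}" if "\<And>x. x \<in> S \<Longrightarrow> f x = c \<longleftrightarrow> x \<in> T" for f :: "nat \<Rightarrow> nat set" and S T c
      using that by blast
    show ?thesis
      unfolding edges_image by (rule image_minus) (use edge_eq_iff[OF assms] in simp)
  qed
  finally show ?thesis .
qed

text \<open>Making \<open>h\<close> and its opposite legs only adds the condition that their exponents vanish.\<close>

lemma weight_cut_edge:
  assumes "wf_graph G" "h \<in> halves G - legs G"
  shows "weight (cut_edge p q G h) = (\<Sum>d\<in>{d \<in> psi_exponents G. \<forall>i\<in>{h, opp G h}. d i = 0}.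
    vertex_factors G d * rconst (\<Prod>e\<in>edges G - {{h, opp G h}}. zeta_factor (1 + 2 * (\<Sum>i\<in>e. d i))))"
proof -
  have "psi_exponents (cut_edge p q G h) = {d \<in> psi_exponents G. \<forall>i\<in>{h, opp G h}. d i = 0}"
    by (auto simp: psi_exponents_def legs_cut_edge[OF assms])
  then show ?thesis
    by (simp add: weight_def edges_cut_edge[OF assms] vertex_factors_def)
qed

lemma Z_op_del_edge:
  assumes wf: "wf_graph G" and h: "h \<in> halves G - legs G" and e: "e = {h, opp G h}"
  shows "Z_op (econst (rconst c) * bvar e * at_zero e (pdiff e (P_graph g n G))) =
    rconst (vol_const g n / 2 ^ (card (verts G) - 1) / real (card (Aut G)) * (pi\<^sup>2 / 6)) *
      (rconst c * weight (cut_edge p q G h))"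
proof -
  define a where "a = vol_const g n / 2 ^ (card (verts G) - 1) / real (card (Aut G))"
  define S where "S = (\<lambda>d. Poly_Mapping.single (edge_monomial G d) (rconst a * vertex_factors G d))"
  have e_in: "e \<in> edges G"
    using h by (auto simp: e edges_image)
  have fin: "finite e" using e by simp
  have "bvar e * at_zero e (pdiff e (P_graph g n G)) =
      (\<Sum>d\<in>psi_exponents G. bvar e * at_zero e (pdiff e (S d)))"
    by (simp only: P_graph_expand[OF wf] a_def[symmetric] S_def pdiff_sum at_zero_sum sum_distrib_left)
  also have "\<dots> = (\<Sum>d\<in>psi_exponents G. if \<forall>i\<in>e. d i = 0 then S d else 0)"
    unfolding S_def bvar_at_zero_pdiff_single
    using e_in fin by (intro sum.cong refl) (simp add: lookup_edge_monomial[OF wf])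
  also have "\<dots> = (\<Sum>d\<in>{d \<in> psi_exponents G. \<forall>i\<in>e. d i = 0}. S d)"
    by (simp add: sum.inter_filter finite_psi_exponents[OF wf])
  finally have "Z_op (econst (rconst c) * bvar e * at_zero e (pdiff e (P_graph g n G))) =
      (\<Sum>d\<in>{d \<in> psi_exponents G. \<forall>i\<in>e. d i = 0}. Z_op (econst (rconst c) * S d))"
    by (simp add: mult.assoc Z_op_sum sum_distrib_left)
  also have "\<dots> = (\<Sum>d\<in>{d \<in> psi_exponents G. \<forall>i\<in>e. d i = 0}. rconst (a * (pi\<^sup>2 / 6)) * (rconst c *
     (vertex_factors G d * rconst (\<Prod>e\<in>edges G - {e}. zeta_factor (1 + 2 * (\<Sum>i\<in>e. d i))))))"
  proof (intro sum.cong refl)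
    fix d assume d: "d \<in> {d \<in> psi_exponents G. \<forall>i\<in>e. d i = 0}"
    have "(\<Prod>e\<in>edges G. zeta_factor (1 + 2 * (\<Sum>i\<in>e. d i))) =
        pi\<^sup>2 / 6 * (\<Prod>e\<in>edges G - {e}. zeta_factor (1 + 2 * (\<Sum>i\<in>e. d i)))"
      using d by (subst prod.remove[OF finite_edges[OF wf] e_in]) (simp add: zeta_factor_1)
    then show "Z_op (econst (rconst c) * S d) = rconst (a * (pi\<^sup>2 / 6)) * (rconst c *
       (vertex_factors G d * rconst (\<Prod>e\<in>edges G - {e}. zeta_factor (1 + 2 * (\<Sum>i\<in>e. d i)))))"
      unfolding S_def econst_mult_single Z_op_edge_monomial[OF wf]
      by (simp only: rconst_mult mult_ac)
  qed
  also have "\<dots> = rconst (a * (pi\<^sup>2 / 6)) * (rconst c * weight (cut_edge p q G h))"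
    by (simp add: weight_cut_edge[OF wf h] e sum_distrib_left)
  finally show ?thesis by (simp add: a_def)
qed

text \<open>The sum over edges is written as half the sum over half-edges, since the inverse of cutting,
  gluing, distinguishes the two new legs; this turns \<open>\<pi>\<^sup>2/6\<close> into \<open>\<pi>\<^sup>2/12\<close>.\<close>

lemma Z_op_del_graph:
  assumes wf: "wf_graph G"
  shows "Z_op (del_graph G (P_graph g n G)) =
    rconst (vol_const g n / 2 ^ (card (verts G) - 1) / real (card (Aut G)) * (pi\<^sup>2 / 12)) *
      (\<Sum>h\<in>halves G - legs G. rconst (chi G {h, opp G h}) * weight (cut_edge p q G h))"
proof -
  define a where "a = vol_const g n / 2 ^ (card (verts G) - 1) / real (card (Aut G))"
  define f where "f = (\<lambda>e. Z_op (econst (rconst (chi G e)) * bvar e * at_zero e (pdiff e (P_graph g n G))))"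
  have f_half: "f {h, opp G h} = rconst (a * (pi\<^sup>2 / 6)) * (rconst (chi G {h, opp G h}) * weight (cut_edge p q G h))"
    if "h \<in> halves G - legs G" for h
    unfolding f_def a_def using Z_op_del_edge[OF wf that refl] by blast
  have "(\<Sum>h\<in>halves G - legs G. f {h, opp G h}) = (\<Sum>e\<in>edges G. \<Sum>h\<in>e. f {h, opp G h})"
    using edges_disjoint[OF wf] finite_edge
    by (subst Union_edges[OF wf, symmetric], subst sum.Union_disjoint) auto
  also have "\<dots> = (\<Sum>e\<in>edges G. \<Sum>h\<in>e. f e)"
    by (intro sum.cong refl) (metis edge_of_member(2)[OF wf])
  also have "\<dots> = (\<Sum>e\<in>edges G. 2 * f e)"
    by (intro sum.cong refl) (auto simp: edges_def)
  also have "\<dots> = 2 * Z_op (del_graph G (P_graph g n G))"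
    by (simp add: del_graph_def Z_op_sum f_def sum_distrib_left)
  finally have "rconst (1/2) * (2 * Z_op (del_graph G (P_graph g n G))) =
      rconst (1/2) * (rconst (a * (pi\<^sup>2 / 6)) * (\<Sum>h\<in>halves G - legs G. rconst (chi G {h, opp G h}) * weight (cut_edge p q G h)))"
    by (simp add: f_half sum_distrib_left)
  moreover have "rconst (1/2) * (2 * x) = x" for x
    using rconst_cancel[of 2 x] rconst_of_nat[of 2] by simp
  moreover have "rconst (1/2) * (rconst (a * (pi\<^sup>2 / 6)) * x) = rconst (a * (pi\<^sup>2 / 12)) * x" for x
    by (simp add: mult.assoc[symmetric] rconst_mult[symmetric])
  ultimately show ?thesis
    by (simp add: a_def)
qed

section \<open>Connectedness, bridges and stability\<close>

definition opp_closed :: "sgraph \<Rightarrow> nat set \<Rightarrow> bool" where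
  "opp_closed G A \<longleftrightarrow> (\<forall>h\<in>halves G. inc G h \<in> A \<longrightarrow> inc G (opp G h) \<in> A)"

text \<open>Connectedness without paths: no proper nonempty set of vertices is closed under passing to the
  other end of an edge. In this form it transfers easily to cut, glued and restricted graphs.\<close>

definition is_connected :: "sgraph \<Rightarrow> bool" where
  "is_connected G \<longleftrightarrow> verts G \<noteq> {} \<and> (\<forall>A \<subseteq> verts G. A \<noteq> {} \<longrightarrow> opp_closed G A \<longrightarrow> A = verts G)"

lemma reach_closed:
  assumes "(u, v) \<in> reach G F" "u \<in> A"
    "\<forall>h\<in>halves G. {h, opp G h} \<in> F \<longrightarrow> inc G h \<in> A \<longrightarrow> inc G (opp G h) \<in> A"
  shows "v \<in> A"
  using assms(1,2) unfolding reach_def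
  by (induction rule: rtrancl_induct) (use assms(3) in auto)

lemma connected_with_iff_closed:
  assumes "wf_graph G"
  shows "connected_with G F \<longleftrightarrow> verts G \<noteq> {} \<and> (\<forall>A \<subseteq> verts G. A \<noteq> {} \<longrightarrow>
    (\<forall>h\<in>halves G. {h, opp G h} \<in> F \<longrightarrow> inc G h \<in> A \<longrightarrow> inc G (opp G h) \<in> A) \<longrightarrow> A = verts G)"
    (is "_ \<longleftrightarrow> ?R")
proof
  assume *: "connected_with G F"
  show ?R
  proof (intro conjI allI impI)
    fix A assume A: "A \<subseteq> verts G" "A \<noteq> {}"
      "\<forall>h\<in>halves G. {h, opp G h} \<in> F \<longrightarrow> inc G h \<in> A \<longrightarrow> inc G (opp G h) \<in> A"
    then obtain u where "u \<in> A" by blast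
    then have "v \<in> A" if "v \<in> verts G" for v
      using * A that reach_closed[OF _ _ A(3)] unfolding connected_with_def by blast
    with A show "A = verts G" by blast
  qed (use * in \<open>simp add: connected_with_def\<close>)
next
  assume *: ?R
  show "connected_with G F"
    unfolding connected_with_def
  proof (intro conjI ballI)
    fix u v assume uv: "u \<in> verts G" "v \<in> verts G"
    let ?A = "reach G F `` {u}"
    have "?A \<subseteq> verts G"
      using reach_closed[of u _ G F "verts G"] uv wf_graphD[OF assms] by blast
    moreover have "u \<in> ?A" by (simp add: reach_def)
    moreover have "inc G (opp G h) \<in> ?A"
      if "h \<in> halves G" "{h, opp G h} \<in> F" "inc G h \<in> ?A" for h
      using that unfolding reach_def by (auto intro: rtrancl_into_rtrancl)
    ultimately have "?A = verts G"
      using * by blast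
    with uv show "(u, v) \<in> reach G F" by blast
  qed (use * in blast)
qed

lemma connected_with_edges:
  assumes "wf_graph G"
  shows "connected_with G (edges G) \<longleftrightarrow> is_connected G"
proof -
  have "{h, opp G h} \<in> edges G \<or> opp G h = h" if "h \<in> halves G" for h
    using that by (auto simp: edges_def)
  then have "(\<forall>h\<in>halves G. {h, opp G h} \<in> edges G \<longrightarrow> inc G h \<in> A \<longrightarrow> inc G (opp G h) \<in> A)
      \<longleftrightarrow> opp_closed G A" for A
    unfolding opp_closed_def by metis
  then show ?thesis
    by (simp add: connected_with_iff_closed[OF assms] is_connected_def)
qed

text \<open>Removing an edge and cutting it into two legs lead to the same closed sets of vertices.\<close>

lemma bridge_iff:
  assumes "wf_graph G" "h \<in> halves G - legs G"
  shows "bridge G {h, opp G h} \<longleftrightarrow> \<not> is_connected (cut_edge p q G h)"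
proof -
  note nl = non_legD[OF assms]
  have e: "{h, opp G h} \<in> edges G"
    using nl by (auto simp: edges_def)
  have iff: "{x, opp G x} \<in> edges G - {{h, opp G h}} \<longleftrightarrow> opp (cut_edge p q G h) x \<noteq> x"
    if "x \<in> halves G" for x
  proof -
    have "{x, opp G x} \<in> edges G \<longleftrightarrow> opp G x \<noteq> x"
      using edge_of_member(1)[OF assms(1), of "{x, opp G x}" x] that
      by (auto simp: edges_def legs_def)
    then show ?thesis
      using edge_eq_iff[OF assms that] by auto
  qed
  have "opp (cut_edge p q G h) x = opp G x \<or> opp (cut_edge p q G h) x = x" for x
    by auto
  then have "(\<forall>x\<in>halves G. {x, opp G x} \<in> edges G - {{h, opp G h}} \<longrightarrow> inc G x \<in> A \<longrightarrow> inc G (opp G x) \<in> A)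
      \<longleftrightarrow> opp_closed (cut_edge p q G h) A" for A
    unfolding opp_closed_def using iff by (metis cut_edge_simps(2,3))
  then have "connected_with G (edges G - {{h, opp G h}}) \<longleftrightarrow> is_connected (cut_edge p q G h)"
    by (simp add: connected_with_iff_closed[OF assms(1)] is_connected_def)
  then show ?thesis
    using e by (simp add: bridge_def)
qed

text \<open>The genus condition is doubled and stated over the natural numbers: a connected graph has first Betti
  number \<open>|E| - |V| + 1\<close>, and \<open>2 |E|\<close> is the number of half-edges minus the number of legs. The set of leg
  labels is arbitrary, since the components of a cut graph do not carry the labels \<open>1, \<dots>, n\<close>.\<close>

definition stable_type :: "nat \<Rightarrow> nat set \<Rightarrow> sgraph \<Rightarrow> bool" where
  "stable_type g L G \<longleftrightarrow> wf_graph G \<and> bij_betw (leg_label G) (legs G) L \<and> is_connected G \<and>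
     2 * g + 2 * card (verts G) + card L = card (halves G) + 2 + 2 * (\<Sum>v\<in>verts G. genus G v) \<and>
     (\<forall>v\<in>verts G. 2 * genus G v + card (halves_at G v) > 2)"

lemma card_edges:
  assumes wf: "wf_graph G"
  shows "2 * card (edges G) + card (legs G) = card (halves G)"
proof -
  have "card (halves G - legs G) = (\<Sum>e\<in>edges G. card e)"
    using edges_disjoint[OF wf] finite_edge
    by (subst Union_edges[OF wf, symmetric], subst card_Union_disjoint)
       (auto simp: pairwise_def disjnt_def)
  also have "\<dots> = 2 * card (edges G)"
    by (subst sum.cong[OF refl, of _ _ "\<lambda>_. 2"]) (auto simp: edges_def)
  finally have "card (halves G - legs G) = 2 * card (edges G)" .
  moreover have "legs G \<subseteq> halves G" by (auto simp: legs_def)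
  moreover have "finite (halves G)" using wf by (simp add: wf_graph_def)
  ultimately show ?thesis
    by (metis add.commute card_Diff_subset card_mono finite_subset le_add_diff_inverse)
qed

lemma stable_graph_iff: "stable_graph g n G \<longleftrightarrow> stable_type g {1..n} G"
proof (cases "wf_graph G \<and> bij_betw (leg_label G) (legs G) {1..n} \<and> is_connected G")
  case True
  then have wf: "wf_graph G" and is_connected: "connected_with G (edges G)"
    and legs: "card (legs G) = n"
    by (auto simp: connected_with_edges dest: bij_betw_same_card)
  have "reach G (edges G) `` {v} = verts G" if "v \<in> verts G" for v
    using that is_connected reach_closed[of v _ G "edges G" "verts G"] wf_graphD[OF wf]
    unfolding connected_with_def by blast
  then have "components G (edges G) = (\<lambda>v. verts G) ` verts G"
    unfolding components_def by (rule image_cong[OF refl])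
  then have "components G (edges G) = {verts G}"
    using is_connected by (auto simp: connected_with_def)
  then have "int g = betti1 G + int (\<Sum>v\<in>verts G. genus G v) \<longleftrightarrow>
      2 * g + 2 * card (verts G) + card {1..n} = card (halves G) + 2 + 2 * (\<Sum>v\<in>verts G. genus G v)"
    using card_edges[OF wf] legs unfolding betti1_def by (simp del: of_nat_sum) linarith
  then show ?thesis
    using True is_connected unfolding stable_graph_def stable_type_def wf_graph_def by blast
next
  case False
  then show ?thesis
    by (auto simp: stable_graph_def stable_type_def connected_with_edges wf_graph_def)
qed

section \<open>Isomorphisms\<close>

text \<open>The renaming \<open>\<kappa>\<close> of the leg labels allows the components of a cut graph, which carry only some of the
  labels, to be compared with graphs labelled by \<open>1, \<dots>, n\<close>.\<close>

definition graph_iso :: "(nat \<Rightarrow> nat) \<Rightarrow> (nat \<Rightarrow> nat) \<Rightarrow> (nat \<Rightarrow> nat) \<Rightarrow> sgraph \<Rightarrow> sgraph \<Rightarrow> bool" where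
  "graph_iso \<phi> \<psi> \<kappa> G K \<longleftrightarrow>
     bij_betw \<phi> (verts G) (verts K) \<and> bij_betw \<psi> (halves G) (halves K) \<and>
     (\<forall>h\<in>halves G. inc K (\<psi> h) = \<phi> (inc G h) \<and> opp K (\<psi> h) = \<psi> (opp G h)) \<and>
     (\<forall>v\<in>verts G. genus K (\<phi> v) = genus G v) \<and>
     (\<forall>h\<in>legs G. leg_label K (\<psi> h) = \<kappa> (leg_label G h))"

lemma isos_iff:
  "(\<phi>, \<psi>) \<in> isos G K \<longleftrightarrow>
     \<phi> \<in> extensional (verts G) \<and> \<psi> \<in> extensional (halves G) \<and> graph_iso \<phi> \<psi> id G K"
  by (auto simp: isos_def graph_iso_def)

lemma graph_isoD:
  assumes "graph_iso \<phi> \<psi> \<kappa> G K"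
  shows "bij_betw \<phi> (verts G) (verts K)" "bij_betw \<psi> (halves G) (halves K)"
    "inj_on \<phi> (verts G)" "inj_on \<psi> (halves G)"
    "verts K = \<phi> ` verts G" "halves K = \<psi> ` halves G"
    "\<And>h. h \<in> halves G \<Longrightarrow> inc K (\<psi> h) = \<phi> (inc G h)"
    "\<And>h. h \<in> halves G \<Longrightarrow> opp K (\<psi> h) = \<psi> (opp G h)"
    "\<And>v. v \<in> verts G \<Longrightarrow> genus K (\<phi> v) = genus G v"
    "\<And>h. h \<in> legs G \<Longrightarrow> leg_label K (\<psi> h) = \<kappa> (leg_label G h)"
  using assms unfolding graph_iso_def by (auto simp: bij_betw_def)

lemma legs_subset: "legs G \<subseteq> halves G"
  by (auto simp: legs_def)

lemma graph_iso_cong: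
  assumes "wf_graph G" "graph_iso \<phi> \<psi> \<kappa> G K"
    "\<And>v. v \<in> verts G \<Longrightarrow> \<phi>' v = \<phi> v" "\<And>h. h \<in> halves G \<Longrightarrow> \<psi>' h = \<psi> h"
    "\<And>h. h \<in> legs G \<Longrightarrow> \<kappa>' (leg_label G h) = \<kappa> (leg_label G h)"
  shows "graph_iso \<phi>' \<psi>' \<kappa>' G K"
proof -
  have "bij_betw \<phi>' (verts G) (verts K)" "bij_betw \<psi>' (halves G) (halves K)"
    using bij_betw_cong[of "verts G" \<phi>' \<phi>] bij_betw_cong[of "halves G" \<psi>' \<psi>] assms
    by (auto simp: graph_iso_def)
  moreover have "h \<in> halves G" if "h \<in> legs G" for h
    using that legs_subset by blast
  ultimately show ?thesis
    using assms wf_graphD(3,4)[OF assms(1)] unfolding graph_iso_def by simp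
qed

lemma graph_iso_refl: "graph_iso id id id G G"
  by (simp add: graph_iso_def)

lemma wf_graph_iso:
  assumes wf: "wf_graph G" and iso: "graph_iso \<phi> \<psi> \<kappa> G K"
  shows "wf_graph K"
  using wf graph_isoD(5-8)[OF iso] by (auto simp: wf_graph_def)

lemma legs_iso:
  assumes wf: "wf_graph G" and iso: "graph_iso \<phi> \<psi> \<kappa> G K"
  shows "legs K = \<psi> ` legs G"
  using graph_isoD(6,8)[OF iso] inj_onD[OF graph_isoD(4)[OF iso]] wf_graphD(4)[OF wf]
  by (fastforce simp: legs_def)

lemma halves_at_iso:
  assumes wf: "wf_graph G" and iso: "graph_iso \<phi> \<psi> \<kappa> G K" and v: "v \<in> verts G"
  shows "halves_at K (\<phi> v) = \<psi> ` halves_at G v"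
  using graph_isoD(6,7)[OF iso] inj_onD[OF graph_isoD(3)[OF iso]] wf_graphD(3)[OF wf] v
  by (fastforce simp: halves_at_def)

lemma edges_iso:
  assumes wf: "wf_graph G" and iso: "graph_iso \<phi> \<psi> \<kappa> G K"
  shows "edges K = (`) \<psi> ` edges G"
proof -
  have "halves K - legs K = \<psi> ` (halves G - legs G)"
    using graph_isoD(4,6)[OF iso] legs_iso[OF wf iso] legs_subset[of G]
    by (simp add: inj_on_image_set_diff)
  then show ?thesis
    using graph_isoD(8)[OF iso] by (auto simp: edges_image image_image intro!: image_cong)
qed

lemma graph_iso_comp:
  assumes wf: "wf_graph G" and iso: "graph_iso \<phi> \<psi> \<kappa> G K" "graph_iso \<phi>' \<psi>' \<kappa>' K \<Theta>"
  shows "graph_iso (\<phi>' \<circ> \<phi>) (\<psi>' \<circ> \<psi>) (\<kappa>' \<circ> \<kappa>) G \<Theta>"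
  using bij_betw_trans[OF graph_isoD(1)[OF iso(1)] graph_isoD(1)[OF iso(2)]]
    bij_betw_trans[OF graph_isoD(2)[OF iso(1)] graph_isoD(2)[OF iso(2)]]
    graph_isoD(5-10)[OF iso(1)] graph_isoD(5-10)[OF iso(2)] legs_iso[OF wf iso(1)]
    wf_graphD(3,4)[OF wf] legs_subset[of G]
  unfolding graph_iso_def by auto

lemma graph_iso_sym:
  assumes wf: "wf_graph G" and iso: "graph_iso \<phi> \<psi> \<kappa> G K"
    and \<mu>: "\<And>h. h \<in> legs G \<Longrightarrow> \<mu> (\<kappa> (leg_label G h)) = leg_label G h"
  shows "graph_iso (inv_into (verts G) \<phi>) (inv_into (halves G) \<psi>) \<mu> K G"
proof -
  note D = graph_isoD[OF iso]
  have "inc G (inv_into (halves G) \<psi> (\<psi> h)) = inv_into (verts G) \<phi> (inc K (\<psi> h)) \<and>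
      opp G (inv_into (halves G) \<psi> (\<psi> h)) = inv_into (halves G) \<psi> (opp K (\<psi> h))"
    if "h \<in> halves G" for h
    using that D wf_graphD[OF wf] by simp
  moreover have "genus G (inv_into (verts G) \<phi> (\<phi> v)) = genus K (\<phi> v)" if "v \<in> verts G" for v
    using that D by simp
  moreover have "leg_label G (inv_into (halves G) \<psi> (\<psi> h)) = \<mu> (leg_label K (\<psi> h))" if "h \<in> legs G" for h
    using that D \<mu> legs_subset[of G] by (simp add: subset_iff)
  moreover have "bij_betw (inv_into (verts G) \<phi>) (verts K) (verts G)"
    "bij_betw (inv_into (halves G) \<psi>) (halves K) (halves G)"
    using D(1,2) by (simp_all add: bij_betw_inv_into)
  ultimately show ?thesis
    unfolding graph_iso_def legs_iso[OF wf iso] D(5,6) by blast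
qed

lemma graph_iso_sym_id:
  assumes "wf_graph G" "graph_iso \<phi> \<psi> id G K"
  shows "graph_iso (inv_into (verts G) \<phi>) (inv_into (halves G) \<psi>) id K G"
  using graph_iso_sym[OF assms, of id] by simp

lemma vertex_factor_image:
  assumes "inj_on \<psi> I"
  shows "vertex_factor k (\<psi> ` I) d = vertex_factor k I (d \<circ> \<psi>)"
proof -
  have "image_mset d (mset_set (\<psi> ` I)) = image_mset (d \<circ> \<psi>) (mset_set I)"
    by (simp add: image_mset_mset_set[OF assms, symmetric] multiset.map_comp)
  then show ?thesis
    by (simp add: vertex_factor_def card_image[OF assms] prod.reindex[OF assms])
qed

text \<open>An exponent function on the half-edges of \<open>K\<close> is pulled back along \<open>\<psi>\<close>; vertices, edges and their
  factors correspond.\<close>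

lemma weight_iso:
  assumes wf: "wf_graph G" and iso: "graph_iso \<phi> \<psi> \<kappa> G K"
  shows "weight K = weight G"
proof -
  note D = graph_isoD[OF iso]
  have inj_at: "inj_on \<psi> (halves_at G v)" for v
    using D(4) by (rule inj_on_subset) (auto simp: halves_at_def)
  have inj_e: "inj_on \<psi> e" if "e \<in> edges G" for e
    using D(4) by (rule inj_on_subset) (use edge_of_member[OF wf that] in blast)
  have inj_edges: "inj_on ((`) \<psi>) (edges G)"
  proof (rule inj_onI)
    fix e e' assume "e \<in> edges G" "e' \<in> edges G" "\<psi> ` e = \<psi> ` e'"
    moreover from this have "e \<subseteq> halves G" "e' \<subseteq> halves G"
      using edge_of_member(1)[OF wf] by blast+
    ultimately show "e = e'"
      using D(4) by (simp add: inj_on_image_eq_iff)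
  qed
  have factors: "vertex_factors K d = vertex_factors G (restrict (d \<circ> \<psi>) (halves G))" for d
  proof -
    have "vertex_factors K d = (\<Prod>v\<in>verts G. vertex_factor (genus K (\<phi> v)) (halves_at K (\<phi> v)) d)"
      by (simp add: vertex_factors_def D(5) prod.reindex[OF D(3)])
    also have "\<dots> = (\<Prod>v\<in>verts G. vertex_factor (genus G v) (halves_at G v) (d \<circ> \<psi>))"
      by (intro prod.cong refl) (simp add: D(9) halves_at_iso[OF wf iso] vertex_factor_image[OF inj_at])
    also have "\<dots> = vertex_factors G (restrict (d \<circ> \<psi>) (halves G))"
      unfolding vertex_factors_def
      by (intro prod.cong refl vertex_factor_cong finite_halves_at[OF wf]) (auto simp: halves_at_def)
    finally show ?thesis .
  qed
  have zeta_factors: "(\<Prod>e\<in>edges K. zeta_factor (1 + 2 * (\<Sum>i\<in>e. d i))) =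
      (\<Prod>e\<in>edges G. zeta_factor (1 + 2 * (\<Sum>i\<in>e. restrict (d \<circ> \<psi>) (halves G) i)))" for d
  proof -
    have "(\<Sum>i\<in>\<psi> ` e. d i) = (\<Sum>i\<in>e. restrict (d \<circ> \<psi>) (halves G) i)" if "e \<in> edges G" for e
      unfolding sum.reindex[OF inj_e[OF that]]
      by (intro sum.cong refl) (use edge_of_member(1)[OF wf that] in auto)
    then show ?thesis
      by (simp add: edges_iso[OF wf iso] prod.reindex[OF inj_edges])
  qed
  have psi_iff: "restrict (d \<circ> \<psi>) (halves G) \<in> psi_exponents G \<longleftrightarrow> d \<in> psi_exponents K"
    if "d \<in> extensional (halves K)" for d
  proof -
    have "(\<Sum>i\<in>halves_at K (\<phi> v). d i) = (\<Sum>i\<in>halves_at G v. restrict (d \<circ> \<psi>) (halves G) i)"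
      "card (halves_at K (\<phi> v)) = card (halves_at G v)"
      if "v \<in> verts G" for v
      unfolding halves_at_iso[OF wf iso that] sum.reindex[OF inj_at] card_image[OF inj_at]
      by (auto intro!: sum.cong simp: halves_at_def)
    moreover have "restrict (d \<circ> \<psi>) (halves G) h = d (\<psi> h)" if "h \<in> legs G" for h
      using that legs_subset[of G] by auto
    ultimately show ?thesis
      using that D(9) by (auto simp: psi_exponents_def PiE_iff D(5) legs_iso[OF wf iso])
  qed
  show ?thesis
    unfolding weight_def
  proof (rule sum.reindex_bij_witness[of _ "\<lambda>d. restrict (d \<circ> inv_into (halves G) \<psi>) (halves K)"
        "\<lambda>d. restrict (d \<circ> \<psi>) (halves G)"])
    fix d assume d: "d \<in> psi_exponents K"
    then have ext: "d \<in> extensional (halves K)"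
      by (simp add: psi_exponents_def PiE_iff)
    show "restrict (restrict (d \<circ> \<psi>) (halves G) \<circ> inv_into (halves G) \<psi>) (halves K) = d"
      using ext D(2) D(6) by (auto simp: fun_eq_iff extensional_def inv_into_into f_inv_into_f)
    show "restrict (d \<circ> \<psi>) (halves G) \<in> psi_exponents G"
      using d psi_iff[OF ext] by simp
    show "vertex_factors G (restrict (d \<circ> \<psi>) (halves G)) *
        rconst (\<Prod>e\<in>edges G. zeta_factor (1 + 2 * sum (restrict (d \<circ> \<psi>) (halves G)) e)) =
      vertex_factors K d * rconst (\<Prod>e\<in>edges K. zeta_factor (1 + 2 * sum d e))"
      by (simp only: factors zeta_factors)
  next
    fix d assume d: "d \<in> psi_exponents G"
    then have ext: "d \<in> extensional (halves G)"
      by (simp add: psi_exponents_def PiE_iff)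
    show *: "restrict (restrict (d \<circ> inv_into (halves G) \<psi>) (halves K) \<circ> \<psi>) (halves G) = d"
      using ext D(4) D(6) by (auto simp: fun_eq_iff extensional_def)
    show "restrict (d \<circ> inv_into (halves G) \<psi>) (halves K) \<in> psi_exponents K"
      by (subst psi_iff[symmetric]) (use d * in auto)
  qed
qed

lemma is_connected_iso_imp:
  assumes wf: "wf_graph G" and iso: "graph_iso \<phi> \<psi> \<kappa> G K" and is_connected: "is_connected G"
  shows "is_connected K"
  unfolding is_connected_def
proof (intro conjI allI impI)
  note D = graph_isoD[OF iso]
  show "verts K \<noteq> {}"
    using is_connected by (simp add: D(5) is_connected_def)
  fix A assume A: "A \<subseteq> verts K" "A \<noteq> {}" "opp_closed K A"
  define B where "B = {v \<in> verts G. \<phi> v \<in> A}"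
  have "B \<noteq> {}" "B \<subseteq> verts G" "A = \<phi> ` B"
    using A(1,2) by (auto simp: B_def D(5))
  moreover have "opp_closed G B"
    unfolding opp_closed_def
  proof (intro ballI impI)
    fix h assume h: "h \<in> halves G" "inc G h \<in> B"
    then have "inc K (opp K (\<psi> h)) \<in> A"
      using A(3) D(6,7) by (auto simp: opp_closed_def B_def)
    then show "inc G (opp G h) \<in> B"
      using h wf_graphD[OF wf] D(7,8) by (simp add: B_def)
  qed
  ultimately have "B = verts G"
    using is_connected by (simp add: is_connected_def)
  then show "A = verts K"
    using \<open>A = \<phi> ` B\<close> D(5) by simp
qed

lemma is_connected_iso:
  assumes wf: "wf_graph G" and iso: "graph_iso \<phi> \<psi> id G K"
  shows "is_connected K \<longleftrightarrow> is_connected G"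
  using is_connected_iso_imp[OF wf iso] is_connected_iso_imp[OF wf_graph_iso[OF wf iso] graph_iso_sym_id[OF wf iso]]
  by blast

lemma stable_type_iso:
  assumes stable_type: "stable_type g L G" and iso: "graph_iso \<phi> \<psi> \<kappa> G K" and inj: "inj_on \<kappa> L"
  shows "stable_type g (\<kappa> ` L) K"
proof -
  note D = graph_isoD[OF iso]
  have wf: "wf_graph G" and lab: "bij_betw (leg_label G) (legs G) L"
    using stable_type by (auto simp: stable_type_def)
  have "bij_betw (leg_label K) (legs K) (\<kappa> ` L)"
  proof (rule bij_betwI')
    fix x y assume "x \<in> legs K" "y \<in> legs K"
    then obtain h k where "h \<in> legs G" "x = \<psi> h" "k \<in> legs G" "y = \<psi> k"
      by (auto simp: legs_iso[OF wf iso])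
    moreover from this have "leg_label G h \<in> L" "leg_label G k \<in> L"
      using lab by (auto simp: bij_betw_def)
    ultimately show "(leg_label K x = leg_label K y) = (x = y)"
      using inj lab legs_subset[of G] inj_on_eq_iff[OF D(4), of h k]
      by (auto simp: D(10) inj_on_eq_iff bij_betw_def)
  next
    fix x assume "x \<in> legs K"
    then show "leg_label K x \<in> \<kappa> ` L"
      using lab by (auto simp: legs_iso[OF wf iso] D(10) bij_betw_def)
  next
    fix y assume "y \<in> \<kappa> ` L"
    then show "\<exists>x\<in>legs K. y = leg_label K x"
      using lab by (auto simp: legs_iso[OF wf iso] D(10) bij_betw_def)
  qed
  moreover have "card (\<kappa> ` L) = card L" "card (verts K) = card (verts G)" "card (halves K) = card (halves G)"
    using inj D(1,2) by (auto simp: card_image dest: bij_betw_same_card)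
  moreover have "(\<Sum>v\<in>verts K. genus K v) = (\<Sum>v\<in>verts G. genus G v)"
    by (simp add: D(5) sum.reindex[OF D(3)] D(9))
  moreover have "card (halves_at K (\<phi> v)) = card (halves_at G v)" if "v \<in> verts G" for v
    unfolding halves_at_iso[OF wf iso that]
    by (rule card_image, rule inj_on_subset[OF D(4)]) (auto simp: halves_at_def)
  then have "\<forall>v\<in>verts K. 2 < 2 * genus K v + card (halves_at K v)"
    using stable_type by (auto simp: D(5) D(9) stable_type_def)
  ultimately show ?thesis
    using stable_type is_connected_iso_imp[OF wf iso] wf_graph_iso[OF wf iso] by (simp add: stable_type_def)
qed

section \<open>Labelled graphs\<close>

text \<open>Fixing the values outside the carriers makes equality of graphs mean equality of the structure on
  the carriers, so that there are only finitely many graphs with given vertices and half-edges.\<close>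

definition canonical :: "sgraph \<Rightarrow> bool" where
  "canonical G \<longleftrightarrow> inc G \<in> extensional (halves G) \<and> opp G \<in> extensional (halves G) \<and>
     genus G \<in> extensional (verts G) \<and> leg_label G \<in> extensional (legs G)"

lemma canonical_eqI:
  assumes "canonical G" "canonical K" "verts G = verts K" "halves G = halves K"
    "\<And>h. h \<in> halves G \<Longrightarrow> inc G h = inc K h" "\<And>h. h \<in> halves G \<Longrightarrow> opp G h = opp K h"
    "\<And>v. v \<in> verts G \<Longrightarrow> genus G v = genus K v" "\<And>h. h \<in> legs G \<Longrightarrow> leg_label G h = leg_label K h"
  shows "G = K"
proof -
  have legs: "legs G = legs K"
    using assms(4,6) by (auto simp: legs_def)
  have "inc G = inc K" "opp G = opp K" "genus G = genus K" "leg_label G = leg_label K"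
    using assms(1,2) unfolding canonical_def assms(3,4)[symmetric] legs[symmetric]
    by (auto intro: extensionalityI simp: assms(5-8))
  then show ?thesis
    using assms(3,4) by (intro sgraph.equality) auto
qed

definition relabel :: "(nat \<Rightarrow> nat) \<Rightarrow> (nat \<Rightarrow> nat) \<Rightarrow> (nat \<Rightarrow> nat) \<Rightarrow> sgraph \<Rightarrow> sgraph" where
  "relabel \<phi> \<psi> \<kappa> G = \<lparr>verts = \<phi> ` verts G, halves = \<psi> ` halves G,
     inc = restrict (\<phi> \<circ> inc G \<circ> inv_into (halves G) \<psi>) (\<psi> ` halves G),
     opp = restrict (\<psi> \<circ> opp G \<circ> inv_into (halves G) \<psi>) (\<psi> ` halves G),
     genus = restrict (genus G \<circ> inv_into (verts G) \<phi>) (\<phi> ` verts G),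
     leg_label = restrict (\<kappa> \<circ> leg_label G \<circ> inv_into (halves G) \<psi>) (\<psi> ` legs G)\<rparr>"

lemma relabel_simps [simp]: "verts (relabel \<phi> \<psi> \<kappa> G) = \<phi> ` verts G" "halves (relabel \<phi> \<psi> \<kappa> G) = \<psi> ` halves G"
  by (simp_all add: relabel_def)

lemma relabel_iso:
  assumes wf: "wf_graph G" and inj: "inj_on \<phi> (verts G)" "inj_on \<psi> (halves G)"
  shows "graph_iso \<phi> \<psi> \<kappa> G (relabel \<phi> \<psi> \<kappa> G)"
  using inj legs_subset[of G]
  by (auto simp: graph_iso_def relabel_def inj_on_imp_bij_betw)

lemma canonical_relabel:
  assumes wf: "wf_graph G" and inj: "inj_on \<phi> (verts G)" "inj_on \<psi> (halves G)"
  shows "canonical (relabel \<phi> \<psi> \<kappa> G)"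
  unfolding canonical_def legs_iso[OF wf relabel_iso[OF wf inj]] by (simp add: relabel_def)

lemma graph_iso_unique:
  assumes wf: "wf_graph G" and iso: "graph_iso \<phi> \<psi> \<kappa> G K" "graph_iso \<phi> \<psi> \<kappa> G K'"
    and can: "canonical K" "canonical K'"
  shows "K = K'"
proof -
  note D = graph_isoD[OF iso(1)] and D' = graph_isoD[OF iso(2)]
  show ?thesis
    using D(5-10) D'(5-10) legs_subset[of G]
    by (intro canonical_eqI[OF can]) (auto simp: legs_iso[OF wf iso(1)])
qed

definition labelled :: "nat \<Rightarrow> nat set \<Rightarrow> nat set \<Rightarrow> nat set \<Rightarrow> sgraph set" where
  "labelled g V H L = {G. verts G = V \<and> halves G = H \<and> canonical G \<and> stable_type g L G}"

lemma relabel_labelled: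
  assumes G: "G \<in> labelled g V H L"
    and bij: "bij_betw \<phi> V V'" "bij_betw \<psi> H H'" "bij_betw \<kappa> L L'"
  shows "relabel \<phi> \<psi> \<kappa> G \<in> labelled g V' H' L'"
proof -
  have wf: "wf_graph G" and stable_type: "stable_type g L G" and VH: "verts G = V" "halves G = H"
    using G by (auto simp: labelled_def stable_type_def)
  have inj: "inj_on \<phi> (verts G)" "inj_on \<psi> (halves G)" "inj_on \<kappa> L"
    and im: "\<phi> ` V = V'" "\<psi> ` H = H'" "\<kappa> ` L = L'"
    using bij by (auto simp: VH bij_betw_def)
  show ?thesis
    using stable_type_iso[OF stable_type relabel_iso[OF wf inj(1,2)] inj(3)] canonical_relabel[OF wf inj(1,2)]
    by (simp add: labelled_def VH im)
qed

lemma relabel_inverse: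
  assumes G: "G \<in> labelled g V H L"
    and bij: "bij_betw \<phi> V V'" "bij_betw \<psi> H H'" "bij_betw \<kappa> L L'"
    and inv: "\<And>v. v \<in> V \<Longrightarrow> \<phi>' (\<phi> v) = v" "\<And>h. h \<in> H \<Longrightarrow> \<psi>' (\<psi> h) = h" "\<And>l. l \<in> L \<Longrightarrow> \<kappa>' (\<kappa> l) = l"
  shows "relabel \<phi>' \<psi>' \<kappa>' (relabel \<phi> \<psi> \<kappa> G) = G"
proof -
  have lab: "leg_label G h \<in> L" if "h \<in> legs G" for h
    using G that by (auto simp: labelled_def stable_type_def bij_betw_def)
  have wf: "wf_graph G" and can: "canonical G" and VH: "verts G = V" "halves G = H"
    using G by (auto simp: labelled_def stable_type_def)
  have inj: "inj_on \<phi> (verts G)" "inj_on \<psi> (halves G)"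
    using bij by (auto simp: VH bij_betw_def)
  let ?K = "relabel \<phi> \<psi> \<kappa> G"
  have inj': "inj_on \<phi>' (verts ?K)" "inj_on \<psi>' (halves ?K)"
    using inv(1,2) by (auto simp: VH inj_on_def)
  have iso: "graph_iso \<phi> \<psi> \<kappa> G ?K"
    by (rule relabel_iso[OF wf inj])
  have wf': "wf_graph ?K"
    by (rule wf_graph_iso[OF wf iso])
  have "graph_iso (\<phi>' \<circ> \<phi>) (\<psi>' \<circ> \<psi>) (\<kappa>' \<circ> \<kappa>) G (relabel \<phi>' \<psi>' \<kappa>' ?K)"
    by (rule graph_iso_comp[OF wf iso relabel_iso[OF wf' inj']])
  moreover have "graph_iso (\<phi>' \<circ> \<phi>) (\<psi>' \<circ> \<psi>) (\<kappa>' \<circ> \<kappa>) G G"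
    by (rule graph_iso_cong[OF wf graph_iso_refl]) (auto simp: VH inv lab)
  ultimately show ?thesis
    using graph_iso_unique[OF wf] canonical_relabel[OF wf' inj'] can by blast
qed

text \<open>Relabelling along bijections is a bijection, so this sum depends only on the cardinalities
  of \<open>V\<close>, \<open>H\<close> and \<open>L\<close>.\<close>

lemma sum_weight_transport:
  assumes bij: "bij_betw \<phi> V V'" "bij_betw \<psi> H H'" "bij_betw \<kappa> L L'"
  shows "(\<Sum>G\<in>labelled g V H L. weight G) = (\<Sum>G\<in>labelled g V' H' L'. weight G)"
proof (rule sum.reindex_bij_witness[of _ "relabel (inv_into V \<phi>) (inv_into H \<psi>) (inv_into L \<kappa>)" "relabel \<phi> \<psi> \<kappa>"])
  note bij' = bij_betw_inv_into[OF bij(1)] bij_betw_inv_into[OF bij(2)] bij_betw_inv_into[OF bij(3)]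
  fix G assume G: "G \<in> labelled g V H L"
  show "relabel (inv_into V \<phi>) (inv_into H \<psi>) (inv_into L \<kappa>) (relabel \<phi> \<psi> \<kappa> G) = G"
    using bij by (intro relabel_inverse[OF G bij]) (auto simp: bij_betw_def)
  show "relabel \<phi> \<psi> \<kappa> G \<in> labelled g V' H' L'"
    by (rule relabel_labelled[OF G bij])
  show "weight (relabel \<phi> \<psi> \<kappa> G) = weight G"
    using G bij by (intro weight_iso[OF _ relabel_iso]) (auto simp: labelled_def stable_type_def bij_betw_def)
next
  note bij' = bij_betw_inv_into[OF bij(1)] bij_betw_inv_into[OF bij(2)] bij_betw_inv_into[OF bij(3)]
  fix G assume G: "G \<in> labelled g V' H' L'"
  show "relabel \<phi> \<psi> \<kappa> (relabel (inv_into V \<phi>) (inv_into H \<psi>) (inv_into L \<kappa>) G) = G"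
    using bij by (intro relabel_inverse[OF G bij']) (auto simp: bij_betw_def f_inv_into_f)
  show "relabel (inv_into V \<phi>) (inv_into H \<psi>) (inv_into L \<kappa>) G \<in> labelled g V H L"
    by (rule relabel_labelled[OF G bij'])
qed

section \<open>From isomorphism classes to labelled graphs\<close>

definition bijections :: "nat set \<Rightarrow> nat set \<Rightarrow> (nat \<Rightarrow> nat) set" where
  "bijections A B = {f \<in> extensional A. bij_betw f A B}"

lemma card_bijections:
  assumes "finite A" "finite B" "card A = card B"
  shows "card (bijections A B) = fact (card A)"
proof -
  obtain b where b: "bij_betw b A B"
    using finite_same_card_bij[OF assms] by blast
  have "bij_betw (\<lambda>p. restrict (b \<circ> p) A) {p. p permutes A} (bijections A B)"
  proof (rule bij_betw_byWitness[where f' = "\<lambda>f x. if x \<in> A then inv_into A b (f x) else x"])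
    show "\<forall>p\<in>{p. p permutes A}. (\<lambda>x. if x \<in> A then inv_into A b (restrict (b \<circ> p) A x) else x) = p"
      using b by (auto simp: fun_eq_iff permutes_in_image bij_betw_def permutes_not_in)
    show "\<forall>f\<in>bijections A B. restrict (b \<circ> (\<lambda>x. if x \<in> A then inv_into A b (f x) else x)) A = f"
      using bij_betw_inv_into_right[OF b] by (auto simp: fun_eq_iff bijections_def extensional_def dest: bij_betwE)
    show "(\<lambda>p. restrict (b \<circ> p) A) ` {p. p permutes A} \<subseteq> bijections A B"
      using bij_betw_trans[OF permutes_imp_bij b] by (auto simp: bijections_def bij_betw_restrict_eq)
    show "(\<lambda>f x. if x \<in> A then inv_into A b (f x) else x) ` bijections A B \<subseteq> {p. p permutes A}"
    proof clarify
      fix f assume "f \<in> bijections A B"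
      then have "bij_betw (inv_into A b \<circ> f) A A"
        using b by (auto simp: bijections_def intro: bij_betw_trans bij_betw_inv_into)
      then have "bij_betw (\<lambda>x. if x \<in> A then inv_into A b (f x) else x) A A"
        by (rule bij_betw_cong[THEN iffD1, rotated]) simp
      then show "(\<lambda>x. if x \<in> A then inv_into A b (f x) else x) permutes A"
        by (rule bij_imp_permutes) simp
    qed
  qed
  then show ?thesis
    using card_permutations[OF refl assms(1)] by (simp add: bij_betw_same_card[symmetric])
qed

lemma finite_bijections: "finite A \<Longrightarrow> finite B \<Longrightarrow> finite (bijections A B)"
  by (rule finite_subset[OF _ finite_PiE[of A "\<lambda>_. B"]]) (auto simp: bijections_def PiE_iff extensional_def bij_betw_def)

lemma isos_subset_bijections: "isos G K \<subseteq> bijections (verts G) (verts K) \<times> bijections (halves G) (halves K)"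
  by (auto simp: isos_def bijections_def)

lemma finite_isos:
  assumes "wf_graph G" "wf_graph K"
  shows "finite (isos G K)"
  by (rule finite_subset[OF isos_subset_bijections])
     (use assms in \<open>auto simp: wf_graph_def intro: finite_bijections\<close>)

lemma isosI:
  assumes "wf_graph G" "graph_iso \<phi> \<psi> id G K"
  shows "(restrict \<phi> (verts G), restrict \<psi> (halves G)) \<in> isos G K"
  unfolding isos_iff using graph_iso_cong[OF assms] by auto

lemma isos_nonempty_iff:
  assumes "wf_graph G"
  shows "isos G K \<noteq> {} \<longleftrightarrow> (\<exists>\<phi> \<psi>. graph_iso \<phi> \<psi> id G K)"
  using isosI[OF assms] isos_iff by fast

text \<open>The isomorphisms between two isomorphic graphs form a torsor under the automorphism group.\<close>

lemma card_isos:
  assumes wf: "wf_graph G" and ne: "isos G K \<noteq> {}"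
  shows "card (isos G K) = card (Aut G)"
proof -
  obtain \<alpha> \<beta> where iso: "graph_iso \<alpha> \<beta> id G K"
    using ne isos_nonempty_iff[OF wf] by blast
  note D = graph_isoD[OF iso]
  have wf': "wf_graph K"
    by (rule wf_graph_iso[OF wf iso])
  note inv = graph_iso_sym_id[OF wf iso]
  define f where "f = (\<lambda>(\<phi>, \<psi>). (restrict (\<alpha> \<circ> \<phi>) (verts G), restrict (\<beta> \<circ> \<psi>) (halves G)))"
  define f' where "f' = (\<lambda>(\<phi>, \<psi>). (restrict (inv_into (verts G) \<alpha> \<circ> \<phi>) (verts G),
        restrict (inv_into (halves G) \<beta> \<circ> \<psi>) (halves G)))"
  have "bij_betw f (Aut G) (isos G K)"
  proof (rule bij_betw_byWitness[where f' = f'])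
    show "f ` Aut G \<subseteq> isos G K"
    proof (rule image_subsetI)
      fix x assume "x \<in> Aut G"
      then obtain \<phi> \<psi> where x: "x = (\<phi>, \<psi>)" "graph_iso \<phi> \<psi> id G G"
        by (cases x) (auto simp: isos_iff)
      then have "graph_iso (\<alpha> \<circ> \<phi>) (\<beta> \<circ> \<psi>) id G K"
        using graph_iso_comp[OF wf _ iso] by fastforce
      then show "f x \<in> isos G K"
        using isosI[OF wf] by (simp add: f_def x)
    qed
    show "f' ` isos G K \<subseteq> Aut G"
    proof (rule image_subsetI)
      fix x assume "x \<in> isos G K"
      then obtain \<phi> \<psi> where x: "x = (\<phi>, \<psi>)" "graph_iso \<phi> \<psi> id G K"
        by (cases x) (auto simp: isos_iff)
      then have "graph_iso (inv_into (verts G) \<alpha> \<circ> \<phi>) (inv_into (halves G) \<beta> \<circ> \<psi>) id G G"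
        using graph_iso_comp[OF wf _ inv] by fastforce
      then show "f' x \<in> Aut G"
        using isosI[OF wf] by (simp add: f'_def x)
    qed
    show "\<forall>x\<in>Aut G. f' (f x) = x"
    proof
      fix x assume "x \<in> Aut G"
      then obtain \<phi> \<psi> where x: "x = (\<phi>, \<psi>)" "\<phi> \<in> extensional (verts G)" "\<psi> \<in> extensional (halves G)"
        and iso': "graph_iso \<phi> \<psi> id G G"
        by (cases x) (auto simp: isos_iff)
      show "f' (f x) = x"
        using x D(3,4) bij_betwE[OF graph_isoD(1)[OF iso']] bij_betwE[OF graph_isoD(2)[OF iso']]
        by (auto simp: f_def f'_def fun_eq_iff extensional_def)
    qed
    show "\<forall>x\<in>isos G K. f (f' x) = x"
    proof
      fix x assume "x \<in> isos G K"
      then obtain \<phi> \<psi> where x: "x = (\<phi>, \<psi>)" "\<phi> \<in> extensional (verts G)" "\<psi> \<in> extensional (halves G)"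
        and iso': "graph_iso \<phi> \<psi> id G K"
        by (cases x) (auto simp: isos_iff)
      show "f (f' x) = x"
        using x bij_betw_inv_into_right[OF D(1)] bij_betw_inv_into_right[OF D(2)]
          bij_betwE[OF graph_isoD(1)[OF iso']] bij_betwE[OF graph_isoD(2)[OF iso']]
        by (auto simp: f_def f'_def fun_eq_iff extensional_def)
    qed
  qed
  then show ?thesis
    by (simp add: bij_betw_same_card)
qed

lemma finite_labelled:
  assumes "finite V" "finite H" "finite L"
  shows "finite (labelled g V H L)"
proof -
  let ?B = "2 * g + 2 * card V + card L"
  let ?c = "\<lambda>G. (inc G, opp G, genus G, leg_label G)"
  let ?T = "(H \<rightarrow>\<^sub>E V) \<times> (H \<rightarrow>\<^sub>E H) \<times> (V \<rightarrow>\<^sub>E {..?B}) \<times> (\<Union>K\<in>Pow H. K \<rightarrow>\<^sub>E L)"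
  have "finite ?T"
    using assms by (intro finite_cartesian_product finite_PiE finite_UN_I) (auto intro: finite_subset finite_PiE)
  moreover have "?c ` labelled g V H L \<subseteq> ?T"
  proof (rule image_subsetI)
    fix G assume G: "G \<in> labelled g V H L"
    then have "genus G v \<le> ?B" if "v \<in> V" for v
      using member_le_sum[of v V "genus G"] that assms by (auto simp: labelled_def stable_type_def)
    then have "genus G \<in> V \<rightarrow>\<^sub>E {..?B}"
      using G by (auto simp: labelled_def canonical_def PiE_iff)
    moreover have "leg_label G \<in> legs G \<rightarrow>\<^sub>E L" "legs G \<in> Pow H"
      using G legs_subset[of G] by (auto simp: labelled_def canonical_def PiE_iff stable_type_def bij_betw_def)
    ultimately show "?c G \<in> ?T"
      using G by (auto simp: labelled_def stable_type_def canonical_def PiE_iff wf_graph_def)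
  qed
  moreover have "inj_on ?c (labelled g V H L)"
    by (rule inj_onI) (auto simp: labelled_def intro: sgraph.equality)
  ultimately show ?thesis
    by (meson finite_imageD finite_subset)
qed

text \<open>Every pair of bijections of the vertices with \<open>V\<close> and of the half-edges with \<open>H\<close> is an isomorphism
  onto exactly one labelled graph, and by \<open>card_isos\<close> every labelled graph in the isomorphism class is
  reached equally often.\<close>

lemma orbit_count:
  assumes stable_type: "stable_type g L G" and V: "finite V" "card V = card (verts G)" and H: "finite H" "card H = card (halves G)"
  shows "card {K \<in> labelled g V H L. isos G K \<noteq> {}} * card (Aut G) = fact (card V) * fact (card H)"
proof -
  let ?O = "{K \<in> labelled g V H L. isos G K \<noteq> {}}"
  have wf: "wf_graph G" and lab: "bij_betw (leg_label G) (legs G) L"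
    using stable_type by (auto simp: stable_type_def)
  have finL: "finite L"
    using bij_betw_finite[OF lab] finite_subset[OF legs_subset wf_graphD(2)[OF wf]] by simp
  have finite: "finite ?O"
    using finite_labelled[OF V(1) H(1) finL] by simp
  have eq: "(\<Union>K\<in>?O. isos G K) = bijections (verts G) V \<times> bijections (halves G) H"
  proof (rule equalityI; rule subsetI)
    fix x assume "x \<in> (\<Union>K\<in>?O. isos G K)"
    then show "x \<in> bijections (verts G) V \<times> bijections (halves G) H"
      using isos_subset_bijections by (fastforce simp: labelled_def)
  next
    fix x assume "x \<in> bijections (verts G) V \<times> bijections (halves G) H"
    then obtain \<phi> \<psi> where x: "x = (\<phi>, \<psi>)" "\<phi> \<in> extensional (verts G)" "\<psi> \<in> extensional (halves G)"
      and bij: "bij_betw \<phi> (verts G) V" "bij_betw \<psi> (halves G) H"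
      by (auto simp: bijections_def)
    have inj: "inj_on \<phi> (verts G)" "inj_on \<psi> (halves G)"
      using bij by (auto simp: bij_betw_def)
    let ?K = "relabel \<phi> \<psi> id G"
    have iso: "graph_iso \<phi> \<psi> id G ?K"
      by (rule relabel_iso[OF wf inj])
    have "?K \<in> labelled g V H L"
      using stable_type_iso[OF stable_type iso] canonical_relabel[OF wf inj] bij by (auto simp: labelled_def bij_betw_def)
    moreover have "x \<in> isos G ?K"
      using x iso by (simp add: isos_iff)
    ultimately show "x \<in> (\<Union>K\<in>?O. isos G K)" by blast
  qed
  have disj: "isos G K \<inter> isos G K' = {}" if "K \<in> ?O" "K' \<in> ?O" "K \<noteq> K'" for K K'
  proof (rule ccontr)
    assume "isos G K \<inter> isos G K' \<noteq> {}"
    then obtain \<phi> \<psi> where "graph_iso \<phi> \<psi> id G K" "graph_iso \<phi> \<psi> id G K'"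
      by (auto simp: isos_iff)
    then show False
      using graph_iso_unique[OF wf] that by (auto simp: labelled_def)
  qed
  have "card (\<Union>K\<in>?O. isos G K) = (\<Sum>K\<in>?O. card (isos G K))"
  proof (rule card_UN_disjoint[OF finite])
    show "\<forall>K\<in>?O. finite (isos G K)"
      using finite_isos[OF wf] by (auto simp: labelled_def stable_type_def)
  qed (use disj in blast)
  also have "\<dots> = card ?O * card (Aut G)"
    using card_isos[OF wf] by simp
  finally show ?thesis
    using V H wf_graphD(1,2)[OF wf] by (simp add: eq card_cartesian_product card_bijections)
qed

text \<open>Summing the stability conditions \<open>2 g\<^sub>v + n\<^sub>v \<ge> 3\<close> over all vertices bounds the number of
  vertices by the Euler characteristic.\<close>

lemma graph_size_bound:
  assumes "stable_type g L G"
  shows "card (verts G) + 2 \<le> 2 * g + card L" "card (halves G) \<le> 6 * g + 3 * card L"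
proof -
  have wf: "wf_graph G" and euler: "2 * g + 2 * card (verts G) + card L = card (halves G) + 2 + 2 * (\<Sum>v\<in>verts G. genus G v)"
    and st: "\<And>v. v \<in> verts G \<Longrightarrow> 2 * genus G v + card (halves_at G v) > 2"
    using assms by (auto simp: stable_type_def)
  have "card (halves G) = (\<Sum>v\<in>verts G. card {h \<in> halves G. inc G h = v})"
    unfolding card_eq_sum using wf by (intro sum.group[symmetric]) (auto simp: wf_graph_def)
  then have "2 * (\<Sum>v\<in>verts G. genus G v) + card (halves G) = (\<Sum>v\<in>verts G. 2 * genus G v + card (halves_at G v))"
    by (simp add: sum.distrib sum_distrib_left halves_at_def)
  moreover have "\<dots> \<ge> (\<Sum>v\<in>verts G. 3)"
    using st by (intro sum_mono) force
  ultimately show "card (verts G) + 2 \<le> 2 * g + card L" "card (halves G) \<le> 6 * g + 3 * card L"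
    using euler by simp_all
qed

definition standard_graphs :: "nat \<Rightarrow> nat \<Rightarrow> sgraph set" where
  "standard_graphs g n = (\<Union>k\<le>6 * g + 3 * n. \<Union>m\<le>6 * g + 3 * n. labelled g {..<k} {..<m} {1..n})"

text \<open>Replaces isomorphism classes with weights \<open>1/|Aut|\<close> by labelled graphs: the labelled graphs are
  grouped by their classes, and \<open>orbit_count\<close> counts each group.\<close>

lemma sum_stable_labelled:
  assumes inv: "\<And>G K \<phi> \<psi>. wf_graph G \<Longrightarrow> graph_iso \<phi> \<psi> id G K \<Longrightarrow> f K = f G"
    and F: "\<And>G. wf_graph G \<Longrightarrow> F G = rconst (1 / real (card (Aut G))) * f G"
  shows "sum_stable g n F =
    (\<Sum>G\<in>standard_graphs g n. rconst (1 / (fact (card (verts G)) * fact (card (halves G)))) * f G)"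
proof -
  define R where "R = {(G, K). stable_graph g n G \<and> stable_graph g n K \<and> isos G K \<noteq> {}}"
  define S where "S = {G. stable_graph g n G}"
  have wf: "wf_graph G" if "G \<in> S" for G
    using that by (simp add: S_def stable_graph_iff stable_type_def)
  have R_iff: "(G, K) \<in> R \<longleftrightarrow> G \<in> S \<and> K \<in> S \<and> (\<exists>\<phi> \<psi>. graph_iso \<phi> \<psi> id G K)" for G K
    using isos_nonempty_iff[of G K] wf[of G] by (cases "G \<in> S") (simp_all add: R_def S_def)
  have equiv: "equiv S R"
  proof (rule equivI)
    show "R \<subseteq> S \<times> S" by (auto simp: R_def S_def)
    show "refl_on S R"
      using graph_iso_refl by (auto simp: refl_on_def R_iff)
    show "sym R"
      using graph_iso_sym_id wf by (fastforce simp: sym_def R_iff)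
    show "trans R"
    proof (rule transI)
      fix x y z assume "(x, y) \<in> R" "(y, z) \<in> R"
      then obtain \<phi> \<psi> \<phi>' \<psi>' where "x \<in> S" "z \<in> S" "graph_iso \<phi> \<psi> id x y" "graph_iso \<phi>' \<psi>' id y z"
        by (auto simp: R_iff)
      then show "(x, z) \<in> R"
        using graph_iso_comp[OF wf, of x \<phi> \<psi> id y \<phi>' \<psi>' id z] by (auto simp: R_iff)
    qed
  qed
  have labelled_S: "G \<in> S" if "G \<in> labelled g V H {1..n}" for G V H
    using that by (simp add: S_def labelled_def stable_graph_iff)
  have lab_iff: "G \<in> standard_graphs g n \<longleftrightarrow> G \<in> labelled g {..<card (verts G)} {..<card (halves G)} {1..n}" for G
  proof
    assume "G \<in> standard_graphs g n"
    then show "G \<in> labelled g {..<card (verts G)} {..<card (halves G)} {1..n}"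
      by (auto simp: standard_graphs_def labelled_def)
  next
    assume *: "G \<in> labelled g {..<card (verts G)} {..<card (halves G)} {1..n}"
    then have "stable_type g {1..n} G" by (simp add: labelled_def)
    from graph_size_bound[OF this] show "G \<in> standard_graphs g n"
      unfolding standard_graphs_def
      by (intro UN_I[of "card (verts G)"] UN_I[of "card (halves G)"] *) auto
  qed
  have lab_S: "standard_graphs g n \<subseteq> S"
    using labelled_S by (auto simp: standard_graphs_def)
  have fin: "finite (standard_graphs g n)"
    unfolding standard_graphs_def by (intro finite_UN_I finite_labelled) auto
  have orbit: "{x \<in> standard_graphs g n. R `` {x} = R `` {G}} =
      {K \<in> labelled g {..<card (verts G)} {..<card (halves G)} {1..n}. isos G K \<noteq> {}}" if "G \<in> S" for G
  proof -
    have R_isos: "R `` {x} = R `` {G} \<longleftrightarrow> isos G x \<noteq> {}" if "x \<in> S" for x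
      using eq_equiv_class_iff[OF equiv \<open>G \<in> S\<close> that] that \<open>G \<in> S\<close> by (auto simp: R_def S_def)
    have cards: "card (verts x) = card (verts G)" "card (halves x) = card (halves G)" if "isos G x \<noteq> {}" for x
      using that by (auto simp: isos_def dest: bij_betw_same_card)
    show ?thesis
    proof (rule Collect_cong)
      fix x
      show "x \<in> standard_graphs g n \<and> R `` {x} = R `` {G} \<longleftrightarrow>
          x \<in> labelled g {..<card (verts G)} {..<card (halves G)} {1..n} \<and> isos G x \<noteq> {}"
        using lab_iff[of x] labelled_S[of x] R_isos[of x] cards[of x] by metis
    qed
  qed
  have class_sum: "(\<Sum>x\<in>{x \<in> standard_graphs g n. R `` {x} = R `` {G}}.
      rconst (1 / (fact (card (verts x)) * fact (card (halves x)))) * f x) = F G"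
    and class_ne: "{x \<in> standard_graphs g n. R `` {x} = R `` {G}} \<noteq> {}"
    if G: "G \<in> S" for G
  proof -
    let ?k = "card (verts G)" and ?m = "card (halves G)"
    let ?O = "{K \<in> labelled g {..<?k} {..<?m} {1..n}. isos G K \<noteq> {}}"
    have count: "card ?O * card (Aut G) = fact ?k * fact ?m"
      using orbit_count[of g "{1..n}" G "{..<?k}" "{..<?m}"] G by (simp add: S_def stable_graph_iff)
    have "card ?O * card (Aut G) > 0"
      unfolding count by simp
    then have pos: "card ?O > 0" "card (Aut G) > 0"
      by (simp_all only: nat_0_less_mult_iff)
    have "(\<Sum>x\<in>?O. rconst (1 / (fact (card (verts x)) * fact (card (halves x)))) * f x) =
        (\<Sum>x\<in>?O. rconst (1 / (fact ?k * fact ?m)) * f G)"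
    proof (intro sum.cong refl)
      fix x assume x: "x \<in> ?O"
      then have "f x = f G"
        using inv[OF wf[OF G]] isos_nonempty_iff[OF wf[OF G]] by blast
      with x show "rconst (1 / (fact (card (verts x)) * fact (card (halves x)))) * f x =
          rconst (1 / (fact ?k * fact ?m)) * f G"
        by (simp add: labelled_def)
    qed
    also have "\<dots> = rconst (real (card ?O) * (1 / (fact ?k * fact ?m))) * f G"
      by (simp only: sum_constant rconst_mult rconst_of_nat mult.assoc)
    also have "real (card ?O) * (1 / (fact ?k * fact ?m)) = 1 / real (card (Aut G))"
    proof -
      have "real (card ?O) * real (card (Aut G)) = fact ?k * fact ?m"
        using arg_cong[OF count, of real] by simp
      then show ?thesis
        using pos by (simp add: field_simps)
    qed
    finally show "(\<Sum>x\<in>{x \<in> standard_graphs g n. R `` {x} = R `` {G}}.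
      rconst (1 / (fact (card (verts x)) * fact (card (halves x)))) * f x) = F G"
      unfolding orbit[OF G] F[OF wf[OF G]] .
    show "{x \<in> standard_graphs g n. R `` {x} = R `` {G}} \<noteq> {}"
      using pos unfolding orbit[OF G] by (metis card.empty less_numeral_extra(3))
  qed
  have classes: "S // R = (\<lambda>x. R `` {x}) ` standard_graphs g n"
  proof
    show "S // R \<subseteq> (\<lambda>x. R `` {x}) ` standard_graphs g n"
    proof
      fix C assume "C \<in> S // R"
      then obtain G where "G \<in> S" "C = R `` {G}" by (auto elim: quotientE)
      with class_ne[of G] show "C \<in> (\<lambda>x. R `` {x}) ` standard_graphs g n" by blast
    qed
    show "(\<lambda>x. R `` {x}) ` standard_graphs g n \<subseteq> S // R"
      using lab_S by (auto intro: quotientI)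
  qed
  have rep: "(SOME G. G \<in> C) \<in> S" "R `` {SOME G. G \<in> C} = C" if C: "C \<in> S // R" for C
  proof -
    have "C \<noteq> {}" using C equiv in_quotient_imp_non_empty by blast
    then have *: "(SOME G. G \<in> C) \<in> C" by (simp add: some_in_eq)
    then show "(SOME G. G \<in> C) \<in> S"
      using C equiv in_quotient_imp_subset by blast
    show "R `` {SOME G. G \<in> C} = C"
    proof -
      obtain x where x: "C = R `` {x}" using C by (auto elim: quotientE)
      with * have "(x, SOME G. G \<in> C) \<in> R" by blast
      then show ?thesis
        by (rule trans[OF equiv_class_eq[OF equiv, symmetric] x[symmetric]])
    qed
  qed
  have "sum_stable g n F = (\<Sum>C\<in>S // R. F (SOME G. G \<in> C))"
    by (simp add: sum_stable_def stable_classes_def R_def S_def)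
  also have "\<dots> = (\<Sum>C\<in>S // R. \<Sum>x\<in>{x \<in> standard_graphs g n. R `` {x} = C}.
      rconst (1 / (fact (card (verts x)) * fact (card (halves x)))) * f x)"
  proof (intro sum.cong refl)
    fix C assume C: "C \<in> S // R"
    show "F (SOME G. G \<in> C) = (\<Sum>x\<in>{x \<in> standard_graphs g n. R `` {x} = C}.
        rconst (1 / (fact (card (verts x)) * fact (card (halves x)))) * f x)"
      using class_sum[OF rep(1)[OF C]] unfolding rep(2)[OF C] by simp
  qed
  also have "\<dots> = (\<Sum>x\<in>standard_graphs g n. rconst (1 / (fact (card (verts x)) * fact (card (halves x)))) * f x)"
    using fin by (intro sum.group) (auto simp: classes)
  finally show ?thesis .
qed

section \<open>Connected graphs have at least as many edges as trees\<close>

text \<open>A set of vertices that is not yet everything is not closed, so some edge leaves it and adds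
  one vertex.\<close>

lemma spanning_subtree:
  assumes wf: "wf_graph G" and is_connected: "is_connected G"
  shows "j < card (verts G) \<Longrightarrow> \<exists>A F. A \<subseteq> verts G \<and> card A = Suc j \<and> F \<subseteq> edges G \<and> card F = j \<and>
    (\<forall>e\<in>F. \<forall>x\<in>e. inc G x \<in> A)"
proof (induction j)
  case 0
  then obtain v where "v \<in> verts G" using is_connected by (auto simp: is_connected_def)
  then show ?case by (intro exI[of _ "{v}"] exI[of _ "{}"]) auto
next
  case (Suc j)
  then obtain A F where A: "A \<subseteq> verts G" "card A = Suc j" "F \<subseteq> edges G" "card F = j"
    "\<forall>e\<in>F. \<forall>x\<in>e. inc G x \<in> A" by auto
  then have "A \<noteq> {}" "A \<noteq> verts G" using Suc.prems by auto
  then obtain h where h: "h \<in> halves G" "inc G h \<in> A" "inc G (opp G h) \<notin> A"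
    using is_connected A(1) unfolding is_connected_def opp_closed_def by blast
  let ?e = "{h, opp G h}"
  have "?e \<in> edges G" using h by (auto simp: edges_def)
  moreover have "?e \<notin> F" using A(5) h by auto
  moreover have "finite A" "finite F"
    using A finite_edges[OF wf] wf_graphD[OF wf] by (auto intro: finite_subset)
  moreover have "inc G (opp G h) \<in> verts G" using wf_graphD[OF wf] h by blast
  ultimately show ?case
    using A h by (intro exI[of _ "insert (inc G (opp G h)) A"] exI[of _ "insert ?e F"]) auto
qed

lemma connected_card_edges:
  assumes wf: "wf_graph G" and is_connected: "is_connected G"
  shows "card (verts G) \<le> card (edges G) + 1"
proof (cases "card (verts G)")
  case (Suc j)
  then obtain F where "F \<subseteq> edges G" "card F = j"
    using spanning_subtree[OF assms, of j] by auto
  then show ?thesis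
    using card_mono[OF finite_edges[OF wf], of F] Suc by simp
qed simp

section \<open>Gluing two legs\<close>

text \<open>The number \<open>l\<close> of legs is a parameter, because the same equation is used before and after a cut,
  which adds two legs without changing anything else in it.\<close>

definition euler :: "nat \<Rightarrow> nat \<Rightarrow> sgraph \<Rightarrow> bool" where
  "euler g l G \<longleftrightarrow> 2 * g + 2 * card (verts G) + l = card (halves G) + 2 + 2 * (\<Sum>v\<in>verts G. genus G v)"

lemma euler_unique: "euler g l G \<Longrightarrow> euler g' l G \<Longrightarrow> g = g'"
  by (simp add: euler_def)

lemma euler_exists:
  assumes wf: "wf_graph G" and is_connected: "is_connected G"
  shows "\<exists>g. euler g (card (legs G)) G"
  using connected_card_edges[OF assms] card_edges[OF wf]
  by (intro exI[of _ "card (edges G) + 1 + (\<Sum>v\<in>verts G. genus G v) - card (verts G)"])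
     (auto simp: euler_def)

text \<open>The conditions on a stable graph that are local, hence unaffected by cutting and gluing; the
  remaining ones are connectedness and the genus condition.\<close>

definition prestable :: "nat set \<Rightarrow> nat set \<Rightarrow> nat set \<Rightarrow> sgraph set" where
  "prestable V H L = {G. verts G = V \<and> halves G = H \<and> canonical G \<and> wf_graph G \<and>
     bij_betw (leg_label G) (legs G) L \<and> (\<forall>v\<in>verts G. 2 * genus G v + card (halves_at G v) > 2)}"

lemma labelled_iff: "G \<in> labelled g V H L \<longleftrightarrow> G \<in> prestable V H L \<and> is_connected G \<and> euler g (card L) G"
  by (auto simp: labelled_def stable_type_def prestable_def euler_def)

definition leg_of :: "sgraph \<Rightarrow> nat \<Rightarrow> nat" where
  "leg_of G l = inv_into (legs G) (leg_label G) l"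

lemma leg_of:
  assumes "G \<in> prestable V H L" "l \<in> L"
  shows "leg_of G l \<in> legs G" "leg_of G l \<in> H" "leg_label G (leg_of G l) = l"
    "opp G (leg_of G l) = leg_of G l"
proof -
  have "bij_betw (leg_label G) (legs G) L" "halves G = H"
    using assms by (auto simp: prestable_def)
  then show "leg_of G l \<in> legs G" "leg_label G (leg_of G l) = l"
    using assms(2) by (auto simp: leg_of_def bij_betw_def inv_into_into f_inv_into_f)
  then show "leg_of G l \<in> H" "opp G (leg_of G l) = leg_of G l"
    using \<open>halves G = H\<close> by (auto simp: legs_def)
qed

lemma leg_of_eqI:
  assumes "bij_betw (leg_label G) (legs G) L" "h \<in> legs G" "leg_label G h = l"
  shows "leg_of G l = h"
  using assms by (auto simp: leg_of_def bij_betw_def)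

definition glue_legs :: "nat \<Rightarrow> nat \<Rightarrow> sgraph \<Rightarrow> sgraph" where
  "glue_legs p q G = G\<lparr>opp := (opp G)(leg_of G p := leg_of G q, leg_of G q := leg_of G p),
     leg_label := (leg_label G)(leg_of G p := undefined, leg_of G q := undefined)\<rparr>"

lemma glue_legs_simps [simp]:
  "verts (glue_legs p q G) = verts G" "halves (glue_legs p q G) = halves G"
  "inc (glue_legs p q G) = inc G" "genus (glue_legs p q G) = genus G"
  "opp (glue_legs p q G) = (opp G)(leg_of G p := leg_of G q, leg_of G q := leg_of G p)"
  "leg_label (glue_legs p q G) = (leg_label G)(leg_of G p := undefined, leg_of G q := undefined)"
  "halves_at (glue_legs p q G) = halves_at G"
  by (auto simp: glue_legs_def halves_at_def)

lemma euler_glue_legs [simp]: "euler g l (glue_legs p q G) = euler g l G"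
  by (simp add: euler_def)

lemma euler_cut_edge [simp]: "euler g l (cut_edge p q G h) = euler g l G"
  by (simp add: euler_def)

locale cut_labels =
  fixes p q :: nat and L :: "nat set"
  assumes fin_L: "finite L" and pq: "p \<noteq> q" "p \<notin> L" "q \<notin> L"
begin

lemma cut_edge_prestable:
  assumes G: "G \<in> prestable V H L" and h: "h \<in> H - legs G"
  shows "cut_edge p q G h \<in> prestable V H (insert p (insert q L))"
    "leg_of (cut_edge p q G h) p = h" "leg_of (cut_edge p q G h) q = opp G h"
    "glue_legs p q (cut_edge p q G h) = G"
proof -
  have wf: "wf_graph G" and VH: "verts G = V" "halves G = H" and can: "canonical G"
    and lab: "bij_betw (leg_label G) (legs G) L"
    using G by (auto simp: prestable_def)
  have h: "h \<in> halves G - legs G" using h VH by simp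
  note nl = non_legD[OF wf h]
  let ?K = "cut_edge p q G h"
  have opp_nl: "opp G h \<notin> legs G"
    using nl by (auto simp: legs_def)
  have legs: "legs ?K = insert h (insert (opp G h) (legs G))"
    using legs_cut_edge[OF wf h] by auto
  have "bij_betw (leg_label ?K) (legs G) L"
    by (rule bij_betw_cong[THEN iffD1, OF _ lab]) (use h opp_nl in auto)
  then have "bij_betw (leg_label ?K) (legs G \<union> {h, opp G h}) (L \<union> {p, q})"
    by (rule bij_betw_combine) (use nl pq in \<open>auto simp: bij_betw_def inj_on_def\<close>)
  then have lab': "bij_betw (leg_label ?K) (legs ?K) (insert p (insert q L))"
    by (simp add: legs Un_commute)
  have can': "canonical ?K"
    using can nl unfolding canonical_def legs by (auto simp: extensional_def)
  show pre': "?K \<in> prestable V H (insert p (insert q L))"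
    using G wf_cut_edge[OF wf h] can' lab' by (simp add: prestable_def)
  show p: "leg_of ?K p = h"
    by (rule leg_of_eqI[OF lab']) (use nl in \<open>auto simp: legs\<close>)
  show q: "leg_of ?K q = opp G h"
    by (rule leg_of_eqI[OF lab']) (use nl in \<open>auto simp: legs\<close>)
  have "leg_label G h = undefined" "leg_label G (opp G h) = undefined"
    using can h opp_nl by (auto simp: canonical_def extensional_def)
  then show "glue_legs p q ?K = G"
    by (intro sgraph.equality) (use nl in \<open>auto simp: p q fun_eq_iff glue_legs_def\<close>)
qed

lemma glue_legs_prestable:
  assumes G: "G \<in> prestable V H (insert p (insert q L))"
  shows "glue_legs p q G \<in> prestable V H L"
    "leg_of G p \<in> H - legs (glue_legs p q G)"
    "cut_edge p q (glue_legs p q G) (leg_of G p) = G"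
proof -
  have wf: "wf_graph G" and VH: "verts G = V" "halves G = H" and can: "canonical G"
    and lab: "bij_betw (leg_label G) (legs G) (insert p (insert q L))"
    using G by (auto simp: prestable_def)
  define a b where "a = leg_of G p" and "b = leg_of G q"
  have a: "a \<in> legs G" "a \<in> H" "leg_label G a = p" "opp G a = a"
    unfolding a_def by (rule leg_of[OF G]; simp)+
  have b: "b \<in> legs G" "b \<in> H" "leg_label G b = q" "opp G b = b"
    unfolding b_def by (rule leg_of[OF G]; simp)+
  have ab: "a \<noteq> b" using a b pq by auto
  note W = wf_graphD[OF wf, unfolded VH]
  have opp_ab: "opp G x \<noteq> a" "opp G x \<noteq> b" if "x \<in> H" "x \<noteq> a" "x \<noteq> b" for x
    using that W(5)[of x] a(4) b(4) by metis+
  let ?K = "glue_legs p q G"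
  have opp: "opp ?K = (opp G)(a := b, b := a)"
    and label: "leg_label ?K = (leg_label G)(a := undefined, b := undefined)"
    by (simp_all add: a_def b_def)
  have legs: "legs ?K = legs G - {a, b}"
    using ab by (auto simp: legs_def opp simp del: glue_legs_simps(5))
  have wf': "wf_graph ?K"
    unfolding wf_graph_def opp glue_legs_simps(1-3) VH using W a b opp_ab by auto
  have "bij_betw (leg_label G) (legs G - {a, b}) (insert p (insert q L) - {p, q})"
    by (rule bij_betw_DiffI[OF lab]) (use a b pq in \<open>auto simp: bij_betw_def inj_on_def\<close>)
  then have "bij_betw (leg_label G) (legs ?K) L"
    using pq by (simp add: legs insert_Diff_if)
  then have lab': "bij_betw (leg_label ?K) (legs ?K) L"
    by (rule bij_betw_cong[THEN iffD1, rotated]) (auto simp: legs label simp del: glue_legs_simps(6))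
  have can': "canonical ?K"
    using can a b unfolding canonical_def legs opp label glue_legs_simps(1-4) VH
    by (auto simp: extensional_def)
  show "?K \<in> prestable V H L"
    using G wf' lab' can' by (simp add: prestable_def)
  show "leg_of G p \<in> H - legs ?K"
    using a legs by (simp add: a_def)
  show "cut_edge p q ?K (leg_of G p) = G"
    by (intro sgraph.equality)
       (use a b ab in \<open>auto simp: fun_eq_iff cut_edge_def a_def[symmetric] b_def[symmetric]\<close>)
qed

text \<open>Cutting at a half-edge and gluing the legs \<open>p\<close> and \<open>q\<close> are inverse to each other. The property \<open>Q\<close>
  will be connectedness of the cut graph or its negation.\<close>

lemma sum_cut:
  "(\<Sum>(G, h)\<in>{(G, h). G \<in> labelled g V H L \<and> h \<in> H - legs G \<and> Q (cut_edge p q G h)}. weight (cut_edge p q G h)) =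
   (\<Sum>G\<in>{G \<in> prestable V H (insert p (insert q L)). is_connected (glue_legs p q G) \<and> euler g (card L) G \<and> Q G}. weight G)"
proof (rule sum.reindex_bij_witness[of _ "\<lambda>G. (glue_legs p q G, leg_of G p)" "\<lambda>(G, h). cut_edge p q G h"])
  fix x assume x: "x \<in> {(G, h). G \<in> labelled g V H L \<and> h \<in> H - legs G \<and> Q (cut_edge p q G h)}"
  then obtain G h where x: "x = (G, h)" "G \<in> prestable V H L" "is_connected G" "euler g (card L) G" "h \<in> H - legs G"
    "Q (cut_edge p q G h)"
    by (auto simp: labelled_iff)
  note c = cut_edge_prestable[OF x(2) x(5)]
  show "(glue_legs p q (case x of (G, h) \<Rightarrow> cut_edge p q G h), leg_of (case x of (G, h) \<Rightarrow> cut_edge p q G h) p) = x"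
    by (simp add: x(1) c del: cut_edge_simps)
  show "(case x of (G, h) \<Rightarrow> cut_edge p q G h) \<in> {G \<in> prestable V H (insert p (insert q L)).
      is_connected (glue_legs p q G) \<and> euler g (card L) G \<and> Q G}"
    using x c by simp
  show "weight (case x of (G, h) \<Rightarrow> cut_edge p q G h) = (case x of (G, h) \<Rightarrow> weight (cut_edge p q G h))"
    by (simp add: x(1))
next
  fix G assume G: "G \<in> {G \<in> prestable V H (insert p (insert q L)).
      is_connected (glue_legs p q G) \<and> euler g (card L) G \<and> Q G}"
  then have G': "G \<in> prestable V H (insert p (insert q L))" by simp
  note gl = glue_legs_prestable[OF G']
  show "(case (glue_legs p q G, leg_of G p) of (G, h) \<Rightarrow> cut_edge p q G h) = G"
    by (simp add: gl(3))
  show "(glue_legs p q G, leg_of G p) \<in> {(G, h). G \<in> labelled g V H L \<and> h \<in> H - legs G \<and> Q (cut_edge p q G h)}"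
    using G gl by (simp add: labelled_iff)
qed

lemma card_insert_pq: "card (insert p (insert q L)) = card L + 2"
  using fin_L pq by simp

lemma opp_closed_glue_legs:
  assumes "G \<in> prestable V H (insert p (insert q L))"
  shows "opp_closed (glue_legs p q G) A \<longleftrightarrow> opp_closed G A \<and>
    (inc G (leg_of G p) \<in> A \<longleftrightarrow> inc G (leg_of G q) \<in> A)"
proof -
  define a b where "a = leg_of G p" and "b = leg_of G q"
  have H: "halves G = H" using assms by (simp add: prestable_def)
  have a: "a \<in> H" "leg_label G a = p" "opp G a = a"
    unfolding a_def by (rule leg_of[OF assms]; simp)+
  have b: "b \<in> H" "leg_label G b = q" "opp G b = b"
    unfolding b_def by (rule leg_of[OF assms]; simp)+
  have "a \<noteq> b" using a b pq by auto
  have H': "H = insert a (insert b (H - {a, b}))" using a b by auto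
  have "opp_closed (glue_legs p q G) A \<longleftrightarrow> (\<forall>h\<in>H - {a, b}. inc G h \<in> A \<longrightarrow> inc G (opp G h) \<in> A) \<and>
      (inc G a \<in> A \<longleftrightarrow> inc G b \<in> A)"
    unfolding opp_closed_def glue_legs_simps H a_def[symmetric] b_def[symmetric]
    using \<open>a \<noteq> b\<close> by (subst H') auto
  moreover have "opp_closed G A \<longleftrightarrow> (\<forall>h\<in>H - {a, b}. inc G h \<in> A \<longrightarrow> inc G (opp G h) \<in> A)"
    unfolding opp_closed_def H using a(3) b(3) by (subst H') simp
  ultimately show ?thesis
    by (simp add: a_def b_def)
qed

text \<open>If the cut graph is connected, so is the glued graph. The two additional legs lower the genus by
  one in the equation of the Euler characteristic.\<close>

lemma sum_cut_nonbridge: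
  "(\<Sum>(G, h)\<in>{(G, h). G \<in> labelled g V H L \<and> h \<in> H - legs G \<and> is_connected (cut_edge p q G h)}. weight (cut_edge p q G h)) =
   (if g = 0 then 0 else \<Sum>G\<in>labelled (g - 1) V H (insert p (insert q L)). weight G)"
proof -
  let ?Z = "{G \<in> prestable V H (insert p (insert q L)). is_connected (glue_legs p q G) \<and> euler g (card L) G \<and> is_connected G}"
  have "?Z = (if g = 0 then {} else labelled (g - 1) V H (insert p (insert q L)))"
  proof (cases "g = 0")
    case True
    \<comment> \<open>The cut graph would have fewer edges than a tree.\<close>
    have False if "G \<in> ?Z" for G
    proof -
      have wf: "wf_graph G" and lab: "bij_betw (leg_label G) (legs G) (insert p (insert q L))"
        and "is_connected G" and e: "euler 0 (card L) G"
        using that True by (auto simp: prestable_def)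
      have "card (legs G) = card L + 2"
        using bij_betw_same_card[OF lab] card_insert_pq by simp
      then show False
        using connected_card_edges[OF wf \<open>is_connected G\<close>] card_edges[OF wf] e by (simp add: euler_def)
    qed
    with True show ?thesis by auto
  next
    case False
    have "euler g (card L) G \<longleftrightarrow> euler (g - 1) (card L + 2) G" for G
      using False by (auto simp: euler_def)
    moreover have "is_connected (glue_legs p q G)" if "is_connected G" "G \<in> prestable V H (insert p (insert q L))" for G
      using that opp_closed_glue_legs[OF that(2)] by (simp add: is_connected_def)
    ultimately show ?thesis
      using False by (auto simp: labelled_iff card_insert_pq)
  qed
  then show ?thesis
    unfolding sum_cut[of g V H "is_connected"] by simp
qed

end

section \<open>Disjoint unions\<close>

definition union_graph :: "sgraph \<Rightarrow> sgraph \<Rightarrow> sgraph" where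
  "union_graph G K = \<lparr>verts = verts G \<union> verts K, halves = halves G \<union> halves K,
     inc = (\<lambda>x. if x \<in> halves G then inc G x else inc K x),
     opp = (\<lambda>x. if x \<in> halves G then opp G x else opp K x),
     genus = (\<lambda>v. if v \<in> verts G then genus G v else genus K v),
     leg_label = (\<lambda>x. if x \<in> halves G then leg_label G x else leg_label K x)\<rparr>"

lemma union_graph_simps [simp]:
  "verts (union_graph G K) = verts G \<union> verts K" "halves (union_graph G K) = halves G \<union> halves K"
  "inc (union_graph G K) x = (if x \<in> halves G then inc G x else inc K x)"
  "opp (union_graph G K) x = (if x \<in> halves G then opp G x else opp K x)"
  "genus (union_graph G K) v = (if v \<in> verts G then genus G v else genus K v)"
  "leg_label (union_graph G K) x = (if x \<in> halves G then leg_label G x else leg_label K x)"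
  by (simp_all add: union_graph_def)

definition subgraph_on :: "sgraph \<Rightarrow> nat set \<Rightarrow> sgraph" where
  "subgraph_on G A = (let B = {h \<in> halves G. inc G h \<in> A} in
     \<lparr>verts = A, halves = B, inc = restrict (inc G) B, opp = restrict (opp G) B,
      genus = restrict (genus G) A, leg_label = restrict (leg_label G) (legs G \<inter> B)\<rparr>)"

lemma subgraph_on_simps [simp]:
  "verts (subgraph_on G A) = A" "halves (subgraph_on G A) = {h \<in> halves G. inc G h \<in> A}"
  "inc (subgraph_on G A) = restrict (inc G) {h \<in> halves G. inc G h \<in> A}"
  "opp (subgraph_on G A) = restrict (opp G) {h \<in> halves G. inc G h \<in> A}"
  "genus (subgraph_on G A) = restrict (genus G) A"
  "leg_label (subgraph_on G A) = restrict (leg_label G) (legs G \<inter> {h \<in> halves G. inc G h \<in> A})"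
  by (simp_all add: subgraph_on_def Let_def)

lemma legs_subgraph_on: "legs (subgraph_on G A) = legs G \<inter> {h \<in> halves G. inc G h \<in> A}"
  by (auto simp: legs_def)

lemma opp_closed_verts:
  assumes "wf_graph G"
  shows "opp_closed G (A \<inter> verts G) \<longleftrightarrow> opp_closed G A"
  using wf_graphD(3,4)[OF assms] by (auto simp: opp_closed_def)

lemma opp_closed_compl:
  assumes "wf_graph G" "opp_closed G A"
  shows "opp_closed G (verts G - A)"
  using assms(2) wf_graphD(3-5)[OF assms(1)] unfolding opp_closed_def by (metis DiffD1 DiffD2 DiffI)

lemma opp_closed_Int: "opp_closed G A \<Longrightarrow> opp_closed G B \<Longrightarrow> opp_closed G (A \<inter> B)"
  by (auto simp: opp_closed_def)

lemma opp_closed_all: "wf_graph G \<Longrightarrow> opp_closed G (verts G)"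
  using wf_graphD(3,4) by (auto simp: opp_closed_def)

lemma connected_opp_closed:
  assumes "wf_graph G" "is_connected G" "opp_closed G S" "S \<inter> verts G \<noteq> {}"
  shows "verts G \<subseteq> S"
  using assms(2-4) opp_closed_verts[OF assms(1), of S] unfolding is_connected_def by blast

text \<open>Two disjoint graphs, to be considered as one graph with at least two components.\<close>

locale two_graphs =
  fixes G K A B L A' B' L'
  assumes pre1: "G \<in> prestable A B L" and pre2: "K \<in> prestable A' B' L'"
    and disj: "A \<inter> A' = {}" "B \<inter> B' = {}" "L \<inter> L' = {}"
begin

lemma carriers: "verts G = A" "halves G = B" "verts K = A'" "halves K = B'"
  using pre1 pre2 by (auto simp: prestable_def)

lemma wf_both: "wf_graph G" "wf_graph K"
  using pre1 pre2 by (auto simp: prestable_def)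

lemma fin: "finite A" "finite A'" "finite B" "finite B'"
  using wf_both by (auto simp: wf_graph_def carriers)

lemma can_both: "canonical G" "canonical K"
  using pre1 pre2 by (auto simp: prestable_def)

lemmas W = wf_graphD(3-5)[OF wf_both(1), unfolded carriers] wf_graphD(3-5)[OF wf_both(2), unfolded carriers]

lemma not_both: "x \<in> B' \<Longrightarrow> x \<notin> B" "v \<in> A' \<Longrightarrow> v \<notin> A"
  using disj by auto

lemma inc_not_both: "x \<in> B' \<Longrightarrow> inc K x \<notin> A" "x \<in> B \<Longrightarrow> inc G x \<notin> A'"
  using W(1)[of x] W(4)[of x] disj(1) by blast+

lemma union_graph_right: "x \<in> B' \<Longrightarrow> inc (union_graph G K) x = inc K x" "x \<in> B' \<Longrightarrow> opp (union_graph G K) x = opp K x"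
  "x \<in> B' \<Longrightarrow> leg_label (union_graph G K) x = leg_label K x" "v \<in> A' \<Longrightarrow> genus (union_graph G K) v = genus K v"
  by (simp_all add: carriers not_both)

lemma union_graph_left: "x \<in> B \<Longrightarrow> inc (union_graph G K) x = inc G x" "x \<in> B \<Longrightarrow> opp (union_graph G K) x = opp G x"
  "x \<in> B \<Longrightarrow> leg_label (union_graph G K) x = leg_label G x" "v \<in> A \<Longrightarrow> genus (union_graph G K) v = genus G v"
  by (simp_all add: carriers)

lemma legs_union_graph: "legs (union_graph G K) = legs G \<union> legs K"
  using not_both by (auto simp: legs_def carriers)

lemma legs_in: "legs G \<subseteq> B" "legs K \<subseteq> B'"
  using legs_subset carriers by blast+

lemma halves_at_union_graph:
  "v \<in> A \<Longrightarrow> halves_at (union_graph G K) v = halves_at G v"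
  "v \<in> A' \<Longrightarrow> halves_at (union_graph G K) v = halves_at K v"
  unfolding halves_at_def union_graph_simps(2,3) carriers
  using not_both(1) inc_not_both by (intro Collect_cong; metis Un_iff)+

lemma wf_union_graph: "wf_graph (union_graph G K)"
  using fin W not_both unfolding wf_graph_def by (auto simp: carriers)

lemma edges_union_graph: "edges (union_graph G K) = edges G \<union> edges K"
proof -
  have "halves (union_graph G K) - legs (union_graph G K) = (B - legs G) \<union> (B' - legs K)"
    using legs_in disj by (auto simp: legs_union_graph carriers)
  moreover have "(\<lambda>h. {h, opp (union_graph G K) h}) ` (B - legs G) = edges G"
    unfolding edges_image carriers by (intro image_cong refl) (simp add: union_graph_left del: union_graph_simps)
  moreover have "(\<lambda>h. {h, opp (union_graph G K) h}) ` (B' - legs K) = edges K"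
    unfolding edges_image carriers by (intro image_cong refl) (simp add: union_graph_right del: union_graph_simps)
  ultimately show ?thesis
    unfolding edges_image[of "union_graph G K"] by (simp only: image_Un)
qed

lemma edges_disj: "edges G \<inter> edges K = {}"
proof -
  have "e \<noteq> {} \<and> e \<subseteq> B" if "e \<in> edges G" for e
    using that W by (auto simp: edges_def carriers)
  moreover have "e \<subseteq> B'" if "e \<in> edges K" for e
    using that W by (auto simp: edges_def carriers)
  ultimately show ?thesis using disj by blast
qed

lemma union_graph_prestable: "union_graph G K \<in> prestable (A \<union> A') (B \<union> B') (L \<union> L')"
proof -
  have "bij_betw (leg_label (union_graph G K)) (legs G) L"
    using pre1 legs_in by (subst bij_betw_cong[of _ _ "leg_label G"]) (auto simp: prestable_def)
  moreover have "bij_betw (leg_label (union_graph G K)) (legs K) L'"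
    using pre2 legs_in not_both by (subst bij_betw_cong[of _ _ "leg_label K"]) (auto simp: prestable_def carriers)
  ultimately have "bij_betw (leg_label (union_graph G K)) (legs (union_graph G K)) (L \<union> L')"
    unfolding legs_union_graph using disj by (intro bij_betw_combine)
  moreover have "canonical (union_graph G K)"
    using can_both legs_in unfolding canonical_def legs_union_graph by (auto simp: extensional_def carriers)
  moreover have "2 * genus (union_graph G K) v + card (halves_at (union_graph G K) v) > 2" if "v \<in> A \<union> A'" for v
    using pre1 pre2 that not_both by (auto simp: halves_at_union_graph prestable_def)
  ultimately show ?thesis
    using wf_union_graph by (simp add: prestable_def carriers)
qed

lemma leg_of_union_graph:
  "l \<in> L \<Longrightarrow> leg_of (union_graph G K) l = leg_of G l" "l \<in> L' \<Longrightarrow> leg_of (union_graph G K) l = leg_of K l"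
proof -
  have bij: "bij_betw (leg_label (union_graph G K)) (legs (union_graph G K)) (L \<union> L')"
    using union_graph_prestable by (simp add: prestable_def)
  show "l \<in> L \<Longrightarrow> leg_of (union_graph G K) l = leg_of G l"
    using leg_of[OF pre1] by (intro leg_of_eqI[OF bij]) (auto simp: legs_union_graph union_graph_left simp del: union_graph_simps)
  show "l \<in> L' \<Longrightarrow> leg_of (union_graph G K) l = leg_of K l"
    using leg_of[OF pre2] by (intro leg_of_eqI[OF bij]) (auto simp: legs_union_graph union_graph_right simp del: union_graph_simps)
qed

lemma opp_closed_union_graph: "opp_closed (union_graph G K) S \<longleftrightarrow> opp_closed G S \<and> opp_closed K S"
  unfolding opp_closed_def union_graph_simps(2) ball_Un carriers
  using union_graph_left union_graph_right W by simp

lemma opp_closed_part: "opp_closed (union_graph G K) A"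
  using opp_closed_all[OF wf_both(1)] inc_not_both(1)
  unfolding opp_closed_union_graph carriers(1) by (auto simp: opp_closed_def carriers)

lemma halves_union_graph_filter:
  "{h \<in> halves (union_graph G K). inc (union_graph G K) h \<in> A} = B"
  "{h \<in> halves (union_graph G K). inc (union_graph G K) h \<in> A'} = B'"
  using W not_both inc_not_both by (auto simp: carriers)

lemma subgraph_on_union_graph: "subgraph_on (union_graph G K) A = G" "subgraph_on (union_graph G K) A' = K"
proof -
  have can_restr: "canonical (subgraph_on (union_graph G K) S)" for S
    unfolding canonical_def legs_subgraph_on by simp
  show "subgraph_on (union_graph G K) A = G"
    using can_restr can_both(1) by (rule canonical_eqI)
      (use legs_in in \<open>auto simp: halves_union_graph_filter carriers union_graph_left legs_subgraph_on legs_union_graph simp del: union_graph_simps\<close>)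
  show "subgraph_on (union_graph G K) A' = K"
    using can_restr can_both(2) by (rule canonical_eqI)
      (use legs_in in \<open>auto simp: halves_union_graph_filter carriers union_graph_right legs_subgraph_on legs_union_graph simp del: union_graph_simps\<close>)
qed

lemma genus_union_graph:
  "(\<Sum>v\<in>A \<union> A'. genus (union_graph G K) v) = (\<Sum>v\<in>A. genus G v) + (\<Sum>v\<in>A'. genus K v)"
  using fin disj union_graph_left(4) union_graph_right(4)
  by (simp add: sum.union_disjoint del: union_graph_simps)

text \<open>Exponent functions on the union are pairs of exponent functions, and the factors of vertices and
  edges are distributed over the two graphs.\<close>

lemma weight_union_graph: "weight (union_graph G K) = weight G * weight K"
proof -
  let ?M = "union_graph G K"
  define t where "t = (\<lambda>\<Theta> d. vertex_factors \<Theta> d * rconst (\<Prod>e\<in>edges \<Theta>. zeta_factor (1 + 2 * (\<Sum>i\<in>e. d i))))"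
  have e_sub: "e \<subseteq> B" if "e \<in> edges G" for e
    using that W by (auto simp: edges_def carriers)
  have e_sub': "e \<subseteq> B'" if "e \<in> edges K" for e
    using that W by (auto simp: edges_def carriers)
  have at_sub: "halves_at G v \<subseteq> B" "halves_at K v \<subseteq> B'" for v
    by (auto simp: halves_at_def carriers)
  have t_cong: "t \<Theta> d = t \<Theta> d'" if wf: "wf_graph \<Theta>" and eq: "\<And>x. x \<in> halves \<Theta> \<Longrightarrow> d x = d' x" for \<Theta> d d'
  proof -
    have "vertex_factor k (halves_at \<Theta> v) d = vertex_factor k (halves_at \<Theta> v) d'" for k v
      by (rule vertex_factor_cong[OF finite_halves_at[OF wf]]) (use eq in \<open>auto simp: halves_at_def\<close>)
    moreover have "(\<Sum>i\<in>e. d i) = (\<Sum>i\<in>e. d' i)" if "e \<in> edges \<Theta>" for e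
      by (intro sum.cong refl eq) (use edge_of_member(1)[OF wf that] in blast)
    ultimately show ?thesis by (simp add: t_def vertex_factors_def)
  qed
  have t_merge: "t ?M d = t G d * t K d" for d
  proof -
    have "vertex_factors ?M d = vertex_factors G d * vertex_factors K d"
      using fin disj not_both
      by (simp add: vertex_factors_def carriers prod.union_disjoint halves_at_union_graph)
    then show ?thesis
      using finite_edges[OF wf_both(1)] finite_edges[OF wf_both(2)] edges_disj
      by (simp add: t_def edges_union_graph prod.union_disjoint rconst_mult mult_ac)
  qed
  have psi: "d \<in> psi_exponents ?M \<longleftrightarrow> d \<in> extensional (B \<union> B') \<and>
      restrict d B \<in> psi_exponents G \<and> restrict d B' \<in> psi_exponents K" for d
  proof -
    have "(\<Sum>i\<in>halves_at G v. restrict d B i) = (\<Sum>i\<in>halves_at G v. d i)"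
      "(\<Sum>i\<in>halves_at K v. restrict d B' i) = (\<Sum>i\<in>halves_at K v. d i)" for v
      by (intro sum.cong refl; use at_sub[of v] in auto)+
    moreover have "h \<in> legs G \<Longrightarrow> restrict d B h = d h" "h \<in> legs K \<Longrightarrow> restrict d B' h = d h" for h
      using legs_in by auto
    ultimately show ?thesis
      using not_both by (auto simp: psi_exponents_def PiE_iff carriers legs_union_graph ball_Un halves_at_union_graph)
  qed
  have "weight ?M = (\<Sum>d\<in>psi_exponents ?M. t ?M d)"
    by (simp add: weight_def t_def)
  also have "\<dots> = (\<Sum>(d, d')\<in>psi_exponents G \<times> psi_exponents K. t G d * t K d')"
  proof (rule sum.reindex_bij_witness[of _ "\<lambda>(d, d') x. if x \<in> B then d x else d' x"
        "\<lambda>d. (restrict d B, restrict d B')"])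
    fix d assume d: "d \<in> psi_exponents ?M"
    then have ext: "d \<in> extensional (B \<union> B')"
      by (simp add: psi)
    then show "(case (restrict d B, restrict d B') of (d, d') \<Rightarrow> \<lambda>x. if x \<in> B then d x else d' x) = d"
      by (auto simp: fun_eq_iff extensional_def)
    show "(restrict d B, restrict d B') \<in> psi_exponents G \<times> psi_exponents K"
      using d by (simp add: psi)
    show "(case (restrict d B, restrict d B') of (d, d') \<Rightarrow> t G d * t K d') = t ?M d"
      using t_cong[OF wf_both(1), of "restrict d B" d] t_cong[OF wf_both(2), of "restrict d B'" d]
      by (simp add: t_merge carriers)
  next
    fix x assume "x \<in> psi_exponents G \<times> psi_exponents K"
    then obtain d d' where x: "x = (d, d')" "d \<in> psi_exponents G" "d' \<in> psi_exponents K" by auto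
    then have ext: "d \<in> extensional B" "d' \<in> extensional B'"
      by (auto simp: psi_exponents_def PiE_iff carriers)
    let ?d = "\<lambda>x. if x \<in> B then d x else d' x"
    have "restrict ?d B = d" "restrict ?d B' = d'"
      using ext not_both by (auto simp: fun_eq_iff extensional_def)
    moreover have "?d \<in> extensional (B \<union> B')"
      using ext by (auto simp: extensional_def)
    ultimately show "(restrict (case x of (d, d') \<Rightarrow> \<lambda>x. if x \<in> B then d x else d' x) B,
        restrict (case x of (d, d') \<Rightarrow> \<lambda>x. if x \<in> B then d x else d' x) B') = x"
      "(case x of (d, d') \<Rightarrow> \<lambda>x. if x \<in> B then d x else d' x) \<in> psi_exponents ?M"
      using x by (simp_all add: psi)
  qed
  also have "\<dots> = weight G * weight K"
    by (simp add: weight_def t_def sum_product sum.cartesian_product)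
  finally show ?thesis .
qed

end

lemma subgraph_on_prestable:
  assumes G: "G \<in> prestable V H L" and A: "A \<subseteq> V" "opp_closed G A"
  shows "subgraph_on G A \<in> prestable A {h \<in> H. inc G h \<in> A} (leg_label G ` {h \<in> legs G. inc G h \<in> A})"
proof -
  have wf: "wf_graph G" and VH: "verts G = V" "halves G = H"
    and lab: "inj_on (leg_label G) (legs G)"
    using G by (auto simp: prestable_def bij_betw_def)
  note W = wf_graphD[OF wf, unfolded VH]
  have "finite A" using A W by (auto intro: finite_subset)
  have wf': "wf_graph (subgraph_on G A)"
    using W A(2) \<open>finite A\<close> by (auto simp: wf_graph_def opp_closed_def VH)
  have legs: "legs (subgraph_on G A) = {h \<in> legs G. inc G h \<in> A}"
    using legs_subset[of G] by (auto simp: legs_subgraph_on)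
  have "inj_on (leg_label G) {h \<in> legs G. inc G h \<in> A}"
    using lab by (rule inj_on_subset) auto
  then have lab': "bij_betw (leg_label (subgraph_on G A)) (legs (subgraph_on G A)) (leg_label G ` {h \<in> legs G. inc G h \<in> A})"
    unfolding legs using legs_subset[of G]
    by (subst bij_betw_cong[of _ _ "leg_label G"]) (auto intro: inj_on_imp_bij_betw)
  have can: "canonical (subgraph_on G A)"
    unfolding canonical_def legs_subgraph_on by simp
  have "halves_at (subgraph_on G A) v = halves_at G v" if "v \<in> A" for v
    using that by (auto simp: halves_at_def)
  then show ?thesis
    using wf' lab' can G A(1) by (auto simp: prestable_def)
qed

lemma opp_closed_subgraph_on:
  assumes "S \<subseteq> A" "wf_graph G" "opp_closed G A"
  shows "opp_closed (subgraph_on G A) S \<longleftrightarrow> opp_closed G S"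
proof -
  have "inc (subgraph_on G A) h = inc G h" "inc (subgraph_on G A) (opp (subgraph_on G A) h) = inc G (opp G h)"
    if "h \<in> halves G" "inc G h \<in> A" for h
    using that assms(2,3) wf_graphD[OF assms(2)] by (auto simp: opp_closed_def)
  then show ?thesis
    using assms(1) unfolding opp_closed_def by (auto simp del: subgraph_on_simps(3,4))
qed

lemma union_graph_subgraph_on:
  assumes G: "G \<in> prestable V H L" and A: "A \<subseteq> V" "opp_closed G A"
  shows "union_graph (subgraph_on G A) (subgraph_on G (V - A)) = G"
proof -
  have wf: "wf_graph G" and VH: "verts G = V" "halves G = H" and can: "canonical G"
    and inj: "inj_on (leg_label G) (legs G)"
    using G by (auto simp: prestable_def bij_betw_def)
  have cl: "opp_closed G (V - A)"
    using opp_closed_compl[OF wf A(2)] VH by simp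
  have "leg_label G ` {h \<in> legs G. inc G h \<in> A} \<inter> leg_label G ` {h \<in> legs G. inc G h \<in> V - A} = {}"
    using inj by (auto simp: inj_on_def)
  then interpret two_graphs "subgraph_on G A" "subgraph_on G (V - A)" A "{h \<in> H. inc G h \<in> A}"
    "leg_label G ` {h \<in> legs G. inc G h \<in> A}" "V - A" "{h \<in> H. inc G h \<in> V - A}"
    "leg_label G ` {h \<in> legs G. inc G h \<in> V - A}"
    by unfold_locales (use subgraph_on_prestable[OF G A] subgraph_on_prestable[OF G _ cl] in auto)
  have can': "canonical (union_graph (subgraph_on G A) (subgraph_on G (V - A)))"
    using union_graph_prestable by (simp add: prestable_def)
  have V: "A \<union> (V - A) = V" using A by auto
  have H: "{h \<in> H. inc G h \<in> A} \<union> {h \<in> H. inc G h \<in> V - A} = H"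
    using wf_graphD(3)[OF wf] VH by auto
  show ?thesis
    using can' can
  proof (rule canonical_eqI)
    show "verts (union_graph (subgraph_on G A) (subgraph_on G (V - A))) = verts G"
      "halves (union_graph (subgraph_on G A) (subgraph_on G (V - A))) = halves G"
      using V H VH by auto
    show "leg_label (union_graph (subgraph_on G A) (subgraph_on G (V - A))) h = leg_label G h"
      if "h \<in> legs (union_graph (subgraph_on G A) (subgraph_on G (V - A)))" for h
      using that VH by (auto simp: legs_union_graph legs_subgraph_on)
  qed (use V H VH in auto)
qed

section \<open>Cutting a bridge\<close>

text \<open>The smallest closed set that contains \<open>v\<close>; the complement of a closed set is closed, so it has no
  smaller nonempty closed subset.\<close>

definition component_of :: "sgraph \<Rightarrow> nat \<Rightarrow> nat set" where
  "component_of G v = \<Inter>{S. S \<subseteq> verts G \<and> v \<in> S \<and> opp_closed G S}"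

lemma component_of:
  assumes wf: "wf_graph G" and v: "v \<in> verts G"
  shows "component_of G v \<subseteq> verts G" "v \<in> component_of G v" "opp_closed G (component_of G v)"
    "\<And>S. S \<subseteq> component_of G v \<Longrightarrow> S \<noteq> {} \<Longrightarrow> opp_closed G S \<Longrightarrow> S = component_of G v"
proof -
  let ?C = "component_of G v"
  show sub: "?C \<subseteq> verts G" and v_in: "v \<in> ?C"
    using opp_closed_all[OF wf] v by (auto simp: component_of_def)
  show cl: "opp_closed G ?C"
    unfolding component_of_def opp_closed_def by blast
  have min: "?C \<subseteq> S" if "S \<subseteq> verts G" "v \<in> S" "opp_closed G S" for S
    using that by (auto simp: component_of_def)
  fix S assume S: "S \<subseteq> ?C" "S \<noteq> {}" "opp_closed G S"
  show "S = ?C"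
  proof (rule ccontr)
    assume "S \<noteq> ?C"
    then have "v \<notin> S" using min[of S] S sub by blast
    moreover have "opp_closed G (?C \<inter> (verts G - S))"
      by (intro opp_closed_Int cl opp_closed_compl wf S)
    ultimately have "?C \<subseteq> ?C \<inter> (verts G - S)"
      using v v_in by (intro min) auto
    then show False using S by blast
  qed
qed

lemma is_connected_subgraph_onI:
  assumes "A \<noteq> {}" "wf_graph G" "opp_closed G A"
    "\<And>S. S \<subseteq> A \<Longrightarrow> S \<noteq> {} \<Longrightarrow> opp_closed G S \<Longrightarrow> S = A"
  shows "is_connected (subgraph_on G A)"
  unfolding is_connected_def using assms opp_closed_subgraph_on[OF _ assms(2,3)] by simp

context cut_labels
begin

abbreviation "L_pq \<equiv> insert p (insert q L)"

text \<open>If gluing \<open>p\<close> to \<open>q\<close> makes the graph connected, every closed set that contains both or neither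
  of their vertices is trivial. So the graph has exactly two components, one with \<open>p\<close> and one with \<open>q\<close>.\<close>

lemma split_components:
  assumes G: "G \<in> prestable V H L_pq" and glue_legs: "is_connected (glue_legs p q G)" and "\<not> is_connected G"
  defines "A \<equiv> component_of G (inc G (leg_of G p))"
  shows "A \<subseteq> V" "opp_closed G A" "inc G (leg_of G p) \<in> A" "inc G (leg_of G q) \<in> V - A"
    "is_connected (subgraph_on G A)" "is_connected (subgraph_on G (V - A))"
proof -
  have wf: "wf_graph G" and VH: "verts G = V" "halves G = H"
    using G by (auto simp: prestable_def)
  define u v where "u = inc G (leg_of G p)" and "v = inc G (leg_of G q)"
  have u: "u \<in> V" and v: "v \<in> V"
    using leg_of(2)[OF G, of p] leg_of(2)[OF G, of q] wf_graphD(3)[OF wf] VH by (auto simp: u_def v_def)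
  note C = component_of[OF wf, of u, folded A_def[folded u_def], unfolded VH, OF u]
  show "A \<subseteq> V" "opp_closed G A" "inc G (leg_of G p) \<in> A"
    using C by (auto simp: u_def)
  show "is_connected (subgraph_on G A)"
    using C by (intro is_connected_subgraph_onI wf) auto
  have "A \<noteq> V"
    using C(4) \<open>\<not> is_connected G\<close> u unfolding is_connected_def VH by auto
  have glue_legs_closed: "S = V" if "S \<subseteq> V" "S \<noteq> {}" "opp_closed G S" "u \<in> S \<longleftrightarrow> v \<in> S" for S
    using glue_legs that opp_closed_glue_legs[OF G, of S] unfolding is_connected_def by (simp add: VH u_def v_def)
  \<comment> \<open>A closed set that avoids both \<open>u\<close> and \<open>v\<close> would be a proper closed set of the glued graph.\<close>
  have v_in: "v \<in> S" if "S \<subseteq> V - A" "S \<noteq> {}" "opp_closed G S" for S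
  proof (rule ccontr)
    assume "v \<notin> S"
    then have "S = V"
      using that C(2) by (intro glue_legs_closed) auto
    then show False using that C(2) u by auto
  qed
  have cl: "opp_closed G (V - A)"
    using opp_closed_compl[OF wf C(3)] VH by simp
  have ne: "V - A \<noteq> {}" using \<open>A \<noteq> V\<close> C(1) by auto
  show "inc G (leg_of G q) \<in> V - A"
    using v_in[OF _ ne cl] by (simp add: v_def)
  show "is_connected (subgraph_on G (V - A))"
  proof (rule is_connected_subgraph_onI[OF ne wf cl])
    fix S assume S: "S \<subseteq> V - A" "S \<noteq> {}" "opp_closed G S"
    have "opp_closed G ((V - A) \<inter> (V - S))"
      using opp_closed_Int[OF cl opp_closed_compl[OF wf S(3)]] by (simp add: VH)
    then have "v \<in> (V - A) \<inter> (V - S)" if "(V - A) \<inter> (V - S) \<noteq> {}"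
      using that by (intro v_in) auto
    then show "S = V - A"
      using v_in[OF S] S by blast
  qed
qed

text \<open>The data of a pair of components: its vertices \<open>A\<close>, half-edges \<open>B\<close>, old leg labels \<open>I\<close> and genus \<open>k\<close>
  for the component with the new leg \<open>p\<close>, and the two components.\<close>

definition splittings :: "nat \<Rightarrow> nat set \<Rightarrow> nat set \<Rightarrow>
    ((nat set \<times> nat set \<times> nat set \<times> nat) \<times> (sgraph \<times> sgraph)) set" where
  "splittings g V H = Sigma (Pow V \<times> Pow H \<times> Pow L \<times> {..g})
     (\<lambda>(A, B, I, k). labelled k A B (insert p I) \<times> labelled (g - k) (V - A) (H - B) (insert q (L - I)))"

definition two_component :: "nat \<Rightarrow> nat set \<Rightarrow> nat set \<Rightarrow> sgraph set" where
  "two_component g V H = {G \<in> prestable V H L_pq. is_connected (glue_legs p q G) \<and> euler g (card L) G \<and> \<not> is_connected G}"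

lemma two_graphs_splitting:
  assumes "A \<subseteq> V" "B \<subseteq> H" "I \<subseteq> L"
    "G \<in> labelled k A B (insert p I)" "K \<in> labelled (g - k) (V - A) (H - B) (insert q (L - I))"
  shows "two_graphs G K A B (insert p I) (V - A) (H - B) (insert q (L - I))"
  using assms pq by unfold_locales (auto simp: labelled_iff)

lemma union_graph_splitting:
  assumes "A \<subseteq> V" "B \<subseteq> H" "I \<subseteq> L" "k \<le> g"
    and G: "G \<in> labelled k A B (insert p I)" and K: "K \<in> labelled (g - k) (V - A) (H - B) (insert q (L - I))"
  shows "union_graph G K \<in> two_component g V H"
    "inc (union_graph G K) (leg_of (union_graph G K) p) \<in> A"
proof -
  interpret two_graphs G K A B "insert p I" "V - A" "H - B" "insert q (L - I)"
    by (rule two_graphs_splitting) fact+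
  have VHL: "A \<union> (V - A) = V" "B \<union> (H - B) = H" "insert p I \<union> insert q (L - I) = L_pq"
    using assms(1-3) by auto
  have prestable: "union_graph G K \<in> prestable V H L_pq"
    using union_graph_prestable unfolding VHL .
  have p: "inc (union_graph G K) (leg_of (union_graph G K) p) = inc G (leg_of G p)" "inc G (leg_of G p) \<in> A"
    using leg_of[OF pre1, of p] W
    by (simp_all add: leg_of_union_graph union_graph_left del: union_graph_simps)
  have q: "inc (union_graph G K) (leg_of (union_graph G K) q) = inc K (leg_of K q)" "inc K (leg_of K q) \<in> V - A"
    using leg_of[OF pre2, of q] W(4)
    by (simp_all add: leg_of_union_graph union_graph_right del: union_graph_simps)
  show "inc (union_graph G K) (leg_of (union_graph G K) p) \<in> A"
    using p by simp
  have is_connected: "is_connected G" "is_connected K" and e: "euler k (card (insert p I)) G" "euler (g - k) (card (insert q (L - I))) K"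
    using G K by (auto simp: labelled_iff)
  have "\<not> is_connected (union_graph G K)"
    using opp_closed_part p q assms(1) by (auto simp: is_connected_def carriers)
  moreover have "is_connected (glue_legs p q (union_graph G K))"
    unfolding is_connected_def
  proof (intro conjI allI impI)
    show "verts (glue_legs p q (union_graph G K)) \<noteq> {}" using p by (auto simp: carriers)
    fix S assume S: "S \<subseteq> verts (glue_legs p q (union_graph G K))" "S \<noteq> {}" "opp_closed (glue_legs p q (union_graph G K)) S"
    then have cl: "opp_closed G S" "opp_closed K S" and SV: "S \<subseteq> V"
      and iff: "inc G (leg_of G p) \<in> S \<longleftrightarrow> inc K (leg_of K q) \<in> S"
      using assms(1) unfolding opp_closed_glue_legs[OF prestable] opp_closed_union_graph p q by (auto simp: carriers)
    have "S \<inter> A \<noteq> {} \<Longrightarrow> A \<subseteq> S" "S \<inter> (V - A) \<noteq> {} \<Longrightarrow> V - A \<subseteq> S"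
      using connected_opp_closed[OF wf_both(1) is_connected(1) cl(1)] connected_opp_closed[OF wf_both(2) is_connected(2) cl(2)]
      by (simp_all add: carriers)
    then have "V \<subseteq> S"
      using p q iff S(2) SV by blast
    then show "S = verts (glue_legs p q (union_graph G K))"
      using SV assms(1) by (auto simp: carriers)
  qed
  moreover have "euler g (card L) (union_graph G K)"
  proof -
    have "finite V" "finite H" using fin VHL by (metis finite_Un)+
    then have "card V = card A + card (V - A)" "card H = card B + card (H - B)"
      using assms(1,2) by (simp_all add: card_Diff_subset finite_subset card_mono)
    moreover have "card (insert p I) + card (insert q (L - I)) = card L + 2"
      using fin_L pq assms(3) card_mono[OF fin_L assms(3)] finite_subset[OF assms(3) fin_L]
      by (subst card_insert_disjoint card_insert_disjoint, auto simp: card_Diff_subset)+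
    ultimately show ?thesis
      using e genus_union_graph assms(4) unfolding euler_def union_graph_simps(1,2) carriers VHL by simp
  qed
  ultimately show "union_graph G K \<in> two_component g V H"
    using prestable by (simp add: two_component_def)
qed

text \<open>The part \<open>A\<close> is determined by the union: it is the component of the leg \<open>p\<close>.\<close>

lemma union_graph_splitting_inj:
  assumes x: "A \<subseteq> V" "B \<subseteq> H" "I \<subseteq> L" "k \<le> g"
    "G \<in> labelled k A B (insert p I)" "K \<in> labelled (g - k) (V - A) (H - B) (insert q (L - I))"
    and y: "A' \<subseteq> V" "B' \<subseteq> H" "I' \<subseteq> L" "k' \<le> g"
    "G' \<in> labelled k' A' B' (insert p I')" "K' \<in> labelled (g - k') (V - A') (H - B') (insert q (L - I'))"
    and eq: "union_graph G K = union_graph G' K'"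
  shows "(A, B, I, k) = (A', B', I', k') \<and> G = G' \<and> K = K'"
proof -
  interpret X: two_graphs G K A B "insert p I" "V - A" "H - B" "insert q (L - I)"
    by (rule two_graphs_splitting) fact+
  interpret Y: two_graphs G' K' A' B' "insert p I'" "V - A'" "H - B'" "insert q (L - I')"
    by (rule two_graphs_splitting) fact+
  let ?M = "union_graph G K"
  have common: "A \<inter> A' \<noteq> {}"
    using union_graph_splitting(2)[OF x] union_graph_splitting(2)[OF y] eq by auto
  have cl: "opp_closed ?M A" "opp_closed ?M A'"
    using X.opp_closed_part Y.opp_closed_part eq by simp_all
  have "is_connected G" "is_connected G'" using x y by (auto simp: labelled_iff)
  then have "A \<subseteq> A'" "A' \<subseteq> A"
    using connected_opp_closed[OF X.wf_both(1), of A'] connected_opp_closed[OF Y.wf_both(1), of A] cl common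
      X.opp_closed_union_graph Y.opp_closed_union_graph eq
    by (auto simp: X.carriers Y.carriers Int_commute)
  then have A: "A = A'" by blast
  have G: "G = G'" "K = K'"
    using X.subgraph_on_union_graph Y.subgraph_on_union_graph eq A by simp_all
  have "B = B'" using X.carriers Y.carriers G by simp
  have "bij_betw (leg_label G) (legs G) (insert p I)" "bij_betw (leg_label G) (legs G) (insert p I')"
    using X.pre1 Y.pre1 G by (auto simp: prestable_def)
  then have "insert p I = insert p I'" by (metis bij_betw_imp_surj_on)
  moreover have "p \<notin> I" "p \<notin> I'" using x(3) y(3) pq by auto
  ultimately have "I = I'" using insert_ident by metis
  moreover have "k = k'"
    using x(5) y(5) \<open>I = I'\<close> G euler_unique by (auto simp: labelled_iff)
  ultimately show ?thesis using A \<open>B = B'\<close> G by simp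
qed

text \<open>The genus of each part comes from \<open>euler_exists\<close>; that the genera add up to \<open>g\<close> then follows
  from the equation for the union.\<close>

lemma union_graph_splitting_surj:
  assumes "\<Theta> \<in> two_component g V H"
  obtains A B I k G K where "A \<subseteq> V" "B \<subseteq> H" "I \<subseteq> L" "k \<le> g"
    "G \<in> labelled k A B (insert p I)" "K \<in> labelled (g - k) (V - A) (H - B) (insert q (L - I))" "union_graph G K = \<Theta>"
proof -
  have \<Theta>: "\<Theta> \<in> prestable V H L_pq" "is_connected (glue_legs p q \<Theta>)" "\<not> is_connected \<Theta>" and e: "euler g (card L) \<Theta>"
    using assms by (auto simp: two_component_def)
  have wf: "wf_graph \<Theta>" and VH: "verts \<Theta> = V" "halves \<Theta> = H"
    and lab: "bij_betw (leg_label \<Theta>) (legs \<Theta>) L_pq"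
    using \<Theta>(1) by (auto simp: prestable_def)
  define A where "A = component_of \<Theta> (inc \<Theta> (leg_of \<Theta> p))"
  note S = split_components[OF \<Theta>, folded A_def]
  have cl: "opp_closed \<Theta> (V - A)"
    using opp_closed_compl[OF wf S(2)] VH by simp
  define B where "B = {h \<in> H. inc \<Theta> h \<in> A}"
  have HB: "{h \<in> H. inc \<Theta> h \<in> V - A} = H - B"
    using wf_graphD(3)[OF wf] VH by (auto simp: B_def)
  define M where "M = leg_label \<Theta> ` {h \<in> legs \<Theta>. inc \<Theta> h \<in> A}"
  define I where "I = M - {p}"
  have p_in: "p \<in> M"
    unfolding M_def using S(3) leg_of[OF \<Theta>(1), of p] by (intro image_eqI[of _ _ "leg_of \<Theta> p"]) auto
  have q_in: "q \<in> leg_label \<Theta> ` {h \<in> legs \<Theta>. inc \<Theta> h \<in> V - A}"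
    using S(4) leg_of[OF \<Theta>(1), of q] by (intro image_eqI[of _ _ "leg_of \<Theta> q"]) auto
  have compl: "leg_label \<Theta> ` {h \<in> legs \<Theta>. inc \<Theta> h \<in> V - A} = L_pq - M"
  proof -
    have "{h \<in> legs \<Theta>. inc \<Theta> h \<in> V - A} = legs \<Theta> - {h \<in> legs \<Theta>. inc \<Theta> h \<in> A}"
      using wf_graphD(3)[OF wf] legs_subset[of \<Theta>] VH by auto
    moreover have "leg_label \<Theta> ` (legs \<Theta> - {h \<in> legs \<Theta>. inc \<Theta> h \<in> A}) = leg_label \<Theta> ` legs \<Theta> - M"
      unfolding M_def using lab by (intro inj_on_image_set_diff[of _ "legs \<Theta>"]) (auto simp: bij_betw_def)
    ultimately show ?thesis
      using lab by (simp add: bij_betw_def)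
  qed
  have "q \<notin> M" using q_in compl by auto
  moreover have "M \<subseteq> L_pq" using lab by (auto simp: M_def bij_betw_def)
  ultimately have I: "I \<subseteq> L" "M = insert p I" "L_pq - M = insert q (L - I)"
    using p_in pq by (auto simp: I_def)
  let ?G = "subgraph_on \<Theta> A" and ?K = "subgraph_on \<Theta> (V - A)"
  have G: "?G \<in> prestable A B (insert p I)"
    using subgraph_on_prestable[OF \<Theta>(1) S(1,2)] by (simp add: B_def M_def[symmetric] I(2)[symmetric])
  have K: "?K \<in> prestable (V - A) (H - B) (insert q (L - I))"
    using subgraph_on_prestable[OF \<Theta>(1) _ cl, unfolded compl I(3) HB] by blast
  have card_legs: "card (legs X) = card Y" if "X \<in> prestable W J Y" for X W J Y
    using that by (auto simp: prestable_def dest: bij_betw_same_card)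
  obtain k where k: "euler k (card (insert p I)) ?G"
    using euler_exists[OF _ S(5)] G card_legs[OF G] by (auto simp: prestable_def)
  obtain k' where k': "euler k' (card (insert q (L - I))) ?K"
    using euler_exists[OF _ S(6)] K card_legs[OF K] by (auto simp: prestable_def)
  have s: "?G \<in> labelled k A B (insert p I)" "?K \<in> labelled k' (V - A) (H - B) (insert q (L - I))"
    using G K k k' S(5,6) by (simp_all add: labelled_iff)
  have union_graph: "union_graph ?G ?K = \<Theta>"
    by (rule union_graph_subgraph_on[OF \<Theta>(1) S(1,2)])
  have "B \<subseteq> H" by (auto simp: B_def)
  have "euler (k + k') (card L) \<Theta>"
    using union_graph_splitting(1)[of A V B H I k "k + k'" ?G ?K] s S(1) I(1) \<open>B \<subseteq> H\<close>
    unfolding union_graph by (simp add: two_component_def)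
  then have "g = k + k'" using euler_unique e by blast
  then show ?thesis
    using that[OF S(1) \<open>B \<subseteq> H\<close> I(1), of k ?G ?K] s union_graph by simp
qed

lemma sum_cut_bridge:
  assumes fin: "finite V" "finite H"
  shows "(\<Sum>(G, h)\<in>{(G, h). G \<in> labelled g V H L \<and> h \<in> H - legs G \<and> \<not> is_connected (cut_edge p q G h)}. weight (cut_edge p q G h)) =
    (\<Sum>A\<in>Pow V. \<Sum>B\<in>Pow H. \<Sum>I\<in>Pow L. \<Sum>k\<le>g.
      (\<Sum>G\<in>labelled k A B (insert p I). weight G) *
      (\<Sum>K\<in>labelled (g - k) (V - A) (H - B) (insert q (L - I)). weight K))"
proof -
  let ?S = "\<lambda>(A, B, I, k). labelled k A B (insert p I) \<times> labelled (g - k) (V - A) (H - B) (insert q (L - I))"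
  have "bij_betw (\<lambda>(x, G, K). union_graph G K) (splittings g V H) (two_component g V H)"
    unfolding bij_betw_def
  proof
    show "inj_on (\<lambda>(x, G, K). union_graph G K) (splittings g V H)"
    proof (rule inj_onI)
      fix x y assume xy: "x \<in> splittings g V H" "y \<in> splittings g V H"
        "(case x of (x, G, K) \<Rightarrow> union_graph G K) = (case y of (x, G, K) \<Rightarrow> union_graph G K)"
      obtain A B I k G K A' B' I' k' G' K' where "x = ((A, B, I, k), G, K)" "y = ((A', B', I', k'), G', K')"
        by (metis surj_pair)
      with xy union_graph_splitting_inj[of A V B H I k g G K A' B' I' k' G' K'] show "x = y"
        by (simp add: splittings_def)
    qed
    show "(\<lambda>(x, G, K). union_graph G K) ` splittings g V H = two_component g V H"
    proof (rule equalityI; rule subsetI)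
      fix \<Theta> assume "\<Theta> \<in> (\<lambda>(x, G, K). union_graph G K) ` splittings g V H"
      then show "\<Theta> \<in> two_component g V H"
        using union_graph_splitting(1) by (auto simp: splittings_def)
    next
      fix \<Theta> assume "\<Theta> \<in> two_component g V H"
      then show "\<Theta> \<in> (\<lambda>(x, G, K). union_graph G K) ` splittings g V H"
      proof (rule union_graph_splitting_surj)
        fix A B I k G K
        assume "A \<subseteq> V" "B \<subseteq> H" "I \<subseteq> L" "k \<le> g" "G \<in> labelled k A B (insert p I)"
          "K \<in> labelled (g - k) (V - A) (H - B) (insert q (L - I))" "union_graph G K = \<Theta>"
        then show "\<Theta> \<in> (\<lambda>(x, G, K). union_graph G K) ` splittings g V H"
          by (intro image_eqI[of _ _ "((A, B, I, k), G, K)"]) (auto simp: splittings_def)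
      qed
    qed
  qed
  from sum.reindex_bij_betw[OF this, of weight, symmetric]
  have "(\<Sum>\<Theta>\<in>two_component g V H. weight \<Theta>) =
      (\<Sum>x\<in>splittings g V H. case x of (x, G, K) \<Rightarrow> weight (union_graph G K))"
    by (simp add: case_prod_unfold)
  also have "\<dots> = (\<Sum>x\<in>splittings g V H. case x of (x, G, K) \<Rightarrow> weight G * weight K)"
  proof (intro sum.cong refl)
    fix x assume x: "x \<in> splittings g V H"
    obtain A B I k G K where x': "x = ((A, B, I, k), G, K)" by (metis surj_pair)
    interpret two_graphs G K A B "insert p I" "V - A" "H - B" "insert q (L - I)"
      by (rule two_graphs_splitting) (use x x' in \<open>auto simp: splittings_def\<close>)
    show "(case x of (x, G, K) \<Rightarrow> weight (union_graph G K)) = (case x of (x, G, K) \<Rightarrow> weight G * weight K)"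
      by (simp add: x' weight_union_graph)
  qed
  also have "\<dots> = (\<Sum>x\<in>Pow V \<times> Pow H \<times> Pow L \<times> {..g}. \<Sum>(G, K)\<in>?S x. weight G * weight K)"
    unfolding splittings_def
  proof (subst sum.Sigma[symmetric])
    show "finite (Pow V \<times> Pow H \<times> Pow L \<times> {..g})" using fin fin_L by simp
    have "finite (labelled k A B (insert p I) \<times> labelled (g - k) (V - A) (H - B) (insert q (L - I)))"
      if "A \<subseteq> V" "B \<subseteq> H" "I \<subseteq> L" for A B I k
      using that fin fin_L by (intro finite_cartesian_product finite_labelled) (auto intro: finite_subset)
    then show "\<forall>x\<in>Pow V \<times> Pow H \<times> Pow L \<times> {..g}. finite (?S x)" by auto
  qed simp
  also have "\<dots> = (\<Sum>A\<in>Pow V. \<Sum>B\<in>Pow H. \<Sum>I\<in>Pow L. \<Sum>k\<le>g.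
      (\<Sum>G\<in>labelled k A B (insert p I). weight G) *
      (\<Sum>K\<in>labelled (g - k) (V - A) (H - B) (insert q (L - I)). weight K))"
    by (simp add: sum.cartesian_product' sum_product)
  finally show ?thesis
    unfolding sum_cut[of g V H "\<lambda>G. \<not> is_connected G"] two_component_def .
qed

end

section \<open>The series of weights and the formula for the area Siegel--Veech sum\<close>

definition labelled_sum :: "nat \<Rightarrow> nat \<Rightarrow> nat \<Rightarrow> nat \<Rightarrow> tau_poly" where
  "labelled_sum g n k m = (\<Sum>G\<in>labelled g {..<k} {..<m} {1..n}. weight G)"

text \<open>The weight \<open>1/(k! m!)\<close> of a labelled graph together with the factor \<open>1/2 ^ (k - 1)\<close> of its polynomial. It is
  written without subtraction, which is right for \<open>k \<ge> 1\<close>; there is no graph without vertices.\<close>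

definition sym_weight :: "nat \<Rightarrow> nat \<Rightarrow> real" where
  "sym_weight k m = 2 / (2 ^ k * fact k * fact m)"

text \<open>The bounds only have to be large enough for all stable graphs of type \<open>(g, n)\<close>, see \<open>labelled_bounds\<close>.\<close>

definition graph_series :: "nat \<Rightarrow> nat \<Rightarrow> tau_poly" where
  "graph_series g n = (\<Sum>k\<le>6 * g + 3 * n. \<Sum>m\<le>6 * g + 3 * n. rconst (sym_weight k m) * labelled_sum g n k m)"

lemma labelled_bounds:
  assumes "G \<in> labelled g {..<k} {..<m} {1..n}"
  shows "0 < k" "k + 2 \<le> 2 * g + n" "m \<le> 6 * g + 3 * n"
proof -
  have stable_type: "stable_type g {1..n} G" and VH: "verts G = {..<k}" "halves G = {..<m}"
    using assms by (auto simp: labelled_def)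
  have "verts G \<noteq> {}"
    using stable_type by (simp add: stable_type_def is_connected_def)
  then show "0 < k" using VH by (cases k) auto
  show "k + 2 \<le> 2 * g + n" "m \<le> 6 * g + 3 * n"
    using graph_size_bound[OF stable_type] by (simp_all add: VH)
qed

lemma labelled_cards: "G \<in> labelled g {..<k} {..<m} L \<Longrightarrow> card (verts G) = k \<and> card (halves G) = m"
  by (simp add: labelled_def)

lemma labelled_sum_eq_0:
  assumes "k = 0 \<or> 2 * g + n < k + 2 \<or> 6 * g + 3 * n < m"
  shows "labelled_sum g n k m = 0"
proof -
  have "labelled g {..<k} {..<m} {1..n} = {}"
    using labelled_bounds[of _ g k m n] assms by fastforce
  then show ?thesis by (simp add: labelled_sum_def)
qed

lemma sum_weight_card:
  assumes "finite V" "finite H" "finite L"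
  shows "(\<Sum>G\<in>labelled g V H L. weight G) = labelled_sum g (card L) (card V) (card H)"
proof -
  obtain \<phi> \<psi> \<kappa> where "bij_betw \<phi> V {..<card V}" "bij_betw \<psi> H {..<card H}" "bij_betw \<kappa> L {1..card L}"
    using finite_same_card_bij[OF assms(1), of "{..<card V}"] finite_same_card_bij[OF assms(2), of "{..<card H}"]
      finite_same_card_bij[OF assms(3), of "{1..card L}"] by auto
  then show ?thesis
    unfolding labelled_sum_def by (rule sum_weight_transport)
qed

lemma sum_extend_range:
  fixes F :: "nat \<Rightarrow> nat \<Rightarrow> 'a :: comm_monoid_add"
  assumes "\<And>k m. N < k \<or> N < m \<Longrightarrow> F k m = 0" "N \<le> M"
  shows "(\<Sum>k\<le>N. \<Sum>m\<le>N. F k m) = (\<Sum>k\<le>M. \<Sum>m\<le>M. F k m)"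
proof -
  have "(\<Sum>k\<le>M. \<Sum>m\<le>M. F k m) = (\<Sum>k\<le>M. \<Sum>m\<le>N. F k m)"
    by (rule sum.cong[OF refl], rule sum.mono_neutral_right) (use assms in auto)
  also have "\<dots> = (\<Sum>k\<le>N. \<Sum>m\<le>N. F k m)"
    by (rule sum.mono_neutral_right) (use assms in auto)
  finally show ?thesis by simp
qed

lemma sum_rotate3:
  "(\<Sum>a\<in>A. \<Sum>i\<in>I. \<Sum>j\<in>J. f a i j) = (\<Sum>i\<in>I. \<Sum>j\<in>J. \<Sum>a\<in>A. f a i j)"
  by (rule trans[OF sum.swap], rule sum.cong[OF refl], rule sum.swap)

lemma sum_rotate4:
  "(\<Sum>a\<in>A. \<Sum>b\<in>B. \<Sum>i\<in>I. \<Sum>j\<in>J. f a b i j) = (\<Sum>i\<in>I. \<Sum>j\<in>J. \<Sum>a\<in>A. \<Sum>b\<in>B. f a b i j)"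
proof -
  have "(\<Sum>a\<in>A. \<Sum>b\<in>B. \<Sum>i\<in>I. \<Sum>j\<in>J. f a b i j) = (\<Sum>a\<in>A. \<Sum>i\<in>I. \<Sum>j\<in>J. \<Sum>b\<in>B. f a b i j)"
    by (rule sum.cong[OF refl], rule sum_rotate3)
  also have "\<dots> = (\<Sum>i\<in>I. \<Sum>j\<in>J. \<Sum>a\<in>A. \<Sum>b\<in>B. f a b i j)"
    by (rule sum_rotate3)
  finally show ?thesis .
qed

text \<open>Allows a common range of summation for several types.\<close>

lemma graph_series_extend:
  assumes "6 * g + 3 * n \<le> M"
  shows "graph_series g n = (\<Sum>k\<le>M. \<Sum>m\<le>M. rconst (sym_weight k m) * labelled_sum g n k m)"
  unfolding graph_series_def by (rule sum_extend_range[OF _ assms]) (auto simp: labelled_sum_eq_0)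

lemma sum_standard_graphs:
  assumes "6 * g + 3 * n \<le> M"
  shows "(\<Sum>G\<in>standard_graphs g n. rconst (1 / (fact (card (verts G)) * fact (card (halves G)))) *
      (rconst (a / 2 ^ (card (verts G) - 1)) * f G)) =
    rconst a * (\<Sum>k\<le>M. \<Sum>m\<le>M. rconst (sym_weight k m) * (\<Sum>G\<in>labelled g {..<k} {..<m} {1..n}. f G))"
proof -
  let ?N = "6 * g + 3 * n"
  let ?t = "\<lambda>G. rconst (1 / (fact (card (verts G)) * fact (card (halves G)))) *
      (rconst (a / 2 ^ (card (verts G) - 1)) * f G)"
  have "(\<Sum>G\<in>standard_graphs g n. ?t G) = (\<Sum>k\<le>?N. \<Sum>G\<in>(\<Union>m\<le>?N. labelled g {..<k} {..<m} {1..n}). ?t G)"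
    unfolding standard_graphs_def
    by (rule sum.UNION_disjoint) (auto intro!: finite_labelled dest: labelled_cards)
  also have "\<dots> = (\<Sum>k\<le>?N. \<Sum>m\<le>?N. \<Sum>G\<in>labelled g {..<k} {..<m} {1..n}. ?t G)"
    by (rule sum.cong[OF refl], rule sum.UNION_disjoint) (auto intro!: finite_labelled dest: labelled_cards)
  also have "\<dots> = (\<Sum>k\<le>?N. \<Sum>m\<le>?N. rconst a * (rconst (sym_weight k m) * (\<Sum>G\<in>labelled g {..<k} {..<m} {1..n}. f G)))"
  proof (intro sum.cong refl)
    fix k m
    have "?t G = rconst a * (rconst (sym_weight k m) * f G)" if G: "G \<in> labelled g {..<k} {..<m} {1..n}" for G
    proof -
      have "verts G = {..<k}" "halves G = {..<m}" using G by (auto simp: labelled_def)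
      moreover have "(2::real) ^ k = 2 * 2 ^ (k - 1)"
        using labelled_bounds(1)[OF G] by (cases k) auto
      ultimately have "1 / (fact (card (verts G)) * fact (card (halves G))) * (a / 2 ^ (card (verts G) - 1)) =
          a * sym_weight k m"
        by (simp add: sym_weight_def)
      then show ?thesis
        by (simp only: mult.assoc[symmetric] rconst_mult[symmetric])
    qed
    then show "(\<Sum>G\<in>labelled g {..<k} {..<m} {1..n}. ?t G) =
        rconst a * (rconst (sym_weight k m) * (\<Sum>G\<in>labelled g {..<k} {..<m} {1..n}. f G))"
      by (simp add: sum_distrib_left)
  qed
  also have "\<dots> = (\<Sum>k\<le>M. \<Sum>m\<le>M. rconst a * (rconst (sym_weight k m) * (\<Sum>G\<in>labelled g {..<k} {..<m} {1..n}. f G)))"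
  proof (rule sum_extend_range[OF _ assms])
    fix k m assume "?N < k \<or> ?N < m"
    then have "labelled g {..<k} {..<m} {1..n} = {}"
      using labelled_bounds[of _ g k m n] by fastforce
    then show "rconst a * (rconst (sym_weight k m) * (\<Sum>G\<in>labelled g {..<k} {..<m} {1..n}. f G)) = 0"
      by simp
  qed
  finally show ?thesis by (simp add: sum_distrib_left)
qed

lemma sum_stable_P:
  "sum_stable g n (\<lambda>G. Z_op (P_graph g n G)) = rconst (vol_const g n) * graph_series g n"
proof -
  let ?f = "\<lambda>G. rconst (vol_const g n / 2 ^ (card (verts G) - 1)) * weight G"
  have "sum_stable g n (\<lambda>G. Z_op (P_graph g n G)) =
      (\<Sum>G\<in>standard_graphs g n. rconst (1 / (fact (card (verts G)) * fact (card (halves G)))) * ?f G)"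
  proof (rule sum_stable_labelled)
    fix G K \<phi> \<psi> assume a: "wf_graph G" "graph_iso \<phi> \<psi> id G K"
    then show "?f K = ?f G"
      using weight_iso[OF a] bij_betw_same_card[OF graph_isoD(1)[OF a(2)]] by simp
  next
    fix G assume "wf_graph G"
    then show "Z_op (P_graph g n G) = rconst (1 / real (card (Aut G))) * ?f G"
      by (simp only: Z_op_P_graph mult.assoc[symmetric] rconst_mult[symmetric]) (simp add: mult.commute)
  qed
  then show ?thesis
    by (simp only: sum_standard_graphs[OF order_refl] graph_series_def labelled_sum_def)
qed

lemma cut_edge_iso:
  assumes wf: "wf_graph G" and iso: "graph_iso \<phi> \<psi> id G K" and h: "h \<in> halves G - legs G"
  shows "graph_iso \<phi> \<psi> id (cut_edge p q G h) (cut_edge p q K (\<psi> h))"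
proof -
  note D = graph_isoD[OF iso] and nl = non_legD[OF wf h]
  have eq: "\<psi> x = \<psi> h \<longleftrightarrow> x = h" "\<psi> x = \<psi> (opp G h) \<longleftrightarrow> x = opp G h" if "x \<in> halves G" for x
    using inj_on_eq_iff[OF D(4)] that nl by auto
  have opp_h: "opp K (\<psi> h) = \<psi> (opp G h)"
    by (rule D(8)[OF nl(1)])
  have "leg_label (cut_edge p q K (\<psi> h)) (\<psi> x) = leg_label (cut_edge p q G h) x" if x: "x \<in> legs (cut_edge p q G h)" for x
  proof -
    have "x \<in> halves G" using x legs_subset[of "cut_edge p q G h"] by auto
    note eq = eq[OF this]
    have "leg_label K (\<psi> x) = leg_label G x" if "x \<noteq> h" "x \<noteq> opp G h"
      using x that D(10)[of x] by (simp add: legs_cut_edge[OF wf h])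
    then show ?thesis
      unfolding cut_edge_simps opp_h fun_upd_apply eq by simp
  qed
  moreover have "opp (cut_edge p q K (\<psi> h)) (\<psi> x) = \<psi> (opp (cut_edge p q G h) x)" if x: "x \<in> halves G" for x
    unfolding cut_edge_simps opp_h fun_upd_apply eq[OF x] D(8)[OF x] by simp
  ultimately show ?thesis
    using D(1,2,7,9) by (simp add: graph_iso_def del: cut_edge_simps(5,6))
qed

text \<open>A bridge has weight \<open>1/2\<close>, and bridges are the edges whose cut graph is not connected.\<close>

lemma sum_stable_del:
  assumes "6 * g + 3 * n \<le> M"
  shows "sum_stable g n (\<lambda>G. Z_op (del_graph G (P_graph g n G))) =
    rconst (vol_const g n * (pi\<^sup>2 / 12)) * (\<Sum>k\<le>M. \<Sum>m\<le>M. rconst (sym_weight k m) *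
      (\<Sum>G\<in>labelled g {..<k} {..<m} {1..n}. \<Sum>h\<in>halves G - legs G.
         rconst (if is_connected (cut_edge p q G h) then 1 else 1 / 2) * weight (cut_edge p q G h)))"
proof -
  let ?H = "\<lambda>G. \<Sum>h\<in>halves G - legs G.
         rconst (if is_connected (cut_edge p q G h) then 1 else 1 / 2) * weight (cut_edge p q G h)"
  let ?f = "\<lambda>G. rconst (vol_const g n * (pi\<^sup>2 / 12) / 2 ^ (card (verts G) - 1)) * ?H G"
  have "sum_stable g n (\<lambda>G. Z_op (del_graph G (P_graph g n G))) =
      (\<Sum>G\<in>standard_graphs g n. rconst (1 / (fact (card (verts G)) * fact (card (halves G)))) * ?f G)"
  proof (rule sum_stable_labelled)
    fix G K \<phi> \<psi> assume wf: "wf_graph G" and iso: "graph_iso \<phi> \<psi> id G K"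
    have im: "halves K - legs K = \<psi> ` (halves G - legs G)"
      using graph_isoD(4,6)[OF iso] legs_iso[OF wf iso] legs_subset[of G]
      by (simp add: inj_on_image_set_diff)
    have inj: "inj_on \<psi> (halves G - legs G)"
      using graph_isoD(4)[OF iso] by (rule inj_on_subset) auto
    have "?H K = ?H G"
      unfolding im sum.reindex[OF inj]
    proof (intro sum.cong refl)
      fix h assume h: "h \<in> halves G - legs G"
      show "((\<lambda>h. rconst (if is_connected (cut_edge p q K h) then 1 else 1 / 2) * weight (cut_edge p q K h)) \<circ> \<psi>) h =
          rconst (if is_connected (cut_edge p q G h) then 1 else 1 / 2) * weight (cut_edge p q G h)"
        using is_connected_iso[OF wf_cut_edge[OF wf h] cut_edge_iso[OF wf iso h]] weight_iso[OF wf_cut_edge[OF wf h] cut_edge_iso[OF wf iso h]]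
        by simp
    qed
    then show "?f K = ?f G"
      using bij_betw_same_card[OF graph_isoD(1)[OF iso]] by simp
  next
    fix G assume wf: "wf_graph G"
    have "(\<Sum>h\<in>halves G - legs G. rconst (chi G {h, opp G h}) * weight (cut_edge p q G h)) = ?H G"
      by (intro sum.cong refl) (simp add: chi_def bridge_iff[OF wf, of _ p q])
    then show "Z_op (del_graph G (P_graph g n G)) = rconst (1 / real (card (Aut G))) * ?f G"
      by (simp only: Z_op_del_graph[OF wf, of g n p q] mult.assoc[symmetric] rconst_mult[symmetric])
        (simp add: mult.commute mult.left_commute)
  qed
  then show ?thesis
    by (simp only: sum_standard_graphs[OF assms])
qed

lemma sum_Pow_card:
  assumes "finite V"
  shows "(\<Sum>A\<in>Pow V. f (card A)) = (\<Sum>a\<le>card V. of_nat (card V choose a) * (f a :: tau_poly))"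
proof -
  have "(\<Sum>A\<in>Pow V. f (card A)) = (\<Sum>a\<le>card V. \<Sum>A\<in>{A \<in> Pow V. card A = a}. f (card A))"
    using assms by (intro sum.group[symmetric]) (auto intro: card_mono)
  also have "\<dots> = (\<Sum>a\<le>card V. \<Sum>A\<in>{A \<in> Pow V. card A = a}. f a)"
    by (intro sum.cong refl) auto
  also have "\<dots> = (\<Sum>a\<le>card V. of_nat (card V choose a) * f a)"
    using n_subsets[OF assms] by (simp add: Pow_def)
  finally show ?thesis .
qed

lemma sum_Pow_card3:
  fixes f :: "nat \<Rightarrow> nat \<Rightarrow> nat \<Rightarrow> tau_poly"
  assumes "finite V" "finite H" "finite L"
  shows "(\<Sum>A\<in>Pow V. \<Sum>B\<in>Pow H. \<Sum>I\<in>Pow L. f (card A) (card B) (card I)) =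
    (\<Sum>a\<le>card V. \<Sum>b\<le>card H. \<Sum>i\<le>card L.
      of_nat ((card V choose a) * (card H choose b) * (card L choose i)) * f a b i)"
proof -
  define f2 where "f2 = (\<lambda>a b. \<Sum>I\<in>Pow L. f a b (card I))"
  define f1 where "f1 = (\<lambda>a. \<Sum>B\<in>Pow H. f2 a (card B))"
  have "f2 a b = (\<Sum>i\<le>card L. of_nat (card L choose i) * f a b i)" for a b
    unfolding f2_def by (rule sum_Pow_card[OF assms(3)])
  moreover have "f1 a = (\<Sum>b\<le>card H. of_nat (card H choose b) * f2 a b)" for a
    unfolding f1_def by (rule sum_Pow_card[OF assms(2)])
  moreover have "(\<Sum>A\<in>Pow V. f1 (card A)) = (\<Sum>a\<le>card V. of_nat (card V choose a) * f1 a)"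
    by (rule sum_Pow_card[OF assms(1)])
  ultimately have "(\<Sum>A\<in>Pow V. f1 (card A)) = (\<Sum>a\<le>card V. \<Sum>b\<le>card H. \<Sum>i\<le>card L.
      of_nat ((card V choose a) * (card H choose b) * (card L choose i)) * f a b i)"
    by (simp only: sum_distrib_left of_nat_mult mult.assoc)
  then show ?thesis
    by (simp only: f1_def f2_def)
qed

text \<open>The components of the cut graph live on subsets of the vertices, half-edges and legs, but their sums
  depend on the cardinalities of these subsets only.\<close>

lemma sum_cut_labelled:
  "(\<Sum>G\<in>labelled g {..<k} {..<m} {1..n}. \<Sum>h\<in>halves G - legs G.
      rconst (if is_connected (cut_edge (n + 1) (n + 2) G h) then 1 else 1 / 2) * weight (cut_edge (n + 1) (n + 2) G h)) =
   (if g = 0 then 0 else labelled_sum (g - 1) (n + 2) k m) +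
   rconst (1 / 2) * (\<Sum>a\<le>k. \<Sum>b\<le>m. \<Sum>i\<le>n. \<Sum>j\<le>g.
      of_nat ((k choose a) * (m choose b) * (n choose i)) * (labelled_sum j (i + 1) a b * labelled_sum (g - j) (n - i + 1) (k - a) (m - b)))"
proof -
  let ?V = "{..<k}" and ?H = "{..<m}" and ?L = "{1..n}" and ?p = "n + 1" and ?q = "n + 2"
  interpret cut_labels ?p ?q ?L by unfold_locales auto
  let ?S = "{(G, h). G \<in> labelled g ?V ?H ?L \<and> h \<in> ?H - legs G}"
  let ?S1 = "{(G, h). G \<in> labelled g ?V ?H ?L \<and> h \<in> ?H - legs G \<and> is_connected (cut_edge ?p ?q G h)}"
  let ?S2 = "{(G, h). G \<in> labelled g ?V ?H ?L \<and> h \<in> ?H - legs G \<and> \<not> is_connected (cut_edge ?p ?q G h)}"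
  let ?t = "\<lambda>G h. rconst (if is_connected (cut_edge ?p ?q G h) then 1 else 1 / 2) * weight (cut_edge ?p ?q G h)"
  have fin: "finite (labelled g ?V ?H ?L)" by (intro finite_labelled) auto
  have S: "?S = Sigma (labelled g ?V ?H ?L) (\<lambda>G. ?H - legs G)" by auto
  have finS: "finite ?S" unfolding S using fin by auto
  have "(\<Sum>G\<in>labelled g ?V ?H ?L. \<Sum>h\<in>halves G - legs G. ?t G h) = (\<Sum>G\<in>labelled g ?V ?H ?L. \<Sum>h\<in>?H - legs G. ?t G h)"
    by (intro sum.cong) (auto simp: labelled_def)
  also have "\<dots> = (\<Sum>(G, h)\<in>?S. ?t G h)"
    unfolding S using fin by (intro sum.Sigma) auto
  also have "\<dots> = (\<Sum>(G, h)\<in>?S1 \<union> ?S2. ?t G h)"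
    by (rule sum.cong) auto
  also have "\<dots> = (\<Sum>(G, h)\<in>?S1. ?t G h) + (\<Sum>(G, h)\<in>?S2. ?t G h)"
    by (rule sum.union_disjoint) (auto intro: finite_subset[OF _ finS])
  also have "(\<Sum>(G, h)\<in>?S1. ?t G h) = (\<Sum>(G, h)\<in>?S1. weight (cut_edge ?p ?q G h))"
    by (rule sum.cong) auto
  also have "\<dots> = (if g = 0 then 0 else labelled_sum (g - 1) (n + 2) k m)"
    unfolding sum_cut_nonbridge by (simp add: sum_weight_card)
  also have "(\<Sum>(G, h)\<in>?S2. ?t G h) = rconst (1 / 2) * (\<Sum>(G, h)\<in>?S2. weight (cut_edge ?p ?q G h))"
    unfolding sum_distrib_left by (rule sum.cong) auto
  also have "(\<Sum>(G, h)\<in>?S2. weight (cut_edge ?p ?q G h)) =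
    (\<Sum>A\<in>Pow ?V. \<Sum>B\<in>Pow ?H. \<Sum>I\<in>Pow ?L. \<Sum>j\<le>g.
      labelled_sum j (card I + 1) (card A) (card B) * labelled_sum (g - j) (n - card I + 1) (k - card A) (m - card B))"
  proof -
    have "(\<Sum>G\<in>labelled j A B (insert ?p I). weight G) = labelled_sum j (card I + 1) (card A) (card B)"
      "(\<Sum>G\<in>labelled (g - j) (?V - A) (?H - B) (insert ?q (?L - I)). weight G) =
          labelled_sum (g - j) (n - card I + 1) (k - card A) (m - card B)"
      if "A \<subseteq> ?V" "B \<subseteq> ?H" "I \<subseteq> ?L" for A B I j
    proof -
      have f: "finite A" "finite B" "finite I" using that by (auto intro: finite_subset)
      have "?p \<notin> I" "?q \<notin> I" using that by auto
      then show "(\<Sum>G\<in>labelled j A B (insert ?p I). weight G) = labelled_sum j (card I + 1) (card A) (card B)"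
        "(\<Sum>G\<in>labelled (g - j) (?V - A) (?H - B) (insert ?q (?L - I)). weight G) =
          labelled_sum (g - j) (n - card I + 1) (k - card A) (m - card B)"
        using f that by (subst sum_weight_card; simp add: card_Diff_subset)+
    qed
    then show ?thesis
      unfolding sum_cut_bridge[OF finite_lessThan finite_lessThan]
      by (intro sum.cong refl) auto
  qed
  also have "\<dots> = (\<Sum>a\<le>k. \<Sum>b\<le>m. \<Sum>i\<le>n. \<Sum>j\<le>g.
      of_nat ((k choose a) * (m choose b) * (n choose i)) * (labelled_sum j (i + 1) a b * labelled_sum (g - j) (n - i + 1) (k - a) (m - b)))"
    using sum_Pow_card3[of ?V ?H ?L "\<lambda>a b i. \<Sum>j\<le>g. labelled_sum j (i + 1) a b * labelled_sum (g - j) (n - i + 1) (k - a) (m - b)"]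
    by (simp add: sum_distrib_left)
  finally show ?thesis .
qed

lemma sum_convolution:
  fixes F :: "nat \<Rightarrow> nat \<Rightarrow> 'a :: comm_monoid_add"
  assumes "\<And>a c. N < a \<or> N' < c \<Longrightarrow> F a c = 0" "N + N' \<le> M"
  shows "(\<Sum>k\<le>M. \<Sum>a\<le>k. F a (k - a)) = (\<Sum>a\<le>N. \<Sum>c\<le>N'. F a c)"
proof -
  have "(\<Sum>k\<le>M. \<Sum>a\<le>k. F a (k - a)) = (\<Sum>(a, c)\<in>{(a, c). a + c \<le> M}. F a c)"
    by (simp add: sum.triangle_reindex_eq)
  also have "\<dots> = (\<Sum>(a, c)\<in>{..N} \<times> {..N'}. F a c)"
  proof (rule sum.mono_neutral_right)
    show "finite {(a, c). a + c \<le> M}"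
      by (rule finite_subset[of _ "{..M} \<times> {..M}"]) auto
    show "\<forall>x\<in>{(a, c). a + c \<le> M} - {..N} \<times> {..N'}. (case x of (a, c) \<Rightarrow> F a c) = 0"
      by (auto intro: assms(1))
  qed (use assms(2) in auto)
  finally show ?thesis by (simp add: sum.cartesian_product)
qed

text \<open>The binomial coefficients split the factorials. The factor \<open>1/2\<close> comes from the powers of two: two
  graphs with \<open>a\<close> and \<open>k - a\<close> vertices have \<open>2 ^ (k - 2)\<close> in the denominator instead of \<open>2 ^ (k - 1)\<close>.\<close>

lemma sym_weight_split:
  assumes "a \<le> k" "b \<le> m"
  shows "sym_weight k m * real ((k choose a) * (m choose b)) = 1 / 2 * (sym_weight a b * sym_weight (k - a) (m - b))"
proof -
  have "(2::real) ^ k = 2 ^ a * 2 ^ (k - a)"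
    using assms by (simp add: power_add[symmetric])
  then show ?thesis
    using assms by (simp add: sym_weight_def binomial_fact field_simps)
qed

text \<open>A binomial convolution over \<open>k\<close> and \<open>m\<close> becomes the product of the two series, as for exponential
  generating functions.\<close>

lemma product_series:
  assumes M: "(6 * j + 3 * i) + (6 * j' + 3 * i') \<le> M"
  shows "(\<Sum>k\<le>M. \<Sum>m\<le>M. rconst (sym_weight k m) * (\<Sum>a\<le>k. \<Sum>b\<le>m.
      of_nat ((k choose a) * (m choose b)) * (labelled_sum j i a b * labelled_sum j' i' (k - a) (m - b)))) =
    rconst (1 / 2) * (graph_series j i * graph_series j' i')"
proof -
  let ?N = "6 * j + 3 * i" and ?N' = "6 * j' + 3 * i'"
  let ?u = "\<lambda>a b. rconst (sym_weight a b) * labelled_sum j i a b" and ?v = "\<lambda>a b. rconst (sym_weight a b) * labelled_sum j' i' a b"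
  have "(\<Sum>k\<le>M. \<Sum>m\<le>M. rconst (sym_weight k m) * (\<Sum>a\<le>k. \<Sum>b\<le>m.
      of_nat ((k choose a) * (m choose b)) * (labelled_sum j i a b * labelled_sum j' i' (k - a) (m - b)))) =
    (\<Sum>k\<le>M. \<Sum>m\<le>M. \<Sum>a\<le>k. \<Sum>b\<le>m. rconst (1 / 2) * (?u a b * ?v (k - a) (m - b)))"
    unfolding sum_distrib_left
  proof (intro sum.cong refl)
    fix k m a b :: nat assume "a \<in> {..k}" "b \<in> {..m}"
    then have "rconst (sym_weight k m) * of_nat ((k choose a) * (m choose b)) =
        rconst (1 / 2) * (rconst (sym_weight a b) * rconst (sym_weight (k - a) (m - b)))"
      unfolding rconst_of_nat[symmetric] rconst_mult[symmetric] by (subst sym_weight_split) auto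
    then show "rconst (sym_weight k m) * (of_nat ((k choose a) * (m choose b)) * (labelled_sum j i a b * labelled_sum j' i' (k - a) (m - b))) =
        rconst (1 / 2) * (?u a b * ?v (k - a) (m - b))"
      unfolding mult.assoc[symmetric] by (simp only: mult_ac)
  qed
  also have "\<dots> = rconst (1 / 2) * (\<Sum>k\<le>M. \<Sum>a\<le>k. \<Sum>m\<le>M. \<Sum>b\<le>m. ?u a b * ?v (k - a) (m - b))"
    unfolding sum_distrib_left by (rule sum.cong[OF refl], rule sum.swap)
  also have "(\<Sum>k\<le>M. \<Sum>a\<le>k. \<Sum>m\<le>M. \<Sum>b\<le>m. ?u a b * ?v (k - a) (m - b)) =
      (\<Sum>k\<le>M. \<Sum>a\<le>k. \<Sum>b\<le>?N. \<Sum>c\<le>?N'. ?u a b * ?v (k - a) c)"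
    by (rule sum.cong[OF refl], rule sum.cong[OF refl], rule sum_convolution[OF _ M]) (auto simp: labelled_sum_eq_0)
  also have "\<dots> = (\<Sum>a\<le>?N. \<Sum>c'\<le>?N'. \<Sum>b\<le>?N. \<Sum>c\<le>?N'. ?u a b * ?v c' c)"
    by (rule sum_convolution[OF _ M]) (auto simp: labelled_sum_eq_0)
  also have "\<dots> = graph_series j i * graph_series j' i'"
    unfolding graph_series_def by (simp add: sum_product)
  finally show ?thesis .
qed

text \<open>Besides the bijections for cut graphs, this collects the constants: \<open>3/\<pi>\<^sup>2 \<cdot> \<pi>\<^sup>2/12 = 1/4\<close>,
  and for bridges another \<open>1/2\<close> from their weight and \<open>1/2\<close> from the powers of two.\<close>

theorem formal_A_eq:
  "formal_A g n = rconst (vol_const g n) * (rconst (1 / 4) * (if g = 0 then 0 else graph_series (g - 1) (n + 2)) +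
     rconst (1 / 16) * (\<Sum>i\<le>n. \<Sum>j\<le>g. of_nat (n choose i) * (graph_series j (i + 1) * graph_series (g - j) (n - i + 1))))"
proof -
  define M where "M = 6 * g + 3 * (n + 2)"
  let ?l = "\<lambda>k m a b i j. labelled_sum j (i + 1) a b * labelled_sum (g - j) (n - i + 1) (k - a) (m - b)"
  have "(\<Sum>k\<le>M. \<Sum>m\<le>M. rconst (sym_weight k m) *
      ((if g = 0 then 0 else labelled_sum (g - 1) (n + 2) k m) + rconst (1 / 2) * (\<Sum>a\<le>k. \<Sum>b\<le>m. \<Sum>i\<le>n. \<Sum>j\<le>g.
      of_nat ((k choose a) * (m choose b) * (n choose i)) * ?l k m a b i j))) =
    (\<Sum>k\<le>M. \<Sum>m\<le>M. rconst (sym_weight k m) * (if g = 0 then 0 else labelled_sum (g - 1) (n + 2) k m)) +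
    rconst (1 / 2) * (\<Sum>k\<le>M. \<Sum>m\<le>M. rconst (sym_weight k m) * (\<Sum>a\<le>k. \<Sum>b\<le>m. \<Sum>i\<le>n. \<Sum>j\<le>g.
      of_nat ((k choose a) * (m choose b) * (n choose i)) * ?l k m a b i j))"
    by (simp only: distrib_left sum.distrib sum_distrib_left mult.left_commute)
  also have "(\<Sum>k\<le>M. \<Sum>m\<le>M. rconst (sym_weight k m) * (if g = 0 then 0 else labelled_sum (g - 1) (n + 2) k m)) =
      (if g = 0 then 0 else graph_series (g - 1) (n + 2))"
    using graph_series_extend[of "g - 1" "n + 2" M] by (simp add: M_def)
  also have "(\<Sum>k\<le>M. \<Sum>m\<le>M. rconst (sym_weight k m) * (\<Sum>a\<le>k. \<Sum>b\<le>m. \<Sum>i\<le>n. \<Sum>j\<le>g.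
      of_nat ((k choose a) * (m choose b) * (n choose i)) * ?l k m a b i j)) =
    (\<Sum>k\<le>M. \<Sum>m\<le>M. \<Sum>i\<le>n. \<Sum>j\<le>g. of_nat (n choose i) * (rconst (sym_weight k m) * (\<Sum>a\<le>k. \<Sum>b\<le>m.
      of_nat ((k choose a) * (m choose b)) * ?l k m a b i j)))"
  proof (intro sum.cong refl)
    fix k m
    show "rconst (sym_weight k m) * (\<Sum>a\<le>k. \<Sum>b\<le>m. \<Sum>i\<le>n. \<Sum>j\<le>g.
        of_nat ((k choose a) * (m choose b) * (n choose i)) * ?l k m a b i j) =
      (\<Sum>i\<le>n. \<Sum>j\<le>g. of_nat (n choose i) * (rconst (sym_weight k m) * (\<Sum>a\<le>k. \<Sum>b\<le>m.
        of_nat ((k choose a) * (m choose b)) * ?l k m a b i j)))"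
      unfolding sum_rotate4[where A = "{..k}"] by (simp only: sum_distrib_left of_nat_mult mult_ac)
  qed
  also have "\<dots> = (\<Sum>i\<le>n. \<Sum>j\<le>g. of_nat (n choose i) * (\<Sum>k\<le>M. \<Sum>m\<le>M. rconst (sym_weight k m) * (\<Sum>a\<le>k. \<Sum>b\<le>m.
      of_nat ((k choose a) * (m choose b)) * ?l k m a b i j)))"
    unfolding sum_rotate4[where A = "{..M}"] by (simp only: sum_distrib_left)
  also have "\<dots> = (\<Sum>i\<le>n. \<Sum>j\<le>g. of_nat (n choose i) * (rconst (1 / 2) * (graph_series j (i + 1) * graph_series (g - j) (n - i + 1))))"
    by (rule sum.cong[OF refl], rule sum.cong[OF refl], rule arg_cong2[where f = "(*)"], rule refl, rule product_series)
       (auto simp: M_def)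
  also have "\<dots> = rconst (1 / 2) * (\<Sum>i\<le>n. \<Sum>j\<le>g. of_nat (n choose i) * (graph_series j (i + 1) * graph_series (g - j) (n - i + 1)))"
    by (simp only: sum_distrib_left mult.left_commute)
  finally have series: "(\<Sum>k\<le>M. \<Sum>m\<le>M. rconst (sym_weight k m) *
      ((if g = 0 then 0 else labelled_sum (g - 1) (n + 2) k m) + rconst (1 / 2) * (\<Sum>a\<le>k. \<Sum>b\<le>m. \<Sum>i\<le>n. \<Sum>j\<le>g.
      of_nat ((k choose a) * (m choose b) * (n choose i)) * ?l k m a b i j))) =
    (if g = 0 then 0 else graph_series (g - 1) (n + 2)) + rconst (1 / 2) * (rconst (1 / 2) *
      (\<Sum>i\<le>n. \<Sum>j\<le>g. of_nat (n choose i) * (graph_series j (i + 1) * graph_series (g - j) (n - i + 1))))" .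
  have "6 * g + 3 * n \<le> M" by (simp add: M_def)
  from sum_stable_del[OF this, of "n + 1" "n + 2"]
  have main: "formal_A g n = rconst (3 / pi\<^sup>2) * (rconst (vol_const g n * (pi\<^sup>2 / 12)) *
     ((if g = 0 then 0 else graph_series (g - 1) (n + 2)) + rconst (1 / 2) * (rconst (1 / 2) *
      (\<Sum>i\<le>n. \<Sum>j\<le>g. of_nat (n choose i) * (graph_series j (i + 1) * graph_series (g - j) (n - i + 1))))))"
    unfolding formal_A_def sum_cut_labelled series by (rule arg_cong)
  have c: "3 / pi\<^sup>2 * (vol_const g n * (pi\<^sup>2 / 12)) = vol_const g n * (1 / 4)"
    by simp
  show ?thesis
    unfolding main mult.assoc[symmetric] distrib_left rconst_mult[symmetric] c
    by (simp add: mult.assoc[symmetric] rconst_mult[symmetric])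
qed

section \<open>Small types and volumes\<close>

abbreviation tau03 :: tau_poly where "tau03 \<equiv> tau {#0, 0, 0#}"

lemma single_vertex:
  assumes G: "G \<in> labelled g {..<1} {..<m} {1..n}"
  shows "verts G = {0}" "halves G = {..<m}" "wf_graph G" "card (legs G) = n" "halves_at G 0 = {..<m}"
    "2 * g + n = m + 2 * genus G 0"
proof -
  show V: "verts G = {0}" and H: "halves G = {..<m}" and wf: "wf_graph G" and "card (legs G) = n"
    using G by (auto simp: labelled_def stable_type_def dest: bij_betw_same_card)
  show "halves_at G 0 = {..<m}"
    using wf_graphD(3)[OF wf] V H by (auto simp: halves_at_def)
  show "2 * g + n = m + 2 * genus G 0"
    using G V H by (simp add: labelled_def stable_type_def)
qed

text \<open>For a single vertex of genus \<open>0\<close> with three half-edges the exponents add up to \<open>0\<close>.\<close>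

lemma psi_exponents_03:
  assumes G: "G \<in> labelled g {..<1} {..<3} {1..n}" and "2 * g + n = 3"
  shows "psi_exponents G = {\<lambda>x\<in>{..<3}. 0}" "vertex_factors G (\<lambda>x\<in>{..<3}. 0) = tau03"
proof -
  note s = single_vertex[OF G]
  have g: "genus G 0 = 0" using s(6) assms(2) by simp
  show "psi_exponents G = {\<lambda>x\<in>{..<3}. 0}"
  proof (intro equalityI subsetI)
    fix d assume d: "d \<in> psi_exponents G"
    then have "\<forall>x\<in>{..<3}. d x = 0" "d \<in> extensional {..<3}"
      using s g by (auto simp: psi_exponents_def PiE_iff)
    then show "d \<in> {\<lambda>x\<in>{..<3}. 0}"
      by (auto simp: fun_eq_iff extensional_def)
  next
    fix d assume "d \<in> {\<lambda>x\<in>{..<3::nat}. 0::nat}"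
    then show "d \<in> psi_exponents G"
      using s g legs_subset[of G] by (auto simp: psi_exponents_def)
  qed
  have "mset_set {..<3::nat} = {#0, 1, 2#}"
    by (simp add: numeral_3_eq_3 lessThan_Suc numeral_2_eq_2 add_mset_commute)
  then show "vertex_factors G (\<lambda>x\<in>{..<3}. 0) = tau03"
    using s g by (simp add: vertex_factors_def vertex_factor_def)
qed

text \<open>Only the six bijections between half-edges and leg labels are left to choose.\<close>

lemma labelled_sum_03: "labelled_sum 0 3 1 3 = rconst 6 * tau03"
proof -
  let ?S = "labelled 0 {..<1} {..<3} {1..3}"
  have weight: "weight G = tau03" and legs: "legs G = {..<3}" if G: "G \<in> ?S" for G
  proof -
    note s = single_vertex[OF G]
    show legs: "legs G = {..<3}"
      using s legs_subset[of G] by (intro card_subset_eq) auto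
    then have "edges G = {}" using s by (simp add: edges_image)
    then show "weight G = tau03"
      using psi_exponents_03[OF G] by (simp add: weight_def)
  qed
  define tripod where "tripod = (\<lambda>f. \<lparr>verts = {..<1}, halves = {..<3}, inc = \<lambda>x\<in>{..<3}. 0, opp = \<lambda>x\<in>{..<3}. x,
    genus = \<lambda>v\<in>{..<1}. 0, leg_label = f\<rparr> :: sgraph)"
  have "bij_betw leg_label ?S (bijections {..<3} {1..3})"
  proof (rule bij_betw_byWitness[where f' = tripod])
    show "leg_label ` ?S \<subseteq> bijections {..<3} {1..3}"
    proof (rule image_subsetI)
      fix G assume G: "G \<in> ?S"
      then have "leg_label G \<in> extensional (legs G)" "bij_betw (leg_label G) (legs G) {1..3}"
        by (auto simp: labelled_def stable_type_def canonical_def)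
      then show "leg_label G \<in> bijections {..<3} {1..3}"
        by (simp add: bijections_def legs[OF G])
    qed
    show "tripod ` bijections {..<3} {1..3} \<subseteq> ?S"
    proof (rule image_subsetI)
      fix f :: "nat \<Rightarrow> nat" assume f: "f \<in> bijections {..<3} {1..3}"
      have "legs (tripod f) = {..<3}" by (auto simp: legs_def tripod_def)
      moreover have "halves_at (tripod f) 0 = {..<3}" by (auto simp: halves_at_def tripod_def)
      ultimately show "tripod f \<in> ?S"
        using f by (auto simp: labelled_def stable_type_def canonical_def wf_graph_def bijections_def is_connected_def tripod_def)
    qed
    show "\<forall>G\<in>?S. tripod (leg_label G) = G"
    proof
      fix G assume G: "G \<in> ?S"
      note s = single_vertex[OF G]
      have "inc G x = 0" "opp G x = x" if "x < 3" for x
        using that s wf_graphD(3)[OF s(3)] legs[OF G] by (auto simp: legs_def set_eq_iff)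
      then have "inc G = (\<lambda>x\<in>{..<3}. 0)" "opp G = (\<lambda>x\<in>{..<3}. x)" "genus G = (\<lambda>v\<in>{..<1}. 0)"
        using G s by (auto simp: labelled_def canonical_def fun_eq_iff extensional_def)
      then show "tripod (leg_label G) = G"
        using s by (intro sgraph.equality) (auto simp: tripod_def)
    qed
  qed (simp add: tripod_def)
  then have "card ?S = fact 3"
    using card_bijections[of "{..<3}" "{1..3}"] by (simp add: bij_betw_same_card)
  then have "labelled_sum 0 3 1 3 = of_nat 6 * tau03"
    by (simp add: labelled_sum_def weight fact_numeral)
  then show ?thesis using rconst_of_nat[of 6] by simp
qed

text \<open>Instead of enumerating the graphs with one loop, the loop is cut: with one vertex every cut graph
  is connected, so \<open>sum_cut_nonbridge\<close> expresses the sum over pairs of a graph and a half of its loop by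
  the type \<open>(0, 3)\<close>. Every graph occurs in two pairs, and the loop contributes \<open>\<zeta>(2)\<close>.\<close>

lemma labelled_sum_11: "labelled_sum 1 1 1 3 = rconst (pi\<^sup>2 / 2) * tau03"
proof -
  let ?S = "labelled 1 {..<1} {..<3} {1..1}"
  interpret cut_labels 2 3 "{1..1}" by unfold_locales auto
  have is_connected: "is_connected (cut_edge 2 3 G h)" and weight: "weight G = rconst (pi\<^sup>2 / 6) * weight (cut_edge 2 3 G h)"
    if G: "G \<in> ?S" and h: "h \<in> {..<3} - legs G" for G h
  proof -
    note s = single_vertex[OF G]
    have h: "h \<in> halves G - legs G" using h s by simp
    show "is_connected (cut_edge 2 3 G h)"
      using s by (auto simp: is_connected_def)
    let ?d = "\<lambda>x\<in>{..<3::nat}. 0::nat" and ?e = "{h, opp G h}"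
    have e: "?e \<in> edges G" using h by (auto simp: edges_image)
    have d0: "?d i = 0" if "i \<in> ?e" for i
      using that non_legD(1,2)[OF s(3) h] s by auto
    have "(\<Prod>e\<in>edges G. zeta_factor (1 + 2 * (\<Sum>i\<in>e. ?d i))) =
        pi\<^sup>2 / 6 * (\<Prod>e\<in>edges G - {?e}. zeta_factor (1 + 2 * (\<Sum>i\<in>e. ?d i)))"
      using sum.neutral[of ?e ?d] d0
      by (subst prod.remove[OF finite_edges[OF s(3)] e]) (simp add: zeta_factor_1)
    note prod_edges = this
    have psi: "psi_exponents G = {?d}"
      using psi_exponents_03(1)[OF G] by simp
    then have filter: "{d \<in> psi_exponents G. \<forall>i\<in>?e. d i = 0} = {?d}"
      using d0 by auto
    have single: "(\<Sum>d\<in>{?d}. f d) = f ?d" for f :: "_ \<Rightarrow> tau_poly"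
      by simp
    have weight_cut_edge: "weight (cut_edge 2 3 G h) = vertex_factors G ?d *
        rconst (\<Prod>e\<in>edges G - {?e}. zeta_factor (1 + 2 * (\<Sum>i\<in>e. ?d i)))"
      unfolding weight_cut_edge[OF s(3) h] filter by (rule single)
    show "weight G = rconst (pi\<^sup>2 / 6) * weight (cut_edge 2 3 G h)"
      unfolding weight_cut_edge weight_def[of G] psi single prod_edges
      by (simp only: rconst_mult mult_ac)
  qed
  let ?T = "{(G, h). G \<in> ?S \<and> h \<in> {..<3} - legs G}"
  have fin: "finite ?S" by (intro finite_labelled) auto
  have "rconst (pi\<^sup>2 / 6) * (rconst 6 * tau03) = rconst (pi\<^sup>2 / 6) *
     (\<Sum>(G, h)\<in>{(G, h). G \<in> ?S \<and> h \<in> {..<3} - legs G \<and> is_connected (cut_edge 2 3 G h)}. weight (cut_edge 2 3 G h))"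
    unfolding sum_cut_nonbridge using labelled_sum_03 by (simp add: sum_weight_card numeral_3_eq_3)
  also have "\<dots> = rconst (pi\<^sup>2 / 6) * (\<Sum>(G, h)\<in>?T. weight (cut_edge 2 3 G h))"
    by (intro arg_cong2[where f = "(*)"] sum.cong refl) (use is_connected in auto)
  also have "\<dots> = (\<Sum>(G, h)\<in>?T. weight G)"
    unfolding sum_distrib_left by (intro sum.cong refl) (use weight in auto)
  also have "\<dots> = (\<Sum>G\<in>?S. \<Sum>h\<in>{..<3} - legs G. weight G)"
    using fin by (subst sum.Sigma) (auto intro!: sum.cong)
  also have "\<dots> = (\<Sum>G\<in>?S. 2 * weight G)"
  proof (intro sum.cong refl)
    fix G assume G: "G \<in> ?S"
    note s = single_vertex[OF G]
    have "finite (legs G)"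
      using legs_subset[of G] s(2) by (auto intro: finite_subset)
    then have "card ({..<3} - legs G) = 2"
      using s legs_subset[of G] by (simp add: card_Diff_subset)
    then show "(\<Sum>h\<in>{..<3} - legs G. weight G) = 2 * weight G" by simp
  qed
  also have "\<dots> = rconst 2 * labelled_sum 1 1 1 3"
    using rconst_of_nat[of 2] by (simp add: labelled_sum_def sum_distrib_left)
  \<comment> \<open>The factor \<open>2\<close> counts the two halves of the loop.\<close>
  finally have "rconst (1 / 2) * (rconst (pi\<^sup>2 / 6) * (rconst 6 * tau03)) = labelled_sum 1 1 1 3"
    using rconst_cancel[of 2 "labelled_sum 1 1 1 3"] by simp
  then show ?thesis
    by (simp add: mult.assoc[symmetric] rconst_mult[symmetric])
qed

lemma graph_series_single_term:
  assumes "\<And>k m. labelled_sum g n k m \<noteq> 0 \<Longrightarrow> k = 1 \<and> m = 3" "3 \<le> 6 * g + 3 * n"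
  shows "graph_series g n = rconst (1 / 6) * labelled_sum g n 1 3"
proof -
  let ?N = "6 * g + 3 * n"
  have zero: "labelled_sum g n k m = 0" if "\<not> (k = 1 \<and> m = 3)" for k m
    using assms(1) that by blast
  have "graph_series g n = (\<Sum>k\<le>?N. \<Sum>m\<le>?N. if k = 1 then if m = 3 then rconst (sym_weight 1 3) * labelled_sum g n 1 3 else 0 else 0)"
    unfolding graph_series_def by (rule sum.cong[OF refl], rule sum.cong[OF refl]) (simp add: zero)
  also have "\<dots> = (\<Sum>k\<le>?N. if k = 1 then rconst (sym_weight 1 3) * labelled_sum g n 1 3 else 0)"
    by (rule sum.cong[OF refl]) (use assms(2) in simp)
  also have "\<dots> = rconst (sym_weight 1 3) * labelled_sum g n 1 3"
    using assms(2) by simp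
  finally show ?thesis
    by (simp add: sym_weight_def fact_numeral)
qed

lemma graph_series_03: "graph_series 0 3 = tau03"
proof -
  have "k = 1 \<and> m = 3" if ne: "labelled_sum 0 3 k m \<noteq> 0" for k m
  proof -
    have k: "k = 1" using labelled_sum_eq_0[of k 0 3 m] ne by linarith
    obtain G where G: "G \<in> labelled 0 {..<1} {..<m} {1..3}"
      using ne unfolding k labelled_sum_def by (metis sum.neutral)
    note s = single_vertex[OF G]
    have "3 \<le> m"
      using card_mono[OF _ legs_subset[of G]] s by simp
    with s(6) k show ?thesis by simp
  qed
  then show ?thesis
    using graph_series_single_term[of 0 3] labelled_sum_03 rconst_cancel[of 6 tau03] by simp
qed

text \<open>The graph without edges, a vertex of genus \<open>1\<close> with one leg, has weight \<open>0\<close>: its exponent would have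
  to be \<open>1\<close>, but exponents at legs vanish.\<close>

lemma graph_series_11: "graph_series 1 1 = rconst (pi\<^sup>2 / 12) * tau03"
proof -
  have "k = 1 \<and> m = 3" if ne: "labelled_sum 1 1 k m \<noteq> 0" for k m
  proof -
    have k: "k = 1" using labelled_sum_eq_0[of k 1 1 m] ne by linarith
    obtain G where G: "G \<in> labelled 1 {..<1} {..<m} {1..1}" and w: "weight G \<noteq> 0"
      using ne unfolding k labelled_sum_def by (metis sum.neutral)
    note s = single_vertex[OF G]
    have "m \<noteq> 1"
    proof
      assume m: "m = 1"
      have "legs G = {..<m}"
        using s m legs_subset[of G] by (intro card_subset_eq) auto
      then have "psi_exponents G = {}"
        using s m by (auto simp: psi_exponents_def)
      then show False using w by (simp add: weight_def)
    qed
    with s(6) k show ?thesis by presburger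
  qed
  then have "graph_series 1 1 = rconst (1 / 6) * (rconst (pi\<^sup>2 / 2) * tau03)"
    using graph_series_single_term[of 1 1] labelled_sum_11 by simp
  then show ?thesis
    by (simp add: mult.assoc[symmetric] rconst_mult[symmetric])
qed

text \<open>By \<open>labelled_bounds\<close> such a graph would have no vertex.\<close>

lemma graph_series_unstable:
  assumes "n \<le> 2"
  shows "graph_series 0 n = 0"
proof -
  have "labelled_sum 0 n k m = 0" for k m
    by (rule labelled_sum_eq_0) (use assms in linarith)
  then show ?thesis by (simp add: graph_series_def)
qed

lemma formal_V_eq:
  assumes "(g, n) \<noteq> (0, 3)"
  shows "formal_V g n = rconst (vol_const g n) * graph_series g n"
proof (cases "(g, n) = (1, 1)")
  case True
  then have "formal_V g n = rconst (2 * pi\<^sup>2 / 3) * tau03"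
    by (simp add: formal_V_def)
  moreover have "rconst (vol_const g n) * graph_series g n = rconst (8 * (pi\<^sup>2 / 12)) * tau03"
    using True graph_series_11 by (simp add: vol_const_def mult.assoc[symmetric] rconst_mult[symmetric])
  ultimately show ?thesis by simp
next
  case False
  then show ?thesis
    using assms by (auto simp: formal_V_def sum_stable_P)
qed

lemma formal_V_03: "formal_V 0 3 = rconst 4 * graph_series 0 3"
  by (simp add: formal_V_def graph_series_03)

section \<open>Comparison of the constants\<close>

lemma vol_const_dim:
  assumes "dim_d g n \<ge> 1"
  shows "vol_const g n = 2 ^ (dim_d g n + 1) * fact (dim_l g n) / fact (dim_d g n - 1)"
proof -
  have "6 * g + 2 * n - 5 = dim_d g n + 1" "6 * g + 2 * n - 7 = dim_d g n - 1"
    using assms by (simp_all add: dim_d_def)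
  then show ?thesis by (simp add: vol_const_def dim_l_def)
qed

lemma bridge_coefficient:
  assumes "g1 + g2 = g" "n1 + n2 = n + 2" "n1 \<ge> 1" "n2 \<ge> 1" "dim_d g1 n1 \<ge> 1" "dim_d g2 n2 \<ge> 1"
  shows "1 / 8 * (fact (dim_l g n) / (fact (dim_l g1 n1) * fact (dim_l g2 n2)))
      * (fact n / (fact (n1 - 1) * fact (n2 - 1)))
      * (fact (dim_d g1 n1 - 1) * fact (dim_d g2 n2 - 1) / fact (dim_d g n - 1))
      * (vol_const g1 n1 * vol_const g2 n2) = vol_const g n * (1 / 16) * real (n choose (n1 - 1))"
proof -
  have d: "dim_d g n = dim_d g1 n1 + dim_d g2 n2 + 2"
    using assms by (auto simp: dim_d_def)
  have "n - (n1 - 1) = n2 - 1" "n1 - 1 \<le> n" using assms by auto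
  then have "real (n choose (n1 - 1)) = fact n / (fact (n1 - 1) * fact (n2 - 1))"
    by (simp add: binomial_fact)
  moreover have "vol_const g n = 2 ^ (dim_d g1 n1 + dim_d g2 n2 + 3) * fact (dim_l g n) / fact (dim_d g n - 1)"
    using vol_const_dim[of g n] d by (simp add: numeral_eq_Suc)
  moreover note vol_const_dim[OF assms(5)] vol_const_dim[OF assms(6)]
  moreover have "(2::real) ^ (dim_d g1 n1 + dim_d g2 n2 + 3) = 2 ^ (dim_d g1 n1 + 1) * 2 ^ (dim_d g2 n2 + 1) * 2"
    by (simp add: power_add)
  ultimately show ?thesis
    by (simp only:) (simp add: mult_ac del: power_Suc)
qed

lemma nonbridge_coefficient:
  assumes "g \<ge> 1" "2 * g + n > 3"
  shows "fact (dim_l g n) / fact (dim_l g n - 2) * (fact (dim_d g n - 3) / fact (dim_d g n - 1))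
     * vol_const (g - 1) (n + 2) = vol_const g n * (1 / 4)"
proof -
  define k where "k = dim_d g n - 3"
  have d: "dim_d g n = k + 3" "dim_d (g - 1) (n + 2) = k + 1" "dim_l (g - 1) (n + 2) = dim_l g n - 2"
    using assms by (auto simp: dim_d_def dim_l_def k_def)
  have "vol_const g n = 2 ^ (k + 4) * fact (dim_l g n) / fact (k + 2)"
    "vol_const (g - 1) (n + 2) = 2 ^ (k + 2) * fact (dim_l g n - 2) / fact k"
    using vol_const_dim[of g n] vol_const_dim[of "g - 1" "n + 2"] by (simp_all only: d) simp_all
  moreover have "(2::real) ^ (k + 4) = 4 * 2 ^ (k + 2)"
    by (simp add: power_add)
  ultimately show ?thesis
    by (simp only: d) (simp del: fact_Suc)
qed

lemma trivalent_coefficient: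
  assumes "n \<ge> 2" "6 * g + 2 * n \<ge> 10"
  shows "1 / 16 * ((4 * real g - 4 + real n) * real n * (real n - 1)
      / ((6 * real g - 7 + 2 * real n) * (6 * real g - 8 + 2 * real n))) * (4 * vol_const g (n - 1)) =
    vol_const g n * (1 / 16) * (real n * (real n - 1))"
proof -
  define x where "x = 6 * g + 2 * n - 9"
  define y where "y = 4 * g + n - 5"
  have y5: "4 * g + n \<ge> 5" using assms by (cases "g = 0") auto
  have e: "6 * g + 2 * n - 5 = x + 4" "4 * g + n - 4 = y + 1" "6 * g + 2 * n - 7 = x + 2"
    "6 * g + 2 * (n - 1) - 5 = x + 2" "4 * g + (n - 1) - 4 = y" "6 * g + 2 * (n - 1) - 7 = x"
    using assms y5 by (auto simp: x_def y_def)
  have "real (6 * g + 2 * n) = real (x + 9)" "real (4 * g + n) = real (y + 5)"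
    using assms y5 by (simp_all add: x_def y_def del: of_nat_add of_nat_mult)
  then have r: "6 * real g - 7 + 2 * real n = real x + 2" "6 * real g - 8 + 2 * real n = real x + 1"
    "4 * real g - 4 + real n = real y + 1"
    by simp_all
  have "real x + 1 \<noteq> 0" "real x + 2 \<noteq> 0" by linarith+
  then show ?thesis
    unfolding vol_const_def e r by (simp add: power_add field_simps)
qed

text \<open>The index set of the sum over pairs of types. The conditions on the dimensions exclude the
  type \<open>(0, 3)\<close> as well as the unstable types.\<close>

definition stable_splittings :: "nat \<Rightarrow> nat \<Rightarrow> (nat \<times> nat \<times> nat \<times> nat) set" where
  "stable_splittings g n = {(g1, n1, g2, n2). g1 + g2 = g \<and> n1 + n2 = n + 2 \<and>
     n1 \<ge> 1 \<and> n2 \<ge> 1 \<and> dim_d g1 n1 \<ge> 1 \<and> dim_d g2 n2 \<ge> 1}"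

text \<open>For \<open>(g, n) = (0, 4)\<close> the two entries coincide, which makes this case special.\<close>

definition trivalent_splittings :: "nat \<Rightarrow> nat \<Rightarrow> (nat \<times> nat \<times> nat \<times> nat) set" where
  "trivalent_splittings g n = (if n \<ge> 2 then {(0, 3, g, n - 1), (g, n - 1, 0, 3)} else {})"

definition splitting_term :: "nat \<Rightarrow> nat \<times> nat \<times> nat \<times> nat \<Rightarrow> tau_poly" where
  "splitting_term n = (\<lambda>(g1, n1, g2, n2). of_nat (n choose (n1 - 1)) * (graph_series g1 n1 * graph_series g2 n2))"

text \<open>Terms with an unstable type vanish; the terms of the type \<open>(0, 3)\<close> are split off.\<close>

lemma sum_splittings:
  assumes st: "2 * g + n > 3"
  shows "(\<Sum>i\<le>n. \<Sum>j\<le>g. of_nat (n choose i) * (graph_series j (i + 1) * graph_series (g - j) (n - i + 1))) =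
    sum (splitting_term n) (stable_splittings g n) + sum (splitting_term n) (trivalent_splittings g n)"
proof -
  let ?A = "{(g1, n1, g2, n2). g1 + g2 = g \<and> n1 + n2 = n + 2 \<and> n1 \<ge> (1::nat) \<and> n2 \<ge> (1::nat)}"
  let ?D = "stable_splittings g n" and ?E = "trivalent_splittings g n" and ?t = "splitting_term n"
  have fin: "finite ?A"
    by (rule finite_subset[of _ "{..g} \<times> {..n + 2} \<times> {..g} \<times> {..n + 2}"]) auto
  have DE: "?D \<subseteq> ?A" "?E \<subseteq> ?A" "?D \<inter> ?E = {}"
    by (auto simp: stable_splittings_def trivalent_splittings_def dim_d_def split: if_splits)
  \<comment> \<open>What remains has a component of genus \<open>0\<close> with at most two legs.\<close>
  have zero: "?t x = 0" if "x \<in> ?A - (?D \<union> ?E)" for x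
  proof -
    obtain g1 n1 g2 n2 where x: "x = (g1, n1, g2, n2)" by (metis surj_pair)
    have "(g1 = 0 \<and> n1 \<le> 2) \<or> (g2 = 0 \<and> n2 \<le> 2)"
      using that st unfolding x
      by (auto simp: stable_splittings_def trivalent_splittings_def dim_d_def split: if_splits)
    then show ?thesis by (auto simp: x splitting_term_def graph_series_unstable)
  qed
  have "(\<Sum>i\<le>n. \<Sum>j\<le>g. of_nat (n choose i) * (graph_series j (i + 1) * graph_series (g - j) (n - i + 1))) =
      (\<Sum>(i, j)\<in>{..n} \<times> {..g}. of_nat (n choose i) * (graph_series j (i + 1) * graph_series (g - j) (n - i + 1)))"
    by (rule sum.cartesian_product)
  also have "\<dots> = sum ?t ?A"
    by (rule sum.reindex_bij_witness[of _ "\<lambda>(g1, n1, g2, n2). (n1 - 1, g1)" "\<lambda>(i, j). (j, i + 1, g - j, n - i + 1)"])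
       (auto simp: splitting_term_def)
  also have "\<dots> = sum ?t (?D \<union> ?E)"
    by (rule sum.mono_neutral_right[OF fin]) (use DE zero in blast)+
  also have "\<dots> = sum ?t ?D + sum ?t ?E"
    by (rule sum.union_disjoint[OF finite_subset[OF DE(1) fin] finite_subset[OF DE(2) fin] DE(3)])
  finally show ?thesis .
qed

lemma bridge_terms:
  assumes "(g, n) \<noteq> (0, 3)"
    and x: "x \<in> stable_splittings g n"
  shows "(case x of (g1, n1, g2, n2) \<Rightarrow> rconst (1 / 8
             * (fact (dim_l g n) / (fact (dim_l g1 n1) * fact (dim_l g2 n2)))
             * (fact n / (fact (n1 - 1) * fact (n2 - 1)))
             * (fact (dim_d g1 n1 - 1) * fact (dim_d g2 n2 - 1) / fact (dim_d g n - 1)))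
           * formal_V g1 n1 * formal_V g2 n2) =
    rconst (vol_const g n * (1 / 16)) * splitting_term n x"
proof -
  obtain g1 n1 g2 n2 where x': "x = (g1, n1, g2, n2)" by (metis surj_pair)
  have c: "g1 + g2 = g" "n1 + n2 = n + 2" "n1 \<ge> 1" "n2 \<ge> 1" "dim_d g1 n1 \<ge> 1" "dim_d g2 n2 \<ge> 1"
    using x by (auto simp: x' stable_splittings_def)
  define coef :: real where "coef = 1 / 8
             * (fact (dim_l g n) / (fact (dim_l g1 n1) * fact (dim_l g2 n2)))
             * (fact n / (fact (n1 - 1) * fact (n2 - 1)))
             * (fact (dim_d g1 n1 - 1) * fact (dim_d g2 n2 - 1) / fact (dim_d g n - 1))"
  have "(g1, n1) \<noteq> (0, 3)" "(g2, n2) \<noteq> (0, 3)"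
    using c by (auto simp: dim_d_def)
  then have "formal_V g1 n1 = rconst (vol_const g1 n1) * graph_series g1 n1" "formal_V g2 n2 = rconst (vol_const g2 n2) * graph_series g2 n2"
    using formal_V_eq by blast+
  then have "rconst coef * formal_V g1 n1 * formal_V g2 n2 =
      rconst (coef * (vol_const g1 n1 * vol_const g2 n2)) * (graph_series g1 n1 * graph_series g2 n2)"
    by (simp only: rconst_mult mult_ac)
  also have "coef * (vol_const g1 n1 * vol_const g2 n2) = vol_const g n * (1 / 16) * real (n choose (n1 - 1))"
    unfolding coef_def by (rule bridge_coefficient[OF c])
  finally show ?thesis
    by (simp only: x' coef_def splitting_term_def prod.case rconst_mult rconst_of_nat mult.assoc)
qed

lemma sum_bridge_terms:
  assumes "(g, n) \<noteq> (0, 3)"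
  shows "(\<Sum>(g1, n1, g2, n2)\<in>stable_splittings g n. rconst (1 / 8
             * (fact (dim_l g n) / (fact (dim_l g1 n1) * fact (dim_l g2 n2)))
             * (fact n / (fact (n1 - 1) * fact (n2 - 1)))
             * (fact (dim_d g1 n1 - 1) * fact (dim_d g2 n2 - 1) / fact (dim_d g n - 1)))
           * formal_V g1 n1 * formal_V g2 n2) =
    rconst (vol_const g n * (1 / 16)) * sum (splitting_term n) (stable_splittings g n)"
  unfolding sum_distrib_left by (intro sum.cong refl bridge_terms assms)

lemma trivalent_terms:
  assumes "n \<ge> 2" "6 * g + 2 * n \<ge> 10"
  shows "rconst (1 / 16 * ((4 * real g - 4 + real n) * real n * (real n - 1)
      / ((6 * real g - 7 + 2 * real n) * (6 * real g - 8 + 2 * real n)))) * formal_V 0 3 * formal_V g (n - 1) =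
    rconst (vol_const g n * (1 / 16)) * sum (splitting_term n) (trivalent_splittings g n)"
proof -
  have "formal_V g (n - 1) = rconst (vol_const g (n - 1)) * graph_series g (n - 1)"
    using assms by (intro formal_V_eq) auto
  then have "rconst (1 / 16 * ((4 * real g - 4 + real n) * real n * (real n - 1)
      / ((6 * real g - 7 + 2 * real n) * (6 * real g - 8 + 2 * real n)))) * formal_V 0 3 * formal_V g (n - 1) =
    rconst (1 / 16 * ((4 * real g - 4 + real n) * real n * (real n - 1)
      / ((6 * real g - 7 + 2 * real n) * (6 * real g - 8 + 2 * real n))) * (4 * vol_const g (n - 1))) * (graph_series 0 3 * graph_series g (n - 1))"
    by (simp only: formal_V_03 rconst_mult mult_ac)
  also have "\<dots> = rconst (vol_const g n * (1 / 16)) * (rconst (real n * (real n - 1)) * (graph_series 0 3 * graph_series g (n - 1)))"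
    unfolding trivalent_coefficient[OF assms] by (simp only: rconst_mult mult_ac)
  also have "rconst (real n * (real n - 1)) * (graph_series 0 3 * graph_series g (n - 1)) =
      sum (splitting_term n) (trivalent_splittings g n)"
  proof -
    obtain m where m: "n = m + 2" using assms(1) by (metis le_Suc_ex add.commute)
    \<comment> \<open>Either component can be the trivalent one, and it carries two of the \<open>n\<close> old legs.\<close>
    have "real n * (real n - 1) = 2 * real (n choose 2)"
      unfolding m by (simp add: binomial_fact field_simps)
    then have "real n * (real n - 1) = of_nat ((n choose 2) + (n choose 2))" by simp
    then have "rconst (real n * (real n - 1)) = of_nat ((n choose 2) + (n choose 2))"
      by (simp only: rconst_of_nat)
    moreover have "n choose (n - 1 - 1) = n choose 2"
      using binomial_symmetric[of 2 n] assms(1) by (simp add: numeral_2_eq_2)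
    moreover have "(0, 3, g, n - 1) \<noteq> (g, n - 1, 0, 3)"
      using assms by auto
    ultimately show ?thesis
      using assms(1) by (simp add: splitting_term_def trivalent_splittings_def distrib_right mult.commute)
  qed
  finally show ?thesis .
qed

theorem theorem1p16:
  shows "(\<forall>g n :: nat. g \<ge> 1 \<longrightarrow> 2 * g + n > 3 \<longrightarrow>
      formal_A g n =
        (\<Sum>(g1, n1, g2, n2) \<in> {(g1, n1, g2, n2). g1 + g2 = g \<and> n1 + n2 = n + 2 \<and>
              n1 \<ge> 1 \<and> n2 \<ge> 1 \<and> dim_d g1 n1 \<ge> 1 \<and> dim_d g2 n2 \<ge> 1}.
           rconst (1 / 8
             * (fact (dim_l g n) / (fact (dim_l g1 n1) * fact (dim_l g2 n2)))
             * (fact n / (fact (n1 - 1) * fact (n2 - 1)))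
             * (fact (dim_d g1 n1 - 1) * fact (dim_d g2 n2 - 1) / fact (dim_d g n - 1)))
           * formal_V g1 n1 * formal_V g2 n2)
        + rconst (1 / 16
             * ((4 * real g - 4 + real n) * real n * (real n - 1)
                / ((6 * real g - 7 + 2 * real n) * (6 * real g - 8 + 2 * real n))))
          * formal_V 0 3 * formal_V g (n - 1)
        + rconst (fact (dim_l g n) / fact (dim_l g n - 2)
             * (fact (dim_d g n - 3) / fact (dim_d g n - 1)))
          * formal_V (g - 1) (n + 2))
    \<and> (\<forall>n :: nat. n \<ge> 4 \<longrightarrow>
      formal_A 0 n =
        (\<Sum>(n1, n2) \<in> {(n1, n2). n1 + n2 = n + 2 \<and> n1 \<ge> 4 \<and> n2 \<ge> 4}.
           rconst (1 / 8
             * (fact (n - 4) / (fact (n1 - 4) * fact (n2 - 4)))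
             * (fact n / (fact (n1 - 1) * fact (n2 - 1)))
             * (fact (2 * n1 - 7) * fact (2 * n2 - 7) / fact (2 * n - 7)))
           * formal_V 0 n1 * formal_V 0 n2)
        + (if n = 4 then
             rconst (1 / 8 * (fact 4 / (fact 2 * fact 2)) * (1 / 2) * (1 / 2))
             * formal_V 0 3 * formal_V 0 3
           else
             rconst (1 / 16
               * ((real n - 4) * real n * (real n - 1)
                  / ((2 * real n - 7) * (2 * real n - 8))))
             * formal_V 0 3 * formal_V 0 (n - 1)))"
proof (intro conjI allI impI, goal_cases)
  case (1 g n)
  then have ne: "(g, n) \<noteq> (0, 3)" "(g - 1, n + 2) \<noteq> (0, 3)" by auto
  let ?D = "sum (splitting_term n) (stable_splittings g n)"
    and ?E = "sum (splitting_term n) (trivalent_splittings g n)"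
  have "formal_A g n = rconst (vol_const g n * (1 / 16)) * ?D + rconst (vol_const g n * (1 / 16)) * ?E
      + rconst (vol_const g n * (1 / 4)) * graph_series (g - 1) (n + 2)"
    using 1(1) unfolding formal_A_eq[of g n] sum_splittings[OF 1(2)]
    by (simp only: rconst_mult distrib_left mult.assoc add_ac) simp
  moreover have "rconst (vol_const g n * (1 / 16)) * ?E =
      rconst (1 / 16 * ((4 * real g - 4 + real n) * real n * (real n - 1)
        / ((6 * real g - 7 + 2 * real n) * (6 * real g - 8 + 2 * real n))))
          * formal_V 0 3 * formal_V g (n - 1)"
  proof (cases "n \<ge> 2")
    case True
    then show ?thesis
      using trivalent_terms[of n g] 1 by simp
  next
    case False
    then have "real n * (real n - 1) = 0" by (cases "n = 0") auto
    then have "(4 * real g - 4 + real n) * real n * (real n - 1) = 0" by auto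
    then have "1 / 16 * ((4 * real g - 4 + real n) * real n * (real n - 1)
        / ((6 * real g - 7 + 2 * real n) * (6 * real g - 8 + 2 * real n))) = 0"
      by (simp only: div_0 mult_zero_right)
    then show ?thesis
      using False by (simp only: trivalent_splittings_def rconst_0 mult_zero_left if_False sum.empty mult_zero_right)
  qed
  moreover have "rconst (vol_const g n * (1 / 4)) * graph_series (g - 1) (n + 2) =
      rconst (fact (dim_l g n) / fact (dim_l g n - 2) * (fact (dim_d g n - 3) / fact (dim_d g n - 1)))
          * formal_V (g - 1) (n + 2)"
    unfolding formal_V_eq[OF ne(2)] nonbridge_coefficient[OF 1, symmetric]
    by (simp only: rconst_mult mult.assoc)
  moreover note sum_bridge_terms[OF ne(1), symmetric]
  ultimately show ?case
    by (simp only: stable_splittings_def)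
next
  case (2 n)
  then have ne: "(0::nat, n) \<noteq> (0, 3)" and st: "2 * 0 + n > 3" by auto
  let ?D = "sum (splitting_term n) (stable_splittings 0 n)"
    and ?E = "sum (splitting_term n) (trivalent_splittings 0 n)"
  have "formal_A 0 n = rconst (vol_const 0 n * (1 / 16)) * ?D + rconst (vol_const 0 n * (1 / 16)) * ?E"
    unfolding formal_A_eq[of 0 n] sum_splittings[OF st]
    by (simp add: rconst_mult distrib_left mult.assoc del: times_divide_eq_right)
  moreover have "rconst (vol_const 0 n * (1 / 16)) * ?D =
      (\<Sum>(n1, n2) \<in> {(n1, n2). n1 + n2 = n + 2 \<and> n1 \<ge> 4 \<and> n2 \<ge> 4}.
           rconst (1 / 8
             * (fact (n - 4) / (fact (n1 - 4) * fact (n2 - 4)))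
             * (fact n / (fact (n1 - 1) * fact (n2 - 1)))
             * (fact (2 * n1 - 7) * fact (2 * n2 - 7) / fact (2 * n - 7)))
           * formal_V 0 n1 * formal_V 0 n2)"
    unfolding sum_distrib_left
  proof (rule sum.reindex_bij_witness[of _ "\<lambda>(n1, n2). (0, n1, 0, n2)" "\<lambda>(g1, n1, g2, n2). (n1, n2)"], goal_cases)
    case (5 x)
    then obtain n1 n2 where x': "x = (0, n1, 0, n2)" by (auto simp: stable_splittings_def)
    show ?case
      using bridge_terms[OF ne 5] by (simp add: x' dim_l_def dim_d_def)
  qed (auto simp: stable_splittings_def dim_d_def)
  moreover have "rconst (vol_const 0 n * (1 / 16)) * ?E =
       (if n = 4 then
             rconst (1 / 8 * (fact 4 / (fact 2 * fact 2)) * (1 / 2) * (1 / 2))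
             * formal_V 0 3 * formal_V 0 3
           else
             rconst (1 / 16
               * ((real n - 4) * real n * (real n - 1)
                  / ((2 * real n - 7) * (2 * real n - 8))))
             * formal_V 0 3 * formal_V 0 (n - 1))"
  proof (cases "n = 4")
    case True
    have coefficient: "1 / 8 * (fact 4 / (fact 2 * fact 2)) * (1 / 2) * (1 / 2) = (3 / 16 :: real)"
      by (simp add: fact_numeral)
    have "vol_const 0 4 = 8" by (simp add: vol_const_def)
    moreover have "(4 choose 2 :: nat) = 6" by (simp add: numeral_eq_Suc)
    moreover have half_six: "rconst (1 / 2) * (6 * z) = rconst 3 * z" for z
      using rconst_mult[of "1 / 2" 6] rconst_of_nat[of 6] by (simp add: mult.assoc[symmetric])
    ultimately have "rconst (vol_const 0 n * (1 / 16)) * ?E = rconst (1 / 2 * 6) * (graph_series 0 3 * graph_series 0 3)"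
      using True half_six by (simp add: splitting_term_def trivalent_splittings_def)
    also have "\<dots> = rconst (3 / 16 * (4 * 4)) * (graph_series 0 3 * graph_series 0 3)" by simp
    also have "\<dots> = rconst (1 / 8 * (fact 4 / (fact 2 * fact 2)) * (1 / 2) * (1 / 2)) * formal_V 0 3 * formal_V 0 3"
      unfolding formal_V_03 coefficient rconst_mult by (simp only: mult_ac)
    finally show ?thesis using True by simp
  next
    case False
    then show ?thesis
      using trivalent_terms[of n 0] 2 by (simp add: diff_add_eq add_ac)
  qed
  ultimately show ?case by (simp only:)
qed

end
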